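(* Let $\Lambda$, the intensities, the arrays $\mathrm B,\Theta,\mathrm E,\mathrm T$ and the generator $\mathbf R$ be as in the context. For $\underline y\in\mathbb Z_+^\Lambda$ put $$U_l(\underline y)=\sum_{n\in\mathbb Z_+}\frac{\overline\lambda_l(n;\underline y)}{\overline\mu_l(n;\underline y)},\qquad C_r(\underline y)=\sum_{n\in\mathbb Z_+}\frac{\overline\lambda_r(n;\underline y)}{\overline\mu_r(n;\underline y)}\,[\overline\gamma_r(n)]^{y_r},$$ $$\Xi_\Lambda=\sum_{\underline y\in\mathbb Z_+^\Lambda}\ \prod_{r:\,y_r\ge1}\left(\frac{\xi_r}{\eta_r}\right)^{y_r}C_r(\underline y)\prod_{l:\,y_l=0}U_l(\underline y).$$ If $\Xi_\Lambda<+\infty$, then the continuous-time Markov process on $\mathbb Z_+^\Lambda\times\mathbb Z_+^\Lambda$ with generator $\mathbf R$ is positive recurrent and reversible. Its stationary probabilities are $$\pi(\underline y,\underline n)=\frac1{\Xi_\Lambda}\prod_{p\in\Lambda}\frac{\overline\lambda_p(n_p;\underline y)}{\overline\mu_p(n_p;\underline y)}\prod_{q\in\Lambda}\left[\frac{\xi_q}{\eta_q}\overline\gamma_q(n_q)\right]^{y_q}.$$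
   Context: $\Lambda$ is a finite set of sites and $\mathbb Z_+=\{0,1,2,\dots\}$. A state is $(\underline y,\underline n)$ with $\underline y=(y_s)_{s\in\Lambda}\in\mathbb Z_+^\Lambda$ (numbers of distinguished customers at the sites) and $\underline n=(n_i)_{i\in\Lambda}\in\mathbb Z_+^\Lambda$ (numbers of tasks). Write $j\in\underline y$ if $y_j\ge1$ and $l\notin\underline y$ if $y_l=0$. $\underline e^i$ is the unit vector at $i$, $\underline e^{i\to k}=\underline e^k-\underline e^i$, and $\mathbf 1$ is the indicator. Intensities. $\lambda_i(n;\underline y)\ge0$ ($n\ge0$) and $\mu_i(n;\underline y)$ ($n\ge1$) satisfy $\sup\lambda_i(n;\underline y)<\infty$ and $\inf\mu_i(n;\underline y)>0$ (over all $i,n,\underline y$), and $\lambda_i(n;\underline y)>0$ whenever $\lambda_i(n+1;\underline y)>0$. The values $\gamma_i(n)\ge0$ satisfy $\gamma_i(0)=1$ and $\gamma_i(n)>0$ whenever $\gamma_i(n+1)>0$. The numbers $\xi_k>0$, $\eta_k>0$, $k\in\Lambda$, do not depend on $\underline n,\underline y$. Set $\overline\lambda_i(0;\underline y)=\overline\mu_i(0;\underline y)=\overline\gamma_i(0)=1$ and, for $n\ge1$, $$\overline\lambda_i(n;\underline y)=\prod_{0\le m<n}\lambda_i(m;\underline y),\quad \overline\mu_i(n;\underline y)=\prod_{1\le m\le n}\mu_i(m;\underline y),\quad\overline\gamma_i(n)=\prod_{0\le m<n}\gamma_i(m).$$ It is understood that $\overline\gamma_j(n_j)>0$ wherever its reciprocal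 appears below. It is assumed that for every $\underline n\in\mathbb Z_+^\Lambda$ the product $\prod_{q\in\Lambda}\overline\lambda_q(n_q;\underline y)/\overline\mu_q(n_q;\underline y)$ does not depend on $\underline y\in\mathbb Z_+^\Lambda$. Arrays. The collections $\mathrm B(\underline n;\underline y)=(\beta_{kl}(n_k,n_l;\underline y))$, $\Theta(\underline n;\underline y)=(\theta_{kl}(n_k,n_l;\underline y))$, $\mathrm E(\underline n;\underline y)=(\epsilon_{ij}(n_i,n_j;\underline y))$, $\mathrm T(\underline n;\underline y)=(\tau_{jj'}(\underline n;\underline y))$ are irreducible, meaning that their off-diagonal entries are strictly positive. They satisfy: $$\frac{\lambda_k(n_k-1;\underline y)}{\mu_k(n_k;\underline y)}\beta_{kl}(n_k,n_l;\underline y)=\frac{\lambda_l(n_l;\underline y)}{\mu_l(n_l+1;\underline y)}\beta_{lk}(n_l+1,n_k-1;\underline y),\quad k\ne l,\ k,l\notin\underline y,\ n_k\ge1;$$ $$\frac{\lambda_j(n_j-1;\underline y)}{\mu_j(n_j;\underline y)}\theta_{jk}(n_j,n_k;\underline y)=\frac{\lambda_k(n_k;\underline y)}{\mu_k(n_k+1;\underline y)}\theta_{kj}(n_k+1,n_j-1;\underline y),\quad j\in\underline y,\ k\notin\underline y,\ n_j\ge1;$$ $$\frac{\lambda_i(n_i-1;\underline y)[\gamma_i(n_i-1)]^{y_i}}{\mu_i(n_i;\underline y)}\epsilon_{ij}(n_i,n_j;\underline y)=\frac{\lambda_j(n_j;\underline y)[\gamma_j(n_j)]^{y_j}}{\mu_j(n_j+1;\underline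 y)}\epsilon_{ji}(n_j+1,n_i-1;\underline y),\quad i\ne j,\ i,j\in\underline y,\ n_i\ge1;$$ $$\tau_{jj'}(\underline n;\underline y)\frac{\xi_j}{\eta_j}=\tau_{j'j}(\underline n;\underline y+\underline e^{j\to j'})\frac{\xi_{j'}}{\eta_{j'}},\quad j\in\underline y,\ j'\ne j.$$ The generator $\mathbf R$ has the following off-diagonal entries (all others are zero): - $R[(\underline y,\underline n);(\underline y,\underline n+\underline e^p)]=\lambda_p(n_p;\underline y)[\gamma_p(n_p)]^{y_p}$ and $R[(\underline y,\underline n);(\underline y,\underline n-\underline e^p)]=\mu_p(n_p;\underline y)\mathbf 1(n_p\ge1)$, $p\in\Lambda$; - $R[(\underline y,\underline n);(\underline y,\underline n+\underline e^{k\to l})]=\beta_{kl}(n_k,n_l;\underline y)\mathbf 1(n_k\ge1)$, $k\ne l$, $k,l\notin\underline y$; - $R[(\underline y,\underline n);(\underline y,\underline n+\underline e^{i\to j})]=\epsilon_{ij}(n_i,n_j;\underline y)\mathbf 1(n_i\ge1)$, $i\ne j$, $i,j\in\underline y$; - $R[(\underline y,\underline n);(\underline y,\underline n+\underline e^{j\to l})]=\theta_{jl}(n_j,n_l;\underline y)\mathbf 1(n_j\ge1)$, $j\in\underline y$, $l\notin\underline y$; - $R[(\underline y,\underline n);(\underline y,\underline n+\underline e^{k\to j})]=\theta_{kj}(n_k,n_j;\underline y)[\gamma_j(n_j)]^{y_j}\mathbf 1(n_k\ge1)$, $j\in\underline y$, $k\notin\underline y$; - $R[(\underline y,\underline n);(\underline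 y+\underline e^{j\to j'},\underline n)]=[\overline\gamma_j(n_j)]^{-y_j}\,\tau_{jj'}(\underline n;\underline y)\,[\overline\gamma_{j'}(n_{j'})]^{-y_{j'}}$, $j\in\underline y$, $j'\ne j$; - $R[(\underline y,\underline n);(\underline y+\underline e^p,\underline n)]=\xi_p\overline\gamma_p(n_p)$ and $R[(\underline y,\underline n);(\underline y-\underline e^p,\underline n)]=\eta_p\mathbf 1(y_p\ge1)$, $p\in\Lambda$. *)

theory Defs
  imports "HOL-Probability.Probability"
begin

section \<open>Continuous-time Markov processes on a countable state space\<close>

text \<open>
  A generator is given by its off-diagonal entries: \<open>R x z\<close> is the jump intensity from \<open>x\<close>
  to \<open>z \<noteq> x\<close>, and the diagonal entry is minus the total intensity \<open>jump_rate R x\<close>.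
  The process with generator \<open>R\<close> is the (minimal) jump process: in state \<open>x\<close> it waits for an
  exponential time with parameter \<open>jump_rate R x\<close> and then jumps to \<open>z\<close> with
  probability \<open>R x z / jump_rate R x\<close>.
\<close>

definition jump_rate :: "('a \<Rightarrow> 'a \<Rightarrow> real) \<Rightarrow> 'a \<Rightarrow> real" where
  "jump_rate R x = (\<Sum>\<^sub>\<infinity>z\<in>-{x}. R x z)"

definition jump_pmf :: "('a \<Rightarrow> 'a \<Rightarrow> real) \<Rightarrow> 'a \<Rightarrow> 'a pmf" where
  "jump_pmf R x =
     (if jump_rate R x = 0 then return_pmf x
      else embed_pmf (\<lambda>z. if z = x then 0 else R x z / jump_rate R x))"

text \<open>
  A sample point \<open>(x, d, e)\<close> consists of the initial state \<open>x\<close>, drawn from \<open>\<nu>\<close>; of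
  independent targets \<open>d (k, z)\<close>, to be used if the \<open>k\<close>-th jump (counted from 0) starts
  in \<open>z\<close>; and of independent unit exponential times \<open>e k\<close>.
\<close>

type_synonym 'a sample = "'a \<times> (nat \<times> 'a \<Rightarrow> 'a) \<times> (nat \<Rightarrow> real)"

definition ctmc_space :: "('a::countable \<Rightarrow> 'a \<Rightarrow> real) \<Rightarrow> 'a pmf \<Rightarrow> 'a sample measure" where
  "ctmc_space R \<nu> =
     measure_pmf \<nu> \<Otimes>\<^sub>M
     ((\<Pi>\<^sub>M (k, z) \<in> UNIV. measure_pmf (jump_pmf R z)) \<Otimes>\<^sub>M
      (\<Pi>\<^sub>M k \<in> UNIV. density lborel (\<lambda>s. ennreal (exponential_density 1 s))))"

primrec jump_chain :: "'a sample \<Rightarrow> nat \<Rightarrow> 'a" where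
  "jump_chain \<omega> 0 = fst \<omega>"
| "jump_chain \<omega> (Suc k) = fst (snd \<omega>) (k, jump_chain \<omega> k)"

text \<open>The holding time is infinite in an absorbing state, as \<open>c / 0 = \<infinity>\<close> in \<open>ennreal\<close> for \<open>c > 0\<close>.\<close>

definition holding_time :: "('a \<Rightarrow> 'a \<Rightarrow> real) \<Rightarrow> 'a sample \<Rightarrow> nat \<Rightarrow> ennreal" where
  "holding_time R \<omega> k = ennreal (snd (snd \<omega>) k) / ennreal (jump_rate R (jump_chain \<omega> k))"

definition jump_time :: "('a \<Rightarrow> 'a \<Rightarrow> real) \<Rightarrow> 'a sample \<Rightarrow> nat \<Rightarrow> ennreal" where
  "jump_time R \<omega> k = (\<Sum>i<k. holding_time R \<omega> i)"

text \<open>The state at time \<open>t\<close>; it is \<open>None\<close> from the explosion time on.\<close>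

definition ctmc :: "('a \<Rightarrow> 'a \<Rightarrow> real) \<Rightarrow> real \<Rightarrow> 'a sample \<Rightarrow> 'a option" where
  "ctmc R t \<omega> =
     (if \<exists>k. ennreal t < jump_time R \<omega> (Suc k)
      then Some (jump_chain \<omega> (LEAST k. ennreal t < jump_time R \<omega> (Suc k)))
      else None)"

definition return_time :: "('a \<Rightarrow> 'a \<Rightarrow> real) \<Rightarrow> 'a \<Rightarrow> 'a sample \<Rightarrow> ennreal" where
  "return_time R x \<omega> =
     Inf {ennreal t | t. 0 \<le> t \<and> jump_time R \<omega> 1 \<le> ennreal t \<and> ctmc R t \<omega> = Some x}"

definition positive_recurrent_state :: "('a::countable \<Rightarrow> 'a \<Rightarrow> real) \<Rightarrow> 'a \<Rightarrow> bool" where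
  "positive_recurrent_state R x \<longleftrightarrow>
     jump_rate R x = 0 \<or> (\<integral>\<^sup>+\<omega>. return_time R x \<omega> \<partial>ctmc_space R (return_pmf x)) < \<infinity>"

definition accessible :: "('a \<Rightarrow> 'a \<Rightarrow> real) \<Rightarrow> 'a \<Rightarrow> 'a \<Rightarrow> bool" where
  "accessible R x z \<longleftrightarrow> (x, z) \<in> {(u, v). u \<noteq> v \<and> R u v > 0}\<^sup>*"

text \<open>
  Inessential states are allowed: the process has a closed communicating class \<open>C\<close> of positive
  recurrent states, and \<open>C\<close> is entered almost surely from every initial state. If
  the process is irreducible, then necessarily \<open>C = UNIV\<close>, and this is the usual notion. In the
  network below inessential states occur when intensities \<open>\<lambda>\<^sub>i(n)\<close> vanish from some \<open>n\<close> on.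
\<close>

definition positive_recurrent :: "('a::countable \<Rightarrow> 'a \<Rightarrow> real) \<Rightarrow> bool" where
  "positive_recurrent R \<longleftrightarrow>
     (\<exists>C. C \<noteq> {} \<and>
          (\<forall>x\<in>C. \<forall>z. accessible R x z \<longleftrightarrow> z \<in> C) \<and>
          (\<forall>x\<in>C. positive_recurrent_state R x) \<and>
          (\<forall>x. AE \<omega> in ctmc_space R (return_pmf x). \<exists>t\<ge>0. \<exists>z\<in>C. ctmc R t \<omega> = Some z))"

definition stationary_distribution :: "('a::countable \<Rightarrow> 'a \<Rightarrow> real) \<Rightarrow> 'a pmf \<Rightarrow> bool" where
  "stationary_distribution R \<nu> \<longleftrightarrow>
     (\<forall>t\<ge>0. \<forall>z. \<P>(\<omega> in ctmc_space R \<nu>. ctmc R t \<omega> = Some z) = pmf \<nu> z)"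

text \<open>
  Started from \<open>\<nu>\<close>, the process and its time reversal on every interval \<open>[0, T]\<close> have the same
  finite-dimensional distributions.
\<close>

definition reversible_from :: "('a::countable \<Rightarrow> 'a \<Rightarrow> real) \<Rightarrow> 'a pmf \<Rightarrow> bool" where
  "reversible_from R \<nu> \<longleftrightarrow>
     (\<forall>(T::real) (m::nat) (t::nat \<Rightarrow> real) (z::nat \<Rightarrow> 'a).
        (\<forall>i<m. 0 \<le> t i \<and> t i \<le> T) \<longrightarrow>
        \<P>(\<omega> in ctmc_space R \<nu>. \<forall>i<m. ctmc R (t i) \<omega> = Some (z i)) =
        \<P>(\<omega> in ctmc_space R \<nu>. \<forall>i<m. ctmc R (T - t i) \<omega> = Some (z i)))"


section \<open>The queueing network with distinguished customers\<close>

text \<open>The set of sites is a finite type \<open>'s\<close>; a state is a pair \<open>(y, n)\<close>.\<close>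

type_synonym 's config = "'s \<Rightarrow> nat"
type_synonym 's state = "'s config \<times> 's config"

definition add_at :: "'s \<Rightarrow> 's config \<Rightarrow> 's config" where
  "add_at p v = v(p := v p + 1)"

text \<open>The next two are only used if \<open>v p \<ge> 1\<close>, resp. \<open>v i \<ge> 1\<close> and \<open>i \<noteq> k\<close>.\<close>

definition remove_at :: "'s \<Rightarrow> 's config \<Rightarrow> 's config" where
  "remove_at p v = v(p := v p - 1)"

definition move :: "'s \<Rightarrow> 's \<Rightarrow> 's config \<Rightarrow> 's config" where
  "move i k v = v(i := v i - 1, k := v k + 1)"

definition lam_bar :: "('s \<Rightarrow> nat \<Rightarrow> 's config \<Rightarrow> real) \<Rightarrow> 's \<Rightarrow> nat \<Rightarrow> 's config \<Rightarrow> real" where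
  "lam_bar lam i n y = (\<Prod>m<n. lam i m y)"

definition mu_bar :: "('s \<Rightarrow> nat \<Rightarrow> 's config \<Rightarrow> real) \<Rightarrow> 's \<Rightarrow> nat \<Rightarrow> 's config \<Rightarrow> real" where
  "mu_bar mu i n y = (\<Prod>m=1..n. mu i m y)"

definition gam_bar :: "('s \<Rightarrow> nat \<Rightarrow> real) \<Rightarrow> 's \<Rightarrow> nat \<Rightarrow> real" where
  "gam_bar gam i n = (\<Prod>m<n. gam i m)"

text \<open>
  The listed transitions have pairwise distinct targets, all different from the
  current state, so at most one summand is non-zero. The diagonal is not part of this function
  (it is 0 here).
\<close>

fun network_rate ::
  "('s::finite \<Rightarrow> nat \<Rightarrow> 's config \<Rightarrow> real) \<Rightarrow> ('s \<Rightarrow> nat \<Rightarrow> 's config \<Rightarrow> real) \<Rightarrow>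
   ('s \<Rightarrow> nat \<Rightarrow> real) \<Rightarrow> ('s \<Rightarrow> real) \<Rightarrow> ('s \<Rightarrow> real) \<Rightarrow>
   ('s \<Rightarrow> 's \<Rightarrow> nat \<Rightarrow> nat \<Rightarrow> 's config \<Rightarrow> real) \<Rightarrow>
   ('s \<Rightarrow> 's \<Rightarrow> nat \<Rightarrow> nat \<Rightarrow> 's config \<Rightarrow> real) \<Rightarrow>
   ('s \<Rightarrow> 's \<Rightarrow> nat \<Rightarrow> nat \<Rightarrow> 's config \<Rightarrow> real) \<Rightarrow>
   ('s \<Rightarrow> 's \<Rightarrow> 's config \<Rightarrow> 's config \<Rightarrow> real) \<Rightarrow>
   's state \<Rightarrow> 's state \<Rightarrow> real" where
  "network_rate lam mu gam xi eta beta theta eps tau (y, n) (y', n') =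
     (\<Sum>p\<in>UNIV. if y' = y \<and> n' = add_at p n
        then lam p (n p) y * gam p (n p) ^ y p else 0)
   + (\<Sum>p\<in>UNIV. if y' = y \<and> n p \<ge> 1 \<and> n' = remove_at p n
        then mu p (n p) y else 0)
   + (\<Sum>k\<in>UNIV. \<Sum>l\<in>UNIV. if k \<noteq> l \<and> y k = 0 \<and> y l = 0 \<and> n k \<ge> 1 \<and> y' = y \<and> n' = move k l n
        then beta k l (n k) (n l) y else 0)
   + (\<Sum>i\<in>UNIV. \<Sum>j\<in>UNIV. if i \<noteq> j \<and> y i \<ge> 1 \<and> y j \<ge> 1 \<and> n i \<ge> 1 \<and> y' = y \<and> n' = move i j n
        then eps i j (n i) (n j) y else 0)
   + (\<Sum>j\<in>UNIV. \<Sum>l\<in>UNIV. if y j \<ge> 1 \<and> y l = 0 \<and> n j \<ge> 1 \<and> y' = y \<and> n' = move j l n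
        then theta j l (n j) (n l) y else 0)
   + (\<Sum>k\<in>UNIV. \<Sum>j\<in>UNIV. if y k = 0 \<and> y j \<ge> 1 \<and> n k \<ge> 1 \<and> y' = y \<and> n' = move k j n
        then theta k j (n k) (n j) y * gam j (n j) ^ y j else 0)
   + (\<Sum>j\<in>UNIV. \<Sum>j'\<in>UNIV. if y j \<ge> 1 \<and> j' \<noteq> j \<and> y' = move j j' y \<and> n' = n
        then inverse (gam_bar gam j (n j) ^ y j) * tau j j' n y
               * inverse (gam_bar gam j' (n j') ^ y j') else 0)
   + (\<Sum>p\<in>UNIV. if y' = add_at p y \<and> n' = n
        then xi p * gam_bar gam p (n p) else 0)
   + (\<Sum>p\<in>UNIV. if y p \<ge> 1 \<and> y' = remove_at p y \<and> n' = n
        then eta p else 0)"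

definition U_sum ::
  "('s \<Rightarrow> nat \<Rightarrow> 's config \<Rightarrow> real) \<Rightarrow> ('s \<Rightarrow> nat \<Rightarrow> 's config \<Rightarrow> real) \<Rightarrow>
   's \<Rightarrow> 's config \<Rightarrow> ennreal" where
  "U_sum lam mu l y = (\<Sum>n. ennreal (lam_bar lam l n y / mu_bar mu l n y))"

definition C_sum ::
  "('s \<Rightarrow> nat \<Rightarrow> 's config \<Rightarrow> real) \<Rightarrow> ('s \<Rightarrow> nat \<Rightarrow> 's config \<Rightarrow> real) \<Rightarrow>
   ('s \<Rightarrow> nat \<Rightarrow> real) \<Rightarrow> 's \<Rightarrow> 's config \<Rightarrow> ennreal" where
  "C_sum lam mu gam r y =
     (\<Sum>n. ennreal (lam_bar lam r n y / mu_bar mu r n y * gam_bar gam r n ^ y r))"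

definition Xi_sum ::
  "('s::finite \<Rightarrow> nat \<Rightarrow> 's config \<Rightarrow> real) \<Rightarrow> ('s \<Rightarrow> nat \<Rightarrow> 's config \<Rightarrow> real) \<Rightarrow>
   ('s \<Rightarrow> nat \<Rightarrow> real) \<Rightarrow> ('s \<Rightarrow> real) \<Rightarrow> ('s \<Rightarrow> real) \<Rightarrow> ennreal" where
  "Xi_sum lam mu gam xi eta =
     (\<Sum>\<^sub>\<infinity>y\<in>UNIV. (\<Prod>r | y r \<ge> 1. ennreal ((xi r / eta r) ^ y r) * C_sum lam mu gam r y)
                 * (\<Prod>l | y l = 0. U_sum lam mu l y))"

end

theory Submission imports Defs begin

text \<open>
  The product weights satisfy detailed balance. The finite boxes of states with at most \<open>N\<close> tasks and at
  most \<open>M\<close> customers have arbitrarily small boundary conductance: moves inside the network keep both totals, so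
  only arrivals cross the boundary, and finiteness of \<open>\<Xi>\<close> forces the factors
  \<open>\<xi>\<^sub>q / \<eta>\<^sub>q \<cdot> \<gamma>\<^sub>q(n\<^sub>q)\<close> (with the product \<open>\<gamma>\<close>) to be at most 1, which bounds the flow of arrivals. By Green's
  identity the probability that the jump chain escapes from a state is at most the boundary conductance divided by
  the weight of the state, so the chain is recurrent; in particular the process does not explode.
  Self-adjointness of the jump operator bounds the mean return time.

  Reversibility is seen on paths: the density of a path with prescribed jump times is a product of rates, symmetric
  by detailed balance, times an iterated integral of exponentials that is symmetric under \<open>t \<mapsto> T - t\<close>.
  From states of weight 0 no task arrives, and a maximum principle shows that the support is reached.
\<close>

section \<open>Jump processes with finite out-degrees\<close>

definition target_space :: "('a::countable \<Rightarrow> 'a \<Rightarrow> real) \<Rightarrow> (nat \<times> 'a \<Rightarrow> 'a) measure" where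
  "target_space R = (\<Pi>\<^sub>M (k, z) \<in> UNIV. measure_pmf (jump_pmf R z))"

definition clock_space :: "(nat \<Rightarrow> real) measure" where
  "clock_space = (\<Pi>\<^sub>M k \<in> UNIV. density lborel (\<lambda>s. ennreal (exponential_density 1 s)))"

lemma ctmc_space_eq: "ctmc_space R \<nu> = measure_pmf \<nu> \<Otimes>\<^sub>M (target_space R \<Otimes>\<^sub>M clock_space)"
  by (simp add: ctmc_space_def target_space_def clock_space_def)

lemma prob_space_exp1: "prob_space (density lborel (\<lambda>s. ennreal (exponential_density 1 s)))"
  by (rule prob_space_exponential_density) simp

lemma prob_space_target: "prob_space (target_space R)"
  unfolding target_space_def
  by (intro prob_space_PiM) (auto simp: split_beta prob_space_measure_pmf)

lemma prob_space_clock: "prob_space clock_space"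
  unfolding clock_space_def by (intro prob_space_PiM prob_space_exp1)

interpretation clock: prob_space clock_space by (rule prob_space_clock)

lemma prob_space_target_clock: "prob_space (target_space R \<Otimes>\<^sub>M clock_space)"
proof -
  interpret T: prob_space "target_space R" by (rule prob_space_target)
  interpret pair_prob_space "target_space R" clock_space by standard
  show ?thesis by unfold_locales
qed

lemma prob_space_ctmc: "prob_space (ctmc_space R \<nu>)"
proof -
  interpret T: prob_space "target_space R \<Otimes>\<^sub>M clock_space" by (rule prob_space_target_clock)
  interpret N: prob_space "measure_pmf \<nu>" by (rule prob_space_measure_pmf)
  interpret pair_prob_space "measure_pmf \<nu>" "target_space R \<Otimes>\<^sub>M clock_space" by standard
  show ?thesis unfolding ctmc_space_eq by unfold_locales
qed

lemma sets_target [measurable_cong]: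
  "sets (target_space R) = sets (\<Pi>\<^sub>M i\<in>UNIV. count_space UNIV)"
  unfolding target_space_def by (rule sets_PiM_cong) (auto simp: split_beta)

lemma sets_clock [measurable_cong]: "sets clock_space = sets (\<Pi>\<^sub>M i\<in>UNIV. borel)"
  unfolding clock_space_def by (rule sets_PiM_cong) auto

lemma sets_ctmc [measurable_cong]:
  "sets (ctmc_space R \<nu>) = sets (count_space UNIV \<Otimes>\<^sub>M
     ((\<Pi>\<^sub>M i\<in>UNIV. count_space UNIV) \<Otimes>\<^sub>M (\<Pi>\<^sub>M i\<in>UNIV. borel)))"
  unfolding ctmc_space_eq by (intro sets_pair_measure_cong sets_target sets_clock) auto

lemma space_target [simp]: "space (target_space R) = UNIV"
  using sets_eq_imp_space_eq[OF sets_target] by (simp add: space_PiM)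

lemma space_clock [simp]: "space clock_space = UNIV"
  using sets_eq_imp_space_eq[OF sets_clock] by (simp add: space_PiM)

lemma space_ctmc [simp]: "space (ctmc_space R \<nu>) = UNIV"
  by (simp add: ctmc_space_eq space_pair_measure)

lemma measurable_jump_chain [measurable]:
  "(\<lambda>\<omega>. jump_chain \<omega> k) \<in> ctmc_space R \<nu> \<rightarrow>\<^sub>M count_space UNIV"
proof (induction k)
  case (Suc k)
  note [measurable] = Suc
  have "(\<lambda>\<omega>. (\<lambda>z. fst (snd \<omega>) (k, z)) (jump_chain \<omega> k)) \<in> ctmc_space R \<nu> \<rightarrow>\<^sub>M count_space UNIV"
    by measurable
  then show ?case by simp
qed (simp, measurable)

lemma measurable_jump_time [measurable]:
  "(\<lambda>\<omega>. jump_time R \<omega> k) \<in> borel_measurable (ctmc_space R \<nu>)"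
  unfolding jump_time_def holding_time_def by measurable

lemma mono_jump_time: "mono (jump_time R \<omega>)"
  unfolding jump_time_def mono_def by (auto intro!: sum_mono2)

lemma ctmc_eq_Some_iff:
  "ctmc R t \<omega> = Some z \<longleftrightarrow>
   (\<exists>k. jump_time R \<omega> k \<le> ennreal t \<and> ennreal t < jump_time R \<omega> (Suc k) \<and> jump_chain \<omega> k = z)"
proof -
  let ?P = "\<lambda>k. ennreal t < jump_time R \<omega> (Suc k)"
  have *: "(LEAST k. ?P k) = k" if "jump_time R \<omega> k \<le> ennreal t" "?P k" for k
  proof (rule Least_equality)
    show "?P k" by fact
    fix j assume "?P j"
    show "k \<le> j"
    proof (rule ccontr)
      assume "\<not> k \<le> j"
      then have "jump_time R \<omega> (Suc j) \<le> jump_time R \<omega> k"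
        by (intro monoD[OF mono_jump_time]) auto
      with \<open>?P j\<close> that show False by auto
    qed
  qed
  have "jump_time R \<omega> (LEAST k. ?P k) \<le> ennreal t" if "\<exists>k. ?P k"
  proof (cases "LEAST k. ?P k")
    case 0 then show ?thesis by (simp add: jump_time_def)
  next
    case (Suc j)
    then have "\<not> ?P j" using not_less_Least[of j ?P] by simp
    then show ?thesis using Suc by simp
  qed
  moreover have "?P (LEAST k. ?P k)" if "\<exists>k. ?P k"
    using that by (rule LeastI_ex)
  ultimately have **: "jump_time R \<omega> (LEAST k. ?P k) \<le> ennreal t \<and> ?P (LEAST k. ?P k)" if "\<exists>k. ?P k"
    using that by blast
  show ?thesis
  proof (cases "\<exists>k. ?P k")
    case True
    then have "ctmc R t \<omega> = Some (jump_chain \<omega> (LEAST k. ?P k))" by (simp only: ctmc_def if_True)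
    then show ?thesis using **[OF True] * by (metis option.inject)
  next
    case False
    then show ?thesis by (simp add: ctmc_def)
  qed
qed

lemma measurable_ctmc_eq [measurable]:
  "Measurable.pred (ctmc_space R \<nu>) (\<lambda>\<omega>. ctmc R t \<omega> = Some z)"
  unfolding ctmc_eq_Some_iff by measurable

fun weight :: "('a \<Rightarrow> 'a pmf) \<Rightarrow> 'a list \<Rightarrow> real" where
  "weight P (x # z # zs) = pmf (P x) z * weight P (z # zs)"
| "weight P _ = 1"

lemma weight_nonneg: "0 \<le> weight P xs"
  by (induction P xs rule: weight.induct) auto

lemma weight_eq_prod: "weight P xs = (\<Prod>i<length xs - 1. pmf (P (xs ! i)) (xs ! Suc i))"
proof (induction P xs rule: weight.induct)
  case (1 P x z zs)
  have "weight P (x # z # zs) = pmf (P x) z * (\<Prod>i<length zs. pmf (P ((z # zs) ! i)) ((z # zs) ! Suc i))"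
    using 1 by simp
  also have "\<dots> = (\<Prod>i<Suc (length zs). pmf (P ((x # z # zs) ! i)) ((x # z # zs) ! Suc i))"
    unfolding prod.lessThan_Suc_shift by simp
  finally show ?case by simp
qed simp_all

definition history :: "'a sample \<Rightarrow> nat \<Rightarrow> 'a list" where
  "history \<omega> n = map (jump_chain \<omega>) [0..<Suc n]"

lemma length_history [simp]: "length (history \<omega> n) = Suc n"
  by (simp add: history_def)

lemma nth_history: "i \<le> n \<Longrightarrow> history \<omega> n ! i = jump_chain \<omega> i"
  by (simp add: history_def del: upt_Suc)

lemma measurable_history [measurable]:
  "(\<lambda>\<omega>. history \<omega> n) \<in> ctmc_space R \<nu> \<rightarrow>\<^sub>M count_space UNIV"
proof -
  have "{\<omega>. history \<omega> n = xs} \<in> sets (ctmc_space R \<nu>)" for xs :: "'a list"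
  proof -
    have "{\<omega>. history \<omega> n = xs} = {\<omega> \<in> space (ctmc_space R \<nu>).
      length xs = Suc n \<and> (\<forall>i\<le>n. jump_chain \<omega> i = xs ! i)}"
      by (auto simp: list_eq_iff_nth_eq nth_history less_Suc_eq_le)
    then show ?thesis by (simp only:) measurable
  qed
  then show ?thesis
    by (simp add: measurable_count_space_eq2_countable vimage_def)
qed

lemma measurable_clocks [measurable]:
  "(\<lambda>\<omega>. snd (snd \<omega>)) \<in> ctmc_space R \<nu> \<rightarrow>\<^sub>M clock_space"
  unfolding ctmc_space_eq by measurable

lemma history_eq_iff:
  assumes "xs \<noteq> []"
  shows "history (x, d, e) (length xs - 1) = xs \<longleftrightarrow>
         x = hd xs \<and> (\<forall>i<length xs - 1. d (i, xs ! i) = xs ! Suc i)"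
proof -
  have "(\<forall>i<length xs. jump_chain (x, d, e) i = xs ! i) \<longleftrightarrow>
        x = hd xs \<and> (\<forall>i<length xs - 1. d (i, xs ! i) = xs ! Suc i)" (is "?L \<longleftrightarrow> ?R")
  proof
    assume L: ?L
    have "x = hd xs" using L[rule_format, of 0] assms by (simp add: hd_conv_nth)
    moreover have "d (i, xs ! i) = xs ! Suc i" if "i < length xs - 1" for i
    proof -
      have "jump_chain (x, d, e) i = xs ! i" "jump_chain (x, d, e) (Suc i) = xs ! Suc i"
        using L[rule_format, of i] L[rule_format, of "Suc i"] that by linarith+
      then show ?thesis by simp
    qed
    ultimately show ?R by blast
  next
    assume R: ?R
    have "i < length xs \<Longrightarrow> jump_chain (x, d, e) i = xs ! i" for i
    proof (induction i)
      case 0 then show ?case using R assms by (simp add: hd_conv_nth)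
    next
      case (Suc i)
      then have "jump_chain (x, d, e) i = xs ! i" "i < length xs - 1" by auto
      then show ?case using R by simp
    qed
    then show ?L by blast
  qed
  moreover have "history (x, d, e) (length xs - 1) = xs \<longleftrightarrow>
      (\<forall>i<length xs. jump_chain (x, d, e) i = xs ! i)"
  proof -
    have "Suc (length xs - 1) = length xs" using assms by (cases xs) auto
    then show ?thesis unfolding history_def list_eq_iff_nth_eq by (simp del: upt_Suc)
  qed
  ultimately show ?thesis by (simp only:)
qed

lemma emeasure_history_clock:
  assumes xs: "xs \<noteq> []" and B [measurable]: "B \<in> sets clock_space"
  shows "emeasure (ctmc_space R \<nu>) {\<omega>. history \<omega> (length xs - 1) = xs \<and> snd (snd \<omega>) \<in> B} =
         ennreal (pmf \<nu> (hd xs) * weight (jump_pmf R) xs) * emeasure clock_space B"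
proof -
  let ?n = "length xs - 1"
  let ?M = "\<lambda>(k::nat, z). measure_pmf (jump_pmf R z)"
  let ?J = "(\<lambda>i. (i, xs ! i)) ` {..<?n}"
  let ?X = "\<lambda>(i, z). {xs ! Suc i}"
  let ?D = "prod_emb UNIV ?M ?J (Pi\<^sub>E ?J ?X)"
  have D_eq: "?D = {d. \<forall>i<?n. d (i, xs ! i) = xs ! Suc i}"
    by (auto simp: prod_emb_def space_PiM PiE_def Pi_def split_beta)
  have D_sets: "?D \<in> sets (target_space R)"
    unfolding target_space_def by (intro sets_PiM_I) (auto simp: split_beta)
  interpret T: prob_space "target_space R" by (rule prob_space_target)
  interpret TC: prob_space "target_space R \<Otimes>\<^sub>M clock_space" by (rule prob_space_target_clock)
  have "emeasure (target_space R) {d. \<forall>i<?n. d (i, xs ! i) = xs ! Suc i} = (\<Prod>i\<in>?J. emeasure (?M i) (?X i))"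
    unfolding D_eq[symmetric] target_space_def
    by (subst emeasure_PiM_emb) (auto simp: split_beta prob_space_measure_pmf)
  also have "\<dots> = (\<Prod>i<?n. ennreal (pmf (jump_pmf R (xs ! i)) (xs ! Suc i)))"
    by (subst prod.reindex) (auto simp: inj_on_def emeasure_pmf_single)
  also have "\<dots> = ennreal (weight (jump_pmf R) xs)"
    by (simp add: weight_eq_prod prod_ennreal)
  finally have D: "emeasure (target_space R) {d. \<forall>i<?n. d (i, xs ! i) = xs ! Suc i} = ennreal (weight (jump_pmf R) xs)" .
  have "{\<omega>. history \<omega> ?n = xs \<and> snd (snd \<omega>) \<in> B} =
      {hd xs} \<times> ({d. \<forall>i<?n. d (i, xs ! i) = xs ! Suc i} \<times> B)"
    using history_eq_iff[OF xs] by (auto simp del: One_nat_def)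
  then show ?thesis
    using D_sets D unfolding ctmc_space_eq D_eq
    by (simp add: TC.emeasure_pair_measure_Times clock.emeasure_pair_measure_Times
        emeasure_pmf_single ennreal_mult weight_nonneg mult.assoc)
qed

primrec path_pmf :: "('a \<Rightarrow> 'a pmf) \<Rightarrow> nat \<Rightarrow> 'a \<Rightarrow> 'a list pmf" where
  "path_pmf P 0 x = return_pmf [x]"
| "path_pmf P (Suc n) x = bind_pmf (P x) (\<lambda>z. map_pmf ((#) x) (path_pmf P n z))"

lemma set_path_pmf: "xs \<in> set_pmf (path_pmf P n x) \<Longrightarrow> length xs = Suc n \<and> hd xs = x"
  by (induction n arbitrary: x xs) auto

lemma pmf_path_pmf:
  "pmf (path_pmf P n x) xs = (if length xs = Suc n \<and> hd xs = x then weight P xs else 0)"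
proof (induction n arbitrary: x xs)
  case 0
  then show ?case by (cases xs) (auto simp: pmf_return)
next
  case (Suc n)
  show ?case
  proof (cases "length xs = Suc (Suc n) \<and> hd xs = x")
    case False
    then have "xs \<notin> set_pmf (path_pmf P (Suc n) x)" using set_path_pmf by metis
    then show ?thesis using False by (auto simp: set_pmf_iff simp del: path_pmf.simps set_bind_pmf)
  next
    case True
    then obtain z zs where xs: "xs = x # z # zs" "length zs = n"
      by (cases xs; cases "tl xs") auto
    have "pmf (map_pmf ((#) x) (path_pmf P n z')) xs = indicator {z} z' * weight P (z # zs)" for z'
      unfolding xs by (subst pmf_map_inj') (auto simp: Suc xs inj_on_def indicator_def)
    then have "pmf (path_pmf P (Suc n) x) xs = weight P xs"
      by (simp add: pmf_bind xs measure_pmf_single)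
    then show ?thesis using True by simp
  qed
qed

lemma distr_history:
  "distr (ctmc_space R \<nu>) (count_space UNIV \<Otimes>\<^sub>M clock_space) (\<lambda>\<omega>. (history \<omega> n, snd (snd \<omega>))) =
   measure_pmf (bind_pmf \<nu> (path_pmf (jump_pmf R) n)) \<Otimes>\<^sub>M clock_space" (is "?D = ?M1 \<Otimes>\<^sub>M _")
proof -
  interpret M1: prob_space ?M1 by (rule prob_space_measure_pmf)
  have C: "emeasure (ctmc_space R \<nu>) {\<omega>. history \<omega> n = xs \<and> snd (snd \<omega>) \<in> B} =
     ennreal (pmf (bind_pmf \<nu> (path_pmf (jump_pmf R) n)) xs) * emeasure clock_space B"
    if B: "B \<in> sets clock_space" for xs B
  proof (cases "length xs = Suc n")
    case False
    then have "{\<omega>. history \<omega> n = xs \<and> snd (snd \<omega>) \<in> B} = {}" by auto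
    moreover have "xs \<notin> set_pmf (bind_pmf \<nu> (path_pmf (jump_pmf R) n))"
      using False by (auto dest: set_path_pmf)
    ultimately show ?thesis by (simp only: set_pmf_iff) simp
  next
    case True
    then have "pmf (bind_pmf \<nu> (path_pmf (jump_pmf R) n)) xs =
      (\<integral>x. indicator {hd xs} x * weight (jump_pmf R) xs \<partial>measure_pmf \<nu>)"
      unfolding pmf_bind by (intro Bochner_Integration.integral_cong) (auto simp: pmf_path_pmf indicator_def)
    also have "\<dots> = pmf \<nu> (hd xs) * weight (jump_pmf R) xs"
      by (simp add: measure_pmf_single)
    finally show ?thesis
      using emeasure_history_clock[of xs B R \<nu>] B True by (cases xs) auto
  qed
  show ?thesis
  proof (rule pair_measure_eqI[symmetric])
    show "sigma_finite_measure ?M1" "sigma_finite_measure clock_space" by unfold_locales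
    show "sets (?M1 \<Otimes>\<^sub>M clock_space) = sets ?D"
      unfolding sets_distr by (rule sets_pair_measure_cong) auto
    fix A B assume A: "A \<in> sets ?M1" and B [measurable]: "B \<in> sets clock_space"
    have "emeasure ?D (A \<times> B) = emeasure (ctmc_space R \<nu>) (\<Union>xs\<in>A. {\<omega>. history \<omega> n = xs \<and> snd (snd \<omega>) \<in> B})"
      by (subst emeasure_distr) (auto intro!: arg_cong2[where f=emeasure])
    also have "\<dots> = (\<integral>\<^sup>+xs. emeasure (ctmc_space R \<nu>) {\<omega>. history \<omega> n = xs \<and> snd (snd \<omega>) \<in> B} \<partial>count_space A)"
    proof (intro emeasure_UN_countable)
      show "{\<omega>. history \<omega> n = xs \<and> snd (snd \<omega>) \<in> B} \<in> sets (ctmc_space R \<nu>)" for xs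
      proof -
        have "{\<omega> \<in> space (ctmc_space R \<nu>). history \<omega> n = xs \<and> snd (snd \<omega>) \<in> B} \<in> sets (ctmc_space R \<nu>)"
          by measurable
        then show ?thesis by simp
      qed
    qed (auto simp: disjoint_family_on_def)
    also have "\<dots> = emeasure ?M1 A * emeasure clock_space B"
      by (simp add: C nn_integral_multc nn_integral_pmf)
    finally show "emeasure ?M1 A * emeasure clock_space B = emeasure ?D (A \<times> B)" by simp
  qed
qed

lemma nn_integral_history:
  assumes [measurable]: "f \<in> borel_measurable (count_space UNIV \<Otimes>\<^sub>M clock_space)"
  shows "(\<integral>\<^sup>+\<omega>. f (history \<omega> n, snd (snd \<omega>)) \<partial>ctmc_space R \<nu>) =
         (\<integral>\<^sup>+x. \<integral>\<^sup>+xs. \<integral>\<^sup>+e. f (xs, e) \<partial>clock_space \<partial>path_pmf (jump_pmf R) n x \<partial>\<nu>)"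
proof -
  let ?M1 = "measure_pmf (bind_pmf \<nu> (path_pmf (jump_pmf R) n))"
  have [measurable]: "f \<in> borel_measurable (?M1 \<Otimes>\<^sub>M clock_space)"
    using assms by (simp cong: measurable_cong_sets sets_pair_measure_cong)
  have "(\<integral>\<^sup>+\<omega>. f (history \<omega> n, snd (snd \<omega>)) \<partial>ctmc_space R \<nu>) =
        (\<integral>\<^sup>+p. f p \<partial>distr (ctmc_space R \<nu>) (count_space UNIV \<Otimes>\<^sub>M clock_space) (\<lambda>\<omega>. (history \<omega> n, snd (snd \<omega>))))"
    by (subst nn_integral_distr) auto
  also have "\<dots> = (\<integral>\<^sup>+xs. \<integral>\<^sup>+e. f (xs, e) \<partial>clock_space \<partial>?M1)"
    unfolding distr_history by (subst clock.nn_integral_fst[symmetric]) auto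
  finally show ?thesis by simp
qed

definition avoid :: "('a \<Rightarrow> 'a pmf) \<Rightarrow> 'a set \<Rightarrow> nat \<Rightarrow> 'a \<Rightarrow> real" where
  "avoid P D n x = measure (path_pmf P n x) {xs. set xs \<inter> D = {}}"

locale regular_rates =
  fixes R :: "'a::countable \<Rightarrow> 'a \<Rightarrow> real"
  assumes nonneg: "0 \<le> R x z"
    and diag: "R x x = 0"
    and finite_targets: "finite {z. R x z \<noteq> 0}"
    and not_absorbing: "\<exists>z. R x z \<noteq> 0"
begin

abbreviation "targets x \<equiv> {z. R x z \<noteq> 0}"
abbreviation "q \<equiv> jump_rate R"
abbreviation "P \<equiv> jump_pmf R"

lemma jump_rate_eq: "q x = (\<Sum>z\<in>targets x. R x z)"
proof -
  have "q x = (\<Sum>\<^sub>\<infinity>z\<in>targets x. R x z)"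
    unfolding jump_rate_def by (intro infsum_cong_neutral) (auto simp: diag)
  then show ?thesis using finite_targets by simp
qed

lemma q_pos: "0 < q x"
proof -
  obtain z where "R x z \<noteq> 0" using not_absorbing by blast
  then have "0 < R x z" using nonneg[of x z] by simp
  then show ?thesis
    unfolding jump_rate_eq using finite_targets nonneg
    by (intro sum_pos2[of _ z]) auto
qed

lemma pmf_jump: "pmf (P x) z = R x z / q x"
proof -
  have *: "(\<lambda>z. if z = x then 0 else R x z / q x) = (\<lambda>z. R x z / q x)"
    by (auto simp: diag)
  have "(\<integral>\<^sup>+z. ennreal (R x z / q x) \<partial>count_space UNIV) =
      (\<integral>\<^sup>+z. ennreal (R x z / q x) \<partial>count_space (targets x))"
    by (rule nn_integral_count_space_eq) auto
  also have "\<dots> = ennreal (\<Sum>z\<in>targets x. R x z / q x)"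
    using finite_targets by (simp add: nn_integral_count_space_finite sum_ennreal nonneg q_pos less_imp_le)
  also have "\<dots> = 1"
    using q_pos[of x] by (simp flip: sum_divide_distrib jump_rate_eq)
  finally have "pmf (embed_pmf (\<lambda>z. R x z / q x)) z = R x z / q x"
    using q_pos[of x] nonneg by (intro pmf_embed_pmf) (auto simp: less_imp_le)
  then show ?thesis
    using q_pos[of x] by (simp add: jump_pmf_def *)
qed

lemma set_pmf_jump: "set_pmf (P x) = targets x"
  using q_pos[of x] by (auto simp: set_pmf_eq pmf_jump)

lemma measure_path_Suc:
  "measure (path_pmf P (Suc n) x) A =
   (\<Sum>z\<in>targets x. pmf (P x) z * measure (path_pmf P n z) {xs. x # xs \<in> A})"
proof -
  have "emeasure (path_pmf P (Suc n) x) A =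
    (\<integral>\<^sup>+z. emeasure (path_pmf P n z) {xs. x # xs \<in> A} \<partial>P x)"
    by (simp add: emeasure_bind_pmf vimage_def)
  also have "\<dots> = (\<Sum>z\<in>targets x. ennreal (measure (path_pmf P n z) {xs. x # xs \<in> A}) * pmf (P x) z)"
    using finite_targets by (subst nn_integral_measure_pmf_finite)
      (simp_all add: set_pmf_jump measure_pmf.emeasure_eq_measure)
  also have "\<dots> = ennreal (\<Sum>z\<in>targets x. pmf (P x) z * measure (path_pmf P n z) {xs. x # xs \<in> A})"
    by (simp add: sum_ennreal[symmetric] ennreal_mult mult.commute del: sum_ennreal)
  finally show ?thesis
    by (simp add: measure_pmf.emeasure_eq_measure sum_nonneg del: path_pmf.simps)
qed

lemma avoid_0: "avoid P D 0 x = indicator (- D) x"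
  by (simp add: avoid_def indicator_def)

lemma avoid_Suc:
  "avoid P D (Suc n) x = (if x \<in> D then 0 else \<Sum>z\<in>targets x. pmf (P x) z * avoid P D n z)"
  unfolding avoid_def by (subst measure_path_Suc) auto

lemma avoid_nonneg: "0 \<le> avoid P D n x" and avoid_le_1: "avoid P D n x \<le> 1"
  by (simp_all add: avoid_def)

lemma avoid_antimono: "decseq (\<lambda>n. avoid P D n x)"
proof (rule decseq_SucI)
  show "avoid P D (Suc n) x \<le> avoid P D n x" for n
  proof (induction n arbitrary: x)
    case 0
    have "(\<Sum>z\<in>targets x. pmf (P x) z * avoid P D 0 z) \<le> (\<Sum>z\<in>targets x. pmf (P x) z)"
      by (intro sum_mono) (simp add: avoid_0 indicator_def)
    also have "\<dots> = 1"
      using finite_targets by (simp add: sum_pmf_eq_1 set_pmf_jump)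
    finally show ?case by (simp add: avoid_Suc avoid_0 indicator_def)
  next
    case (Suc n)
    then show ?case by (subst (1 2) avoid_Suc) (auto intro!: sum_mono mult_left_mono)
  qed
qed

definition never :: "'a set \<Rightarrow> 'a \<Rightarrow> real" where
  "never D x = lim (\<lambda>n. avoid P D n x)"

lemma avoid_tendsto: "(\<lambda>n. avoid P D n x) \<longlonglongrightarrow> never D x"
  unfolding never_def
  using decseq_convergent[OF avoid_antimono, of 0] avoid_nonneg
  by (metis convergent_def limI)

lemma never_nonneg: "0 \<le> never D x"
  by (rule LIMSEQ_le_const[OF avoid_tendsto]) (auto simp: avoid_nonneg)

lemma never_le_1: "never D x \<le> 1"
  by (rule LIMSEQ_le_const2[OF avoid_tendsto]) (auto simp: avoid_le_1)

lemma never_in: "x \<in> D \<Longrightarrow> never D x = 0"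
proof -
  assume "x \<in> D"
  then have "avoid P D n x = 0" for n by (cases n) (simp_all add: avoid_0 avoid_Suc)
  then show ?thesis using avoid_tendsto[of D x] by (simp add: LIMSEQ_const_iff)
qed

lemma never_harmonic:
  assumes "x \<notin> D"
  shows "(\<Sum>z\<in>targets x. R x z * (never D x - never D z)) = 0"
proof -
  have "(\<lambda>n. avoid P D (Suc n) x) \<longlonglongrightarrow> (\<Sum>z\<in>targets x. pmf (P x) z * never D z)"
    using assms by (auto simp: avoid_Suc intro!: tendsto_intros avoid_tendsto)
  with LIMSEQ_Suc[OF avoid_tendsto] have "never D x = (\<Sum>z\<in>targets x. pmf (P x) z * never D z)"
    by (rule LIMSEQ_unique)
  then have "q x * never D x = (\<Sum>z\<in>targets x. R x z * never D z)"
    using q_pos[of x] by (simp add: pmf_jump sum_distrib_left field_simps sum_divide_distrib[symmetric])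
  then show ?thesis
    by (simp add: right_diff_distrib sum_subtractf sum_distrib_right[symmetric] flip: jump_rate_eq)
qed

lemma never_accessible:
  assumes "accessible R x z" "never D x = 0"
    and D: "\<And>u v. u \<in> D \<Longrightarrow> R u v > 0 \<Longrightarrow> never D v = 0"
  shows "never D z = 0"
  using assms(1,2) unfolding accessible_def
proof (induction rule: rtrancl_induct)
  case (step u v)
  then have u: "never D u = 0" and uv: "R u v > 0" by auto
  show ?case
  proof (cases "u \<in> D")
    case False
    from never_harmonic[OF False] have "(\<Sum>w\<in>targets u. R u w * never D w) = 0"
      by (simp add: u sum_negf)
    then have "R u v * never D v = 0"
      using finite_targets[of u] uv
      by (subst (asm) sum_nonneg_eq_0_iff) (auto simp: nonneg never_nonneg)
    then show ?thesis using uv by simp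
  qed (use D uv in blast)
qed

lemma emeasure_history:
  "emeasure (ctmc_space R \<nu>) {\<omega>. history \<omega> n \<in> A} = emeasure (bind_pmf \<nu> (path_pmf P n)) A"
proof -
  let ?M = "measure_pmf (bind_pmf \<nu> (path_pmf P n))"
  have "emeasure (ctmc_space R \<nu>) {\<omega>. history \<omega> n \<in> A} =
    emeasure (distr (ctmc_space R \<nu>) (count_space UNIV \<Otimes>\<^sub>M clock_space) (\<lambda>\<omega>. (history \<omega> n, snd (snd \<omega>)))) (A \<times> UNIV)"
    using sets.top[of clock_space] by (subst emeasure_distr) (auto simp: vimage_def)
  also have "\<dots> = emeasure ?M A"
    unfolding distr_history using sets.top[of clock_space] clock.emeasure_space_1
    by (simp add: clock.emeasure_pair_measure_Times)
  finally show ?thesis .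
qed

lemma measure_history:
  "measure (ctmc_space R (return_pmf x)) {\<omega>. history \<omega> n \<in> A} = measure (path_pmf P n x) A"
  using emeasure_history[of "return_pmf x" n A] by (simp add: measure_def bind_return_pmf)

lemma set_history: "set (history \<omega> n) = jump_chain \<omega> ` {..n}"
  by (auto simp: history_def simp del: upt_Suc)

lemma AE_hit:
  assumes "never D x = 0"
  shows "AE \<omega> in ctmc_space R (return_pmf x). \<exists>n. jump_chain \<omega> n \<in> D"
proof -
  let ?M = "ctmc_space R (return_pmf x)"
  interpret prob_space ?M by (rule prob_space_ctmc)
  let ?N = "{\<omega> \<in> space ?M. \<forall>n. jump_chain \<omega> n \<notin> D}"
  have N [measurable]: "?N \<in> sets ?M" by measurable
  have "measure ?M ?N \<le> avoid P D n x" for n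
  proof -
    have "{\<omega> \<in> space ?M. history \<omega> n \<in> {xs. set xs \<inter> D = {}}} \<in> sets ?M" by measurable
    then have "measure ?M ?N \<le> measure ?M {\<omega>. history \<omega> n \<in> {xs. set xs \<inter> D = {}}}"
      by (intro finite_measure_mono) (auto simp: set_history)
    then show ?thesis unfolding measure_history avoid_def .
  qed
  then have "measure ?M ?N \<le> 0"
    using avoid_tendsto[of D x] assms by (intro LIMSEQ_le_const) auto
  then have "measure ?M ?N = 0" using measure_nonneg[of ?M ?N] by linarith
  then have "emeasure ?M ?N = 0" by (simp add: emeasure_eq_measure)
  then show ?thesis
    using N by (subst AE_iff_measurable[OF N]) auto
qed

lemma avoid_after_tendsto:
  assumes "\<And>z. accessible R x z \<Longrightarrow> never D z = 0"
  shows "(\<lambda>k. measure (path_pmf P (n + k) x) {xs. set (drop n xs) \<inter> D = {}}) \<longlonglongrightarrow> 0"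
  using assms
proof (induction n arbitrary: x)
  case 0
  then have "never D x = 0" by (auto simp: accessible_def)
  then show ?case using avoid_tendsto[of D x] by (simp add: avoid_def)
next
  case (Suc n)
  have acc: "never D w = 0" if "z \<in> targets x" "accessible R z w" for z w
  proof (rule Suc.prems)
    have "x \<noteq> z" "R x z > 0" using that diag nonneg[of x z] by (auto simp: less_le)
    then show "accessible R x w"
      using that(2) unfolding accessible_def by (auto intro: converse_rtrancl_into_rtrancl)
  qed
  have "(\<lambda>k. \<Sum>z\<in>targets x. pmf (P x) z * measure (path_pmf P (n + k) z) {xs. set (drop n xs) \<inter> D = {}})
    \<longlonglongrightarrow> (\<Sum>z\<in>targets x. pmf (P x) z * 0)"
    using Suc.IH acc by (intro tendsto_intros) auto
  then show ?case by (simp only: add_Suc measure_path_Suc) simp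
qed

lemma AE_hit_infinitely_often:
  assumes "\<And>z. accessible R x z \<Longrightarrow> never D z = 0"
  shows "AE \<omega> in ctmc_space R (return_pmf x). \<forall>n. \<exists>i\<ge>n. jump_chain \<omega> i \<in> D"
proof -
  let ?M = "ctmc_space R (return_pmf x)"
  interpret prob_space ?M by (rule prob_space_ctmc)
  have "AE \<omega> in ?M. \<exists>i\<ge>n. jump_chain \<omega> i \<in> D" for n
  proof -
    let ?N = "{\<omega> \<in> space ?M. \<forall>i\<ge>n. jump_chain \<omega> i \<notin> D}"
    have N [measurable]: "?N \<in> sets ?M" by measurable
    have "measure ?M ?N \<le> measure (path_pmf P (n + k) x) {xs. set (drop n xs) \<inter> D = {}}" for k
    proof -
      have "{\<omega> \<in> space ?M. history \<omega> (n + k) \<in> {xs. set (drop n xs) \<inter> D = {}}} \<in> sets ?M" by measurable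
      then have "measure ?M ?N \<le> measure ?M {\<omega>. history \<omega> (n + k) \<in> {xs. set (drop n xs) \<inter> D = {}}}"
        by (intro finite_measure_mono) (auto simp: history_def drop_map simp del: upt_Suc)
      then show ?thesis unfolding measure_history .
    qed
    then have "measure ?M ?N \<le> 0"
      using LIMSEQ_le_const[OF avoid_after_tendsto[where x=x and D=D and n=n, OF assms]] by blast
    then have "measure ?M ?N = 0" using measure_nonneg[of ?M ?N] by linarith
    then have "emeasure ?M ?N = 0" by (simp add: emeasure_eq_measure)
    then show ?thesis
      using N by (subst AE_iff_measurable[OF N]) auto
  qed
  then show ?thesis by (simp add: AE_all_countable)
qed

end

section \<open>Exponential clocks\<close>

abbreviation "exp1 \<equiv> density lborel (\<lambda>s. ennreal (exponential_density 1 s))"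

interpretation exp1: prob_space exp1 by (rule prob_space_exp1)

interpretation clock_seq: sequence_space exp1 ..

lemma distr_clock_shift:
  "distr (exp1 \<Otimes>\<^sub>M clock_space) clock_space (\<lambda>(s, e). case_nat s e) = clock_space"
  unfolding clock_space_def by (rule clock_seq.PiM_iter)

lemma distr_clock_component: "distr clock_space exp1 (\<lambda>e. e i) = exp1"
  unfolding clock_space_def by (rule distr_PiM_component) (auto intro: prob_space_exp1)

lemma measurable_clock_component [measurable]: "(\<lambda>e. e i) \<in> borel_measurable clock_space"
  by measurable

lemma distributed_exp1: "distributed exp1 lborel (\<lambda>s. s) (exponential_density 1)"
  by (simp add: distributed_def distr_id2 exponential_density_nonneg)

lemma measure_exp1_greaterThan: "0 \<le> a \<Longrightarrow> measure exp1 {a<..} = exp (- a)"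
  using exp1.exponential_distributedD_gt[OF distributed_exp1, of a] by (simp add: greaterThan_def)

lemma emeasure_exp1_greaterThan: "0 \<le> a \<Longrightarrow> emeasure exp1 {a<..} = ennreal (exp (- a))"
  by (simp only: exp1.emeasure_eq_measure measure_exp1_greaterThan)

lemma measure_exp1_atMost: "measure exp1 {..1} = 1 - exp (- 1)"
  using exp1.exponential_distributedD_le[OF distributed_exp1, of 1] by (simp add: atMost_def)

lemma nn_integral_clock: "(\<integral>\<^sup>+e. ennreal (e i) \<partial>clock_space) = 1"
proof -
  have "(\<integral>\<^sup>+e. ennreal (e i) \<partial>clock_space) = (\<integral>\<^sup>+s. ennreal s \<partial>distr clock_space exp1 (\<lambda>e. e i))"
    by (subst nn_integral_distr) (auto simp: clock_space_def)
  also have "\<dots> = (\<integral>\<^sup>+s. ennreal (erlang_density 0 1 s * s ^ 1) \<partial>lborel)"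
    unfolding distr_clock_component
    by (subst nn_integral_density) (auto simp: ennreal_mult' exponential_density_nonneg)
  also have "\<dots> = 1"
    by (subst nn_integral_erlang_ith_moment) auto
  finally show ?thesis .
qed

lemma AE_clock_pos: "AE e in clock_space. \<forall>i. 0 < e i"
proof -
  have "AE s in exp1. 0 < s"
    using AE_lborel_singleton[of "0::real"]
    by (subst AE_density) (auto simp: exponential_density_def)
  then have "AE e in clock_space. 0 < e i" for i
    unfolding clock_space_def by (intro AE_PiM_component prob_space_exp1) auto
  then show ?thesis by (simp add: AE_all_countable)
qed

lemma AE_clock_infinite:
  assumes "infinite I"
  shows "AE e in clock_space. infinite {i \<in> I. 1 < e i}"
proof -
  have "AE e in clock_space. \<exists>i\<in>I. n \<le> i \<and> 1 < e i" for n
  proof -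
    let ?N = "{e \<in> space clock_space. \<forall>i\<in>I. n \<le> i \<longrightarrow> e i \<le> 1}"
    have N: "?N \<in> sets clock_space" by measurable
    have "measure clock_space ?N \<le> (1 - exp (- 1)) ^ k" for k
    proof -
      have "infinite (I - {..<n})" using assms by simp
      then obtain F where F: "F \<subseteq> I - {..<n}" "finite F" "card F = k"
        by (meson infinite_arbitrarily_large)
      let ?B = "prod_emb UNIV (\<lambda>_. exp1) F (Pi\<^sub>E F (\<lambda>_. {..1}))"
      have "emeasure clock_space ?B = (\<Prod>i\<in>F. emeasure exp1 {..1})"
        unfolding clock_space_def by (intro emeasure_PiM_emb) (auto intro: prob_space_exp1 F)
      also have "\<dots> = ennreal ((1 - exp (- 1)) ^ k)"
        by (simp add: exp1.emeasure_eq_measure measure_exp1_atMost F ennreal_power)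
      finally have "measure clock_space ?B = (1 - exp (- 1)) ^ k"
        by (simp add: measure_def)
      moreover have "?N \<subseteq> ?B"
        using F(1) by (fastforce simp: prod_emb_def space_PiM PiE_def Pi_def)
      moreover have "?B \<in> sets clock_space"
        unfolding clock_space_def using F by (intro sets_PiM_I) auto
      ultimately show ?thesis
        using clock.finite_measure_mono[of ?N ?B] by simp
    qed
    moreover have "(\<lambda>k. (1 - exp (- 1 :: real)) ^ k) \<longlonglongrightarrow> 0"
      by (rule LIMSEQ_power_zero) auto
    ultimately have "measure clock_space ?N \<le> 0"
      using LIMSEQ_le_const by blast
    then have "measure clock_space ?N = 0" using measure_nonneg[of clock_space ?N] by linarith
    then have "emeasure clock_space ?N = 0" by (simp add: clock.emeasure_eq_measure)
    then show ?thesis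
      using N by (subst AE_iff_measurable[OF N]) (auto simp: not_le)
  qed
  then have "AE e in clock_space. \<forall>n. \<exists>i\<in>I. n \<le> i \<and> 1 < e i" by (simp add: AE_all_countable)
  then show ?thesis
    by eventually_elim (unfold infinite_nat_iff_unbounded_le, blast)
qed

lemma AE_ctmc_clock:
  assumes "AE e in clock_space. Q e"
  shows "AE \<omega> in ctmc_space R \<nu>. Q (snd (snd \<omega>))"
proof -
  obtain N where N: "N \<in> sets clock_space" "emeasure clock_space N = 0" "{e. \<not> Q e} \<subseteq> N"
    using assms unfolding eventually_ae_filter null_sets_def by auto
  interpret T: prob_space "target_space R" by (rule prob_space_target)
  interpret TC: prob_space "target_space R \<Otimes>\<^sub>M clock_space" by (rule prob_space_target_clock)
  have "UNIV \<times> (UNIV \<times> N) \<in> null_sets (ctmc_space R \<nu>)"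
    unfolding ctmc_space_eq null_sets_def using N sets.top[of "target_space R"]
    by (simp add: TC.emeasure_pair_measure_Times clock.emeasure_pair_measure_Times)
  then show ?thesis
    by (rule AE_I') (use N in auto)
qed

context regular_rates
begin

lemma holding_time_eq:
  "0 < snd (snd \<omega>) k \<Longrightarrow> holding_time R \<omega> k = ennreal (snd (snd \<omega>) k / q (jump_chain \<omega> k))"
  using q_pos by (simp add: holding_time_def divide_ennreal)

lemma jump_time_eq:
  assumes "\<forall>i. 0 < snd (snd \<omega>) i"
  shows "jump_time R \<omega> k = ennreal (\<Sum>i<k. snd (snd \<omega>) i / q (jump_chain \<omega> i))"
  unfolding jump_time_def using assms q_pos
  by (simp add: holding_time_eq sum_ennreal less_imp_le)

lemma ctmc_at_jump_time:
  assumes "\<forall>i. 0 < snd (snd \<omega>) i"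
  shows "ctmc R (\<Sum>i<k. snd (snd \<omega>) i / q (jump_chain \<omega> i)) \<omega> = Some (jump_chain \<omega> k)"
proof -
  have "0 < snd (snd \<omega>) k / q (jump_chain \<omega> k)" using assms q_pos by simp
  moreover have "0 \<le> (\<Sum>i<k. snd (snd \<omega>) i / q (jump_chain \<omega> i))"
    using assms q_pos by (intro sum_nonneg) (simp add: less_imp_le)
  ultimately show ?thesis
    unfolding ctmc_eq_Some_iff jump_time_eq[OF assms]
    by (intro exI[of _ k]) (auto simp: ennreal_less_iff)
qed

lemma jump_time_unbounded:
  assumes "infinite {i. jump_chain \<omega> i = x \<and> 1 < snd (snd \<omega>) i}"
  shows "\<exists>k. ennreal t < jump_time R \<omega> k"
proof -
  let ?V = "{i. jump_chain \<omega> i = x \<and> 1 < snd (snd \<omega>) i}"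
  obtain N :: nat where N: "\<bar>t\<bar> * q x < real N" using reals_Archimedean2 by blast
  obtain F where F: "F \<subseteq> ?V" "finite F" "card F = N"
    using infinite_arbitrarily_large[OF assms] by blast
  obtain k where k: "F \<subseteq> {..<k}"
    using F(2) finite_nat_iff_bounded by auto
  have "\<bar>t\<bar> < real N / q x"
    using N q_pos[of x] by (simp add: field_simps)
  then have "ennreal t < ennreal (N / q x)"
    by (intro ennreal_lessI) linarith+
  also have "\<dots> = (\<Sum>i\<in>F. ennreal (1 / q x))"
    using q_pos[of x] by (simp add: F ennreal_of_nat_eq_real_of_nat flip: ennreal_mult)
  also have "\<dots> \<le> (\<Sum>i\<in>F. holding_time R \<omega> i)"
  proof (rule sum_mono)
    fix i assume "i \<in> F"
    then have "jump_chain \<omega> i = x" "1 < snd (snd \<omega>) i" using F by auto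
    then show "ennreal (1 / q x) \<le> holding_time R \<omega> i"
      using q_pos[of x] by (subst holding_time_eq) (auto intro!: ennreal_leI divide_right_mono)
  qed
  also have "\<dots> \<le> jump_time R \<omega> k"
    unfolding jump_time_def using k by (intro sum_mono2) auto
  finally show ?thesis by blast
qed

lemma jump_chain_indep_clock: "jump_chain (x, d, e) i = jump_chain (x, d, e') i"
  by (induction i) auto

lemma AE_nonexplosive:
  assumes "AE \<omega> in ctmc_space R \<nu>. \<forall>n. \<exists>i\<ge>n. jump_chain \<omega> i = x"
  shows "AE \<omega> in ctmc_space R \<nu>. \<forall>t. \<exists>k. ennreal t < jump_time R \<omega> k"
proof -
  interpret N: prob_space "measure_pmf \<nu>" by (rule prob_space_measure_pmf)
  interpret T: prob_space "target_space R" by (rule prob_space_target)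
  interpret TC: pair_prob_space "target_space R" clock_space by standard
  interpret NTC: pair_prob_space "measure_pmf \<nu>" "target_space R \<Otimes>\<^sub>M clock_space" by standard
  let ?Q = "\<lambda>\<omega>. \<forall>n. \<exists>i\<ge>n. jump_chain \<omega> i = x \<and> 1 < snd (snd \<omega>) i"
  have "AE y in \<nu>. AE d in target_space R. AE e in clock_space. \<forall>n. \<exists>i\<ge>n. jump_chain (y, d, e) i = x"
    using NTC.AE_pair[OF assms[unfolded ctmc_space_eq]]
    by eventually_elim (drule TC.AE_pair, simp)
  then have *: "AE y in \<nu>. AE d in target_space R. AE e in clock_space. ?Q (y, d, e)"
  proof eventually_elim
    case (elim y)
    then show ?case
    proof eventually_elim
      case (elim d)
      obtain e0 where "\<forall>n. \<exists>i\<ge>n. jump_chain (y, d, e0) i = x"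
        using eventually_happens[OF elim] clock.not_empty by (auto simp: trivial_limit_def clock.AE_False)
      then have "infinite {i. jump_chain (y, d, undefined) i = x}"
        using jump_chain_indep_clock[of y d e0 _ undefined] by (auto simp: infinite_nat_iff_unbounded_le)
      from AE_clock_infinite[OF this] show ?case
      proof eventually_elim
        case (elim e)
        then show ?case
          using jump_chain_indep_clock[of y d e _ undefined]
          by (auto simp: infinite_nat_iff_unbounded_le)
      qed
    qed
  qed
  have m: "{\<omega> \<in> space (ctmc_space R \<nu>). ?Q \<omega>} \<in> sets (ctmc_space R \<nu>)" by measurable
  have "AE \<omega> in ctmc_space R \<nu>. ?Q \<omega>"
    unfolding ctmc_space_eq
  proof (rule NTC.AE_pair_measure)
    show "{\<omega> \<in> space (measure_pmf \<nu> \<Otimes>\<^sub>M target_space R \<Otimes>\<^sub>M clock_space). ?Q \<omega>}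
      \<in> sets (measure_pmf \<nu> \<Otimes>\<^sub>M target_space R \<Otimes>\<^sub>M clock_space)"
      using m by (simp add: ctmc_space_eq)
    show "AE y in \<nu>. AE p in target_space R \<Otimes>\<^sub>M clock_space. ?Q (y, p)"
      using *
    proof eventually_elim
      case (elim y)
      have "(\<lambda>p. (y, p)) \<in> target_space R \<Otimes>\<^sub>M clock_space \<rightarrow>\<^sub>M ctmc_space R \<nu>"
        unfolding ctmc_space_eq by (rule measurable_Pair1') simp
      from measurable_sets[OF this m] have "{p \<in> space (target_space R \<Otimes>\<^sub>M clock_space). ?Q (y, p)}
        \<in> sets (target_space R \<Otimes>\<^sub>M clock_space)"
        by (simp add: vimage_def Int_def conj_commute)
      then show ?case by (rule TC.AE_pair_measure) (use elim in auto)
    qed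
  qed
  then show ?thesis
  proof eventually_elim
    case (elim \<omega>)
    then have "infinite {i. jump_chain \<omega> i = x \<and> 1 < snd (snd \<omega>) i}"
      by (auto simp: infinite_nat_iff_unbounded_le)
    then show ?case using jump_time_unbounded by blast
  qed
qed

end

section \<open>Reversible rates\<close>

locale reversible_rates = regular_rates +
  fixes \<pi> :: "'a pmf"
  assumes balance: "pmf \<pi> x * R x z = pmf \<pi> z * R z x"
begin

lemma support_closed:
  assumes "x \<in> set_pmf \<pi>" "R x z \<noteq> 0"
  shows "z \<in> set_pmf \<pi>"
  using assms balance[of x z] by (auto simp: set_pmf_iff)

lemma accessible_support:
  assumes "accessible R x z" "x \<in> set_pmf \<pi>"
  shows "z \<in> set_pmf \<pi>"
  using assms unfolding accessible_def
  by (induction rule: rtrancl_induct) (auto intro: support_closed)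

lemma accessible_sym:
  assumes "accessible R x z" "x \<in> set_pmf \<pi>"
  shows "accessible R z x"
  using assms(1) unfolding accessible_def
proof (induction rule: rtrancl_induct)
  case (step u v)
  then have uv: "u \<noteq> v" "R u v > 0" by auto
  have "u \<in> set_pmf \<pi>"
    using step.hyps(1) assms(2) accessible_support by (auto simp: accessible_def)
  then have "pmf \<pi> u * R u v > 0" using uv by (simp add: pmf_positive)
  then have "R v u > 0"
    using balance[of u v] nonneg[of v u] by (auto simp: less_le)
  then have "(v, u) \<in> {(u, v). u \<noteq> v \<and> R u v > 0}" using uv by simp
  then show ?case using step.IH by (rule converse_rtrancl_into_rtrancl)
qed simp

text \<open>Green's identity on \<open>A\<close> for the function \<open>never {x}\<close>, which is harmonic off \<open>x\<close>.\<close>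

lemma escape_flow:
  assumes A: "finite A" "x \<in> A"
  shows "pmf \<pi> x * (\<Sum>w\<in>targets x. R x w * never {x} w) =
         (\<Sum>u\<in>A. \<Sum>w\<in>targets u - A. pmf \<pi> u * R u w * (never {x} w - never {x} u))"
proof -
  let ?h = "never {x}"
  let ?f = "\<lambda>u w. pmf \<pi> u * R u w * (?h u - ?h w)"
  have "(\<Sum>u\<in>A. \<Sum>w\<in>targets u. ?f u w) = (\<Sum>u\<in>A. if u = x then - (pmf \<pi> x * (\<Sum>w\<in>targets x. R x w * ?h w)) else 0)"
  proof (rule sum.cong[OF refl])
    fix u assume "u \<in> A"
    have "(\<Sum>w\<in>targets u. ?f u w) = pmf \<pi> u * (\<Sum>w\<in>targets u. R u w * (?h u - ?h w))"
      by (simp add: sum_distrib_left mult.assoc)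
    then show "(\<Sum>w\<in>targets u. ?f u w) = (if u = x then - (pmf \<pi> x * (\<Sum>w\<in>targets x. R x w * ?h w)) else 0)"
      using never_harmonic[of u "{x}"] never_in[of x "{x}"] by (auto simp: sum_negf)
  qed
  then have 1: "(\<Sum>u\<in>A. \<Sum>w\<in>targets u. ?f u w) = - (pmf \<pi> x * (\<Sum>w\<in>targets x. R x w * ?h w))"
    using A by simp
  have 2: "(\<Sum>u\<in>A. \<Sum>w\<in>targets u. ?f u w) = (\<Sum>u\<in>A. \<Sum>w\<in>A. ?f u w) + (\<Sum>u\<in>A. \<Sum>w\<in>targets u - A. ?f u w)"
  proof -
    have "(\<Sum>w\<in>targets u. ?f u w) = (\<Sum>w\<in>A. ?f u w) + (\<Sum>w\<in>targets u - A. ?f u w)" for u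
    proof -
      have "(\<Sum>w\<in>targets u. ?f u w) = (\<Sum>w\<in>targets u \<inter> A. ?f u w) + (\<Sum>w\<in>targets u - A. ?f u w)"
        using finite_targets by (rule sum.Int_Diff)
      also have "(\<Sum>w\<in>targets u \<inter> A. ?f u w) = (\<Sum>w\<in>A. ?f u w)"
        using A by (intro sum.mono_neutral_left) auto
      finally show ?thesis .
    qed
    then show ?thesis by (simp add: sum.distrib)
  qed
  have "(\<Sum>u\<in>A. \<Sum>w\<in>A. ?f u w) = (\<Sum>u\<in>A. \<Sum>w\<in>A. ?f w u)" by (rule sum.swap)
  also have "\<dots> = - (\<Sum>u\<in>A. \<Sum>w\<in>A. ?f u w)"
    by (simp add: sum_negf[symmetric] balance right_diff_distrib)
  finally have 3: "(\<Sum>u\<in>A. \<Sum>w\<in>A. ?f u w) = 0" by simp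
  have "(\<Sum>u\<in>A. \<Sum>w\<in>targets u - A. ?f u w) =
    - (\<Sum>u\<in>A. \<Sum>w\<in>targets u - A. pmf \<pi> u * R u w * (?h w - ?h u))"
    by (simp add: sum_negf[symmetric] right_diff_distrib)
  with 1 2 3 show ?thesis by simp
qed

end

locale recurrent_rates = reversible_rates +
  assumes small_boundary: "x \<in> set_pmf \<pi> \<Longrightarrow> \<epsilon> > 0 \<Longrightarrow>
      \<exists>A. finite A \<and> x \<in> A \<and> (\<Sum>u\<in>A. \<Sum>w\<in>targets u - A. pmf \<pi> u * R u w) \<le> \<epsilon>"
begin

lemma no_escape:
  assumes x: "x \<in> set_pmf \<pi>" and "accessible R x z"
  shows "never {x} z = 0"
proof -
  let ?esc = "\<Sum>w\<in>targets x. R x w * never {x} w"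
  have "pmf \<pi> x * ?esc \<le> \<epsilon>" if \<epsilon>: "\<epsilon> > 0" for \<epsilon> :: real
  proof -
    obtain A where A: "finite A" "x \<in> A" "(\<Sum>u\<in>A. \<Sum>w\<in>targets u - A. pmf \<pi> u * R u w) \<le> \<epsilon>"
      using small_boundary x \<epsilon> by blast
    have "pmf \<pi> x * ?esc \<le> (\<Sum>u\<in>A. \<Sum>w\<in>targets u - A. pmf \<pi> u * R u w)"
      unfolding escape_flow[OF A(1,2)]
    proof (intro sum_mono)
      fix u w
      have "never {x} w - never {x} u \<le> 1"
        using never_le_1[of "{x}" w] never_nonneg[of "{x}" u] by linarith
      then show "pmf \<pi> u * R u w * (never {x} w - never {x} u) \<le> pmf \<pi> u * R u w"
        using mult_left_mono[of _ 1 "pmf \<pi> u * R u w"] nonneg[of u w] by simp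
    qed
    with A(3) show ?thesis by linarith
  qed
  then have "pmf \<pi> x * ?esc \<le> 0" by (rule field_le_epsilon) simp
  moreover have "0 \<le> ?esc" by (intro sum_nonneg mult_nonneg_nonneg nonneg never_nonneg)
  moreover have "0 < pmf \<pi> x" using x by (rule pmf_positive)
  ultimately have "?esc = 0" by (simp add: mult_le_0_iff)
  then have "never {x} w = 0" if "R x w > 0" for w
    using that finite_targets[of x] by (subst (asm) sum_nonneg_eq_0_iff) (auto simp: nonneg never_nonneg)
  then show ?thesis
    by (intro never_accessible[OF assms(2)]) (auto simp: never_in)
qed

end

subsection \<open>The mean return time\<close>

context reversible_rates
begin

definition m :: "'a \<Rightarrow> ennreal" where "m z = ennreal (pmf \<pi> z * q z)"

lemma m_integral_jump:
  "m z * (\<integral>\<^sup>+w. b w \<partial>P z) = (\<integral>\<^sup>+w. ennreal (pmf \<pi> z * R z w) * b w \<partial>count_space UNIV)"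
proof -
  have "m z * ennreal (pmf (P z) w) = ennreal (pmf \<pi> z * R z w)" for w
    using q_pos[of z] by (simp add: m_def pmf_jump nonneg flip: ennreal_mult)
  then show ?thesis
    by (simp add: nn_integral_measure_pmf nn_integral_cmult[symmetric] mult.assoc[symmetric])
qed

lemma jump_self_adjoint:
  "(\<integral>\<^sup>+z. m z * ((\<integral>\<^sup>+w. a w \<partial>P z) * b z) \<partial>count_space UNIV) =
   (\<integral>\<^sup>+z. m z * (a z * (\<integral>\<^sup>+w. b w \<partial>P z)) \<partial>count_space UNIV)"
proof -
  let ?c = "\<lambda>z w. ennreal (pmf \<pi> z * R z w)"
  have "(\<integral>\<^sup>+z. m z * ((\<integral>\<^sup>+w. a w \<partial>P z) * b z) \<partial>count_space UNIV) =
    (\<integral>\<^sup>+z. (\<integral>\<^sup>+w. ?c z w * a w * b z \<partial>count_space UNIV) \<partial>count_space UNIV)"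
    by (simp add: mult.assoc[symmetric] m_integral_jump nn_integral_multc)
  also have "\<dots> = (\<integral>\<^sup>+w. (\<integral>\<^sup>+z. ?c z w * a w * b z \<partial>count_space UNIV) \<partial>count_space UNIV)"
    by (rule nn_integral_count_space_nn_integral[symmetric]) auto
  also have "\<dots> = (\<integral>\<^sup>+w. (\<integral>\<^sup>+z. ?c w z * b z * a w \<partial>count_space UNIV) \<partial>count_space UNIV)"
    by (subst balance) (simp add: mult_ac)
  also have "\<dots> = (\<integral>\<^sup>+w. (\<integral>\<^sup>+z. ?c w z * b z \<partial>count_space UNIV) * a w \<partial>count_space UNIV)"
    by (simp add: nn_integral_multc)
  also have "\<dots> = (\<integral>\<^sup>+w. m w * (a w * (\<integral>\<^sup>+z. b z \<partial>P w)) \<partial>count_space UNIV)"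
    unfolding m_integral_jump[symmetric] by (simp add: mult_ac)
  finally show ?thesis .
qed

primrec taboo :: "'a \<Rightarrow> ('a \<Rightarrow> ennreal) \<Rightarrow> nat \<Rightarrow> 'a \<Rightarrow> ennreal" where
  "taboo x g 0 z = indicator (- {x}) z * g z"
| "taboo x g (Suc i) z = indicator (- {x}) z * (\<integral>\<^sup>+w. taboo x g i w \<partial>P z)"

lemma taboo_indicator: "indicator (- {x}) z * taboo x g i z = taboo x g i z"
  by (cases i) (auto simp: indicator_def)

lemma taboo_eq_path:
  "taboo x g i z = (\<integral>\<^sup>+xs. indicator {xs. x \<notin> set xs} xs * g (last xs) \<partial>path_pmf P i z)"
proof (induction i arbitrary: z)
  case 0
  then show ?case by (auto simp: indicator_def)
next
  case (Suc i)
  have "(\<integral>\<^sup>+xs. indicator {xs. x \<notin> set xs} (z # xs) * g (last (z # xs)) \<partial>path_pmf P i w) =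
    (\<integral>\<^sup>+xs. indicator (- {x}) z * (indicator {xs. x \<notin> set xs} xs * g (last xs)) \<partial>path_pmf P i w)" for w
    by (intro nn_integral_cong_AE AE_pmfI) (auto dest!: set_path_pmf simp: indicator_def)
  then show ?case by (simp add: Suc nn_integral_cmult)
qed

lemma taboo_adjoint:
  "(\<integral>\<^sup>+z. m z * (taboo x a i z * taboo x b j z) \<partial>count_space UNIV) =
   (\<integral>\<^sup>+z. m z * (taboo x a 0 z * taboo x b (i + j) z) \<partial>count_space UNIV)"
proof (induction i arbitrary: j)
  case (Suc i)
  have "(\<integral>\<^sup>+z. m z * (taboo x a (Suc i) z * taboo x b j z) \<partial>count_space UNIV) =
    (\<integral>\<^sup>+z. m z * ((\<integral>\<^sup>+w. taboo x a i w \<partial>P z) * (indicator (- {x}) z * taboo x b j z)) \<partial>count_space UNIV)"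
    by (simp add: mult_ac)
  also have "\<dots> = (\<integral>\<^sup>+z. m z * (taboo x a i z * (\<integral>\<^sup>+w. taboo x b j w \<partial>P z)) \<partial>count_space UNIV)"
    by (simp add: taboo_indicator jump_self_adjoint)
  also have "\<dots> = (\<integral>\<^sup>+z. m z * (indicator (- {x}) z * taboo x a i z * (\<integral>\<^sup>+w. taboo x b j w \<partial>P z)) \<partial>count_space UNIV)"
    by (simp add: taboo_indicator)
  also have "\<dots> = (\<integral>\<^sup>+z. m z * (taboo x a i z * taboo x b (Suc j) z) \<partial>count_space UNIV)"
    by (simp add: mult_ac)
  finally show ?case using Suc[of "Suc j"] by simp
qed simp

lemma taboo_hit_sum:
  "(\<Sum>i<n. taboo x (\<lambda>z. ennreal (pmf (P z) x)) i z) \<le> indicator (- {x}) z"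
proof (induction n arbitrary: z)
  case (Suc n)
  let ?f = "taboo x (\<lambda>z. ennreal (pmf (P z) x))"
  have "(\<Sum>i<Suc n. ?f i z) = ?f 0 z + (\<Sum>i<n. ?f (Suc i) z)"
    by (rule sum.lessThan_Suc_shift)
  also have "\<dots> = indicator (- {x}) z * (ennreal (pmf (P z) x) + (\<integral>\<^sup>+w. (\<Sum>i<n. ?f i w) \<partial>P z))"
    by (simp add: nn_integral_sum sum_distrib_left distrib_left)
  also have "\<dots> \<le> indicator (- {x}) z * ((\<integral>\<^sup>+w. indicator {x} w \<partial>P z) + (\<integral>\<^sup>+w. indicator (- {x}) w \<partial>P z))"
    by (intro mult_left_mono add_mono nn_integral_mono Suc) (auto simp: emeasure_pmf_single)
  also have "(\<integral>\<^sup>+w. indicator {x} w \<partial>P z) + (\<integral>\<^sup>+w. indicator (- {x}) w \<partial>P z) = 1"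
    using emeasure_Un[of "{x}" "P z" "- {x}"] measure_pmf.emeasure_space_1[of "P z"]
    by (simp add: plus_emeasure)
  also have "indicator (- {x}) z * 1 = (indicator (- {x}) z :: ennreal)" by simp
  finally show ?case .
qed simp

lemma taboo_time_sum:
  "m x * (\<Sum>i<n. \<integral>\<^sup>+w. taboo x (\<lambda>z. ennreal (1 / q z)) i w \<partial>P x) \<le> 1"
proof -
  let ?g = "\<lambda>z. ennreal (1 / q z)" and ?p = "\<lambda>z. ennreal (pmf (P z) x)"
  have "m x * (\<integral>\<^sup>+w. taboo x ?g i w \<partial>P x) = (\<integral>\<^sup>+z. m z * (taboo x ?p i z * taboo x ?g 0 z) \<partial>count_space UNIV)" for i
  proof -
    have "m w * ?p w = ennreal (pmf \<pi> x * R x w)" for w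
      using q_pos[of w] balance[of x w] by (simp add: m_def pmf_jump nonneg flip: ennreal_mult)
    then have "m x * (\<integral>\<^sup>+w. taboo x ?g i w \<partial>P x) = (\<integral>\<^sup>+w. m w * (?p w * taboo x ?g i w) \<partial>count_space UNIV)"
      by (simp add: m_integral_jump mult.assoc[symmetric])
    also have "\<dots> = (\<integral>\<^sup>+w. m w * (taboo x ?p 0 w * taboo x ?g i w) \<partial>count_space UNIV)"
      using taboo_indicator[of x _ ?g i] by (intro nn_integral_cong) (simp add: mult_ac)
    finally show ?thesis by (simp add: taboo_adjoint[where j=0, simplified])
  qed
  then have "m x * (\<Sum>i<n. \<integral>\<^sup>+w. taboo x ?g i w \<partial>P x) =
    (\<Sum>i<n. \<integral>\<^sup>+z. m z * (taboo x ?p i z * taboo x ?g 0 z) \<partial>count_space UNIV)"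
    by (simp add: sum_distrib_left)
  also have "\<dots> = (\<integral>\<^sup>+z. (\<Sum>i<n. taboo x ?p i z) * (m z * taboo x ?g 0 z) \<partial>count_space UNIV)"
    by (subst nn_integral_sum[symmetric])
       (auto intro!: nn_integral_cong simp: sum_distrib_left sum_distrib_right mult_ac simp del: taboo.simps)
  also have "\<dots> \<le> (\<integral>\<^sup>+z. ennreal (pmf \<pi> z) \<partial>count_space UNIV)"
  proof (intro nn_integral_mono)
    fix z
    have "(\<Sum>i<n. taboo x ?p i z) * (m z * taboo x ?g 0 z) \<le> 1 * (m z * ?g z)"
      by (intro mult_mono order.trans[OF taboo_hit_sum]) (auto simp: indicator_def)
    also have "m z * ?g z = ennreal (pmf \<pi> z)"
      using q_pos[of z] by (simp add: m_def flip: ennreal_mult)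
    finally show "(\<Sum>i<n. taboo x ?p i z) * (m z * taboo x ?g 0 z) \<le> ennreal (pmf \<pi> z)" by simp
  qed
  also have "\<dots> = 1" by (simp add: nn_integral_pmf measure_pmf.emeasure_space_1[simplified])
  finally show ?thesis .
qed

end

context recurrent_rates
begin

lemma AE_return:
  assumes "x \<in> set_pmf \<pi>"
  shows "AE \<omega> in ctmc_space R (return_pmf x). \<forall>n. \<exists>i\<ge>n. jump_chain \<omega> i = x"
  using AE_hit_infinitely_often[of x "{x}"] no_escape[OF assms] by simp

lemma set_tl_history: "set (tl (history \<omega> i)) = jump_chain \<omega> ` {1..i}"
proof -
  have "[0..<Suc i] = 0 # [1..<Suc i]" by (simp add: upt_conv_Cons del: upt_Suc)
  then have "tl (history \<omega> i) = map (jump_chain \<omega>) [1..<Suc i]"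
    by (simp add: history_def del: upt_Suc)
  then show ?thesis by (auto simp del: upt_Suc)
qed

lemma positive_recurrent_support:
  assumes x: "x \<in> set_pmf \<pi>"
  shows "positive_recurrent_state R x"
proof -
  let ?M = "ctmc_space R (return_pmf x)"
  let ?A = "\<lambda>i. {xs. x \<notin> set (tl xs)}"
  let ?t = "\<lambda>i \<omega>. indicator (?A i) (history \<omega> i) * holding_time R \<omega> i"
  have "AE \<omega> in ?M. return_time R x \<omega> \<le> (\<Sum>i. ?t i \<omega>)"
    using AE_return[OF x] AE_ctmc_clock[OF AE_clock_pos]
  proof eventually_elim
    case (elim \<omega>)
    have "\<exists>k. 1 \<le> k \<and> jump_chain \<omega> k = x" using elim(1) by blast
    then obtain K where K: "1 \<le> K" "jump_chain \<omega> K = x"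
      and less: "\<And>j. 1 \<le> j \<Longrightarrow> j < K \<Longrightarrow> jump_chain \<omega> j \<noteq> x"
      unfolding exists_least_iff[of "\<lambda>k. 1 \<le> k \<and> jump_chain \<omega> k = x"] by blast
    let ?T = "\<Sum>i<K. snd (snd \<omega>) i / q (jump_chain \<omega> i)"
    have T: "jump_time R \<omega> K = ennreal ?T" by (rule jump_time_eq[OF elim(2)])
    have "0 \<le> ?T" using elim(2) q_pos by (intro sum_nonneg) (simp add: less_imp_le)
    moreover have "jump_time R \<omega> 1 \<le> ennreal ?T"
      unfolding T[symmetric] using K(1) by (rule monoD[OF mono_jump_time])
    moreover have "ctmc R ?T \<omega> = Some x"
      unfolding K(2)[symmetric] by (rule ctmc_at_jump_time[OF elim(2)])
    ultimately have "return_time R x \<omega> \<le> ennreal ?T"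
      unfolding return_time_def by (intro Inf_lower) blast
    also have "\<dots> = (\<Sum>i<K. holding_time R \<omega> i)"
      using T by (simp add: jump_time_def)
    also have "\<dots> = (\<Sum>i<K. ?t i \<omega>)"
    proof (rule sum.cong[OF refl])
      fix i assume i: "i \<in> {..<K}"
      have "x \<notin> jump_chain \<omega> ` {1..i}"
      proof
        assume "x \<in> jump_chain \<omega> ` {1..i}"
        then obtain j where j: "1 \<le> j" "j \<le> i" "x = jump_chain \<omega> j" by auto
        then show False using less[of j] i by simp
      qed
      then have "history \<omega> i \<in> ?A i" by (simp add: set_tl_history)
      then show "holding_time R \<omega> i = ?t i \<omega>" by (simp only: indicator_simps mult_1)
    qed
    also have "\<dots> \<le> (\<Sum>i. ?t i \<omega>)" by (rule sum_le_suminf) auto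
    finally show ?case .
  qed
  then have "(\<integral>\<^sup>+\<omega>. return_time R x \<omega> \<partial>?M) \<le> (\<integral>\<^sup>+\<omega>. (\<Sum>i. ?t i \<omega>) \<partial>?M)"
    by (rule nn_integral_mono_AE)
  also have "\<dots> = (\<Sum>i. \<integral>\<^sup>+\<omega>. ?t i \<omega> \<partial>?M)"
  proof (rule nn_integral_suminf)
    show "?t i \<in> borel_measurable ?M" for i
      unfolding holding_time_def by measurable
  qed
  also have "(\<lambda>i. \<integral>\<^sup>+\<omega>. ?t i \<omega> \<partial>?M) =
    (\<lambda>i. \<integral>\<^sup>+xs. indicator {xs. x \<notin> set (tl xs)} xs * ennreal (1 / q (last xs)) \<partial>path_pmf P i x)"
  proof
    fix i
    let ?f = "\<lambda>(xs, e :: nat \<Rightarrow> real). indicator {xs. x \<notin> set (tl xs)} xs * ennreal (1 / q (last xs)) * ennreal (e i)"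
    have "?t i \<omega> = ?f (history \<omega> i, snd (snd \<omega>))" for \<omega>
    proof -
      have "last (history \<omega> i) = jump_chain \<omega> i" by (simp add: history_def)
      moreover have "holding_time R \<omega> i = ennreal (1 / q (jump_chain \<omega> i)) * ennreal (snd (snd \<omega>) i)"
        using q_pos[of "jump_chain \<omega> i"]
        by (simp add: holding_time_def divide_ennreal_def inverse_ennreal inverse_eq_divide mult.commute)
      ultimately show ?thesis by (simp add: mult.assoc)
    qed
    then have "(\<integral>\<^sup>+\<omega>. ?t i \<omega> \<partial>?M) = (\<integral>\<^sup>+\<omega>. ?f (history \<omega> i, snd (snd \<omega>)) \<partial>?M)"
      by (intro nn_integral_cong)
    also have "\<dots> = (\<integral>\<^sup>+xs. \<integral>\<^sup>+e. ?f (xs, e) \<partial>clock_space \<partial>path_pmf P i x)"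
      by (subst nn_integral_history) auto
    finally show "(\<integral>\<^sup>+\<omega>. ?t i \<omega> \<partial>?M) =
      (\<integral>\<^sup>+xs. indicator {xs. x \<notin> set (tl xs)} xs * ennreal (1 / q (last xs)) \<partial>path_pmf P i x)"
      by (simp add: nn_integral_cmult nn_integral_clock)
  qed
  also have "(\<Sum>i. \<integral>\<^sup>+xs. indicator {xs. x \<notin> set (tl xs)} xs * ennreal (1 / q (last xs)) \<partial>path_pmf P i x) \<le>
    ennreal (1 / q x) + 1 / m x"
  proof (rule suminf_le_const)
    let ?s = "\<lambda>i. \<integral>\<^sup>+xs. indicator {xs. x \<notin> set (tl xs)} xs * ennreal (1 / q (last xs)) \<partial>path_pmf P i x"
    show "summable ?s" by simp
    fix n
    have s: "?s (Suc i) = (\<integral>\<^sup>+w. taboo x (\<lambda>z. ennreal (1 / q z)) i w \<partial>P x)" for i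
    proof -
      have "(\<integral>\<^sup>+xs. indicator {xs. x \<notin> set xs} xs * ennreal (1 / q (last (x # xs))) \<partial>path_pmf P i w) =
        taboo x (\<lambda>z. ennreal (1 / q z)) i w" for w
        unfolding taboo_eq_path
        by (intro nn_integral_cong_AE AE_pmfI) (auto dest!: set_path_pmf)
      moreover have "indicator {xs. x \<notin> set (tl xs)} (x # xs) = (indicator {xs. x \<notin> set xs} xs :: ennreal)" for xs
        by (simp add: indicator_def)
      ultimately show ?thesis by simp
    qed
    have m: "m x \<noteq> 0" "m x \<noteq> \<top>"
      using q_pos[of x] pmf_positive[OF x] by (auto simp: m_def)
    have "(\<Sum>i<n. ?s (Suc i)) = m x * (\<Sum>i<n. ?s (Suc i)) / m x"
      using m by (simp add: mult.commute[of "m x"] mult_divide_eq_ennreal)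
    also have "\<dots> \<le> 1 / m x"
      unfolding s using taboo_time_sum[of x n] by (rule divide_right_mono_ennreal)
    finally have *: "(\<Sum>i<n. ?s (Suc i)) \<le> 1 / m x" .
    have "(\<Sum>i<n. ?s i) \<le> (\<Sum>i<Suc n. ?s i)" by (intro sum_mono2) auto
    also have "\<dots> = ?s 0 + (\<Sum>i<n. ?s (Suc i))" by (rule sum.lessThan_Suc_shift)
    also have "\<dots> \<le> ennreal (1 / q x) + 1 / m x"
      using * by (intro add_mono) auto
    finally show "(\<Sum>i<n. ?s i) \<le> ennreal (1 / q x) + 1 / m x" .
  qed
  also have "\<dots> < \<infinity>"
    using q_pos[of x] pmf_positive[OF x] by (simp add: m_def divide_ennreal_def inverse_ennreal ennreal_mult_less_top)
  finally show ?thesis by (simp add: positive_recurrent_state_def)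
qed

end

section \<open>Path integrals and time reversal\<close>

fun path_integral :: "('a \<Rightarrow> real \<Rightarrow> real \<Rightarrow> ennreal) \<Rightarrow> 'a list \<Rightarrow> real \<Rightarrow> real \<Rightarrow> ennreal" where
  "path_integral \<kappa> (x # y # ys) a b =
     (\<integral>\<^sup>+u. \<kappa> x a u * path_integral \<kappa> (y # ys) u b * indicator {a..b} u \<partial>lborel)"
| "path_integral \<kappa> [x] a b = \<kappa> x a b"
| "path_integral \<kappa> [] a b = 0"

lemma measurable_path_integral:
  assumes k [measurable]: "\<And>x. (\<lambda>p. \<kappa> x (fst p) (snd p)) \<in> borel_measurable (borel \<Otimes>\<^sub>M borel)"
  shows "(\<lambda>p. path_integral \<kappa> xs (fst p) (snd p)) \<in> borel_measurable (borel \<Otimes>\<^sub>M borel)"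
proof (induction xs rule: induct_list012)
  case (3 x y ys)
  have [measurable]: "(\<lambda>p. \<kappa> x (fst (fst p)) (snd p)) \<in> borel_measurable ((borel \<Otimes>\<^sub>M borel) \<Otimes>\<^sub>M lborel)"
    using measurable_compose[OF _ k[of x], of "\<lambda>p. (fst (fst p), snd p)" "(borel \<Otimes>\<^sub>M borel) \<Otimes>\<^sub>M lborel"] by simp
  have [measurable]: "(\<lambda>p. path_integral \<kappa> (y # ys) (snd p) (snd (fst p))) \<in> borel_measurable ((borel \<Otimes>\<^sub>M borel) \<Otimes>\<^sub>M lborel)"
    using measurable_compose[OF _ 3(2), of "\<lambda>p. (snd p, snd (fst p))" "(borel \<Otimes>\<^sub>M borel) \<Otimes>\<^sub>M lborel"] by simp
  have "(\<lambda>p. path_integral \<kappa> (x # y # ys) (fst p) (snd p)) =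
    (\<lambda>p. \<integral>\<^sup>+u. \<kappa> x (fst p) u * path_integral \<kappa> (y # ys) u (snd p) *
      (if fst p \<le> u \<and> u \<le> snd p then 1 else 0) \<partial>lborel)"
    by (auto simp: fun_eq_iff indicator_def intro!: nn_integral_cong)
  also have "\<dots> \<in> borel_measurable (borel \<Otimes>\<^sub>M borel)"
    by (rule lborel.borel_measurable_nn_integral) (simp add: split_beta', measurable)
  finally show ?case .
qed simp_all

lemma path_integral_snoc:
  assumes k [measurable]: "\<And>x. (\<lambda>p. \<kappa> x (fst p) (snd p)) \<in> borel_measurable (borel \<Otimes>\<^sub>M borel)"
    and "xs \<noteq> []"
  shows "path_integral \<kappa> (xs @ [z]) a b =
         (\<integral>\<^sup>+v. path_integral \<kappa> xs a v * \<kappa> z v b * indicator {a..b} v \<partial>lborel)"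
  using \<open>xs \<noteq> []\<close>
proof (induction xs arbitrary: a rule: induct_list012)
  case (3 x y ys)
  let ?F = "path_integral \<kappa> (y # ys)"
  have [measurable]: "(\<lambda>p. ?F (fst p) (snd p)) \<in> borel_measurable (borel \<Otimes>\<^sub>M borel)"
    by (rule measurable_path_integral) fact
  have [measurable]: "(\<lambda>u. \<kappa> x a u) \<in> borel_measurable borel"
    using measurable_compose[OF _ k[of x], of "\<lambda>u. (a, u)" borel] by simp
  have [measurable]: "(\<lambda>v. \<kappa> z v b) \<in> borel_measurable borel"
    using measurable_compose[OF _ k[of z], of "\<lambda>u. (u, b)" borel] by simp
  have [measurable]: "(\<lambda>u. ?F u v) \<in> borel_measurable borel" "(\<lambda>v. ?F u v) \<in> borel_measurable borel" for u v
    using measurable_compose[OF _ \<open>(\<lambda>p. ?F (fst p) (snd p)) \<in> _\<close>, of "\<lambda>u. (u, v)" borel]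
      measurable_compose[OF _ \<open>(\<lambda>p. ?F (fst p) (snd p)) \<in> _\<close>, of "\<lambda>v. (u, v)" borel] by simp_all
  let ?G = "\<lambda>u v. \<kappa> x a u * ?F u v * \<kappa> z v b * (if a \<le> u \<and> u \<le> v \<and> v \<le> b then 1 else 0)"
  have "path_integral \<kappa> ((x # y # ys) @ [z]) a b =
    (\<integral>\<^sup>+u. \<kappa> x a u * (\<integral>\<^sup>+v. ?F u v * \<kappa> z v b * indicator {u..b} v \<partial>lborel) * indicator {a..b} u \<partial>lborel)"
    using 3(2) by simp
  also have "\<dots> = (\<integral>\<^sup>+u. \<integral>\<^sup>+v. ?G u v \<partial>lborel \<partial>lborel)"
    by (auto simp: nn_integral_cmult[symmetric] nn_integral_multc[symmetric] indicator_def mult_ac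
        intro!: nn_integral_cong)
  also have "\<dots> = (\<integral>\<^sup>+v. \<integral>\<^sup>+u. ?G u v \<partial>lborel \<partial>lborel)"
  proof (rule lborel_pair.Fubini'[symmetric])
    show "case_prod ?G \<in> borel_measurable (lborel \<Otimes>\<^sub>M lborel)"
      by (simp add: split_beta', measurable)
  qed
  also have "\<dots> = (\<integral>\<^sup>+v. (\<integral>\<^sup>+u. \<kappa> x a u * ?F u v * indicator {a..v} u \<partial>lborel) * \<kappa> z v b * indicator {a..b} v \<partial>lborel)"
    by (auto simp: nn_integral_cmult[symmetric] nn_integral_multc[symmetric] indicator_def mult_ac
        intro!: nn_integral_cong)
  finally show ?case by simp
qed simp_all

lemma path_integral_reflect:
  assumes k [measurable]: "\<And>x. (\<lambda>p. \<kappa> x (fst p) (snd p)) \<in> borel_measurable (borel \<Otimes>\<^sub>M borel)"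
    and k': "\<And>x a b. \<kappa>' x a b = \<kappa> x (T - b) (T - a)"
  shows "path_integral \<kappa>' xs a b = path_integral \<kappa> (rev xs) (T - b) (T - a)"
proof (induction xs arbitrary: a rule: induct_list012)
  case (3 x y ys)
  let ?F = "path_integral \<kappa> (rev (y # ys))"
  have F: "(\<lambda>p. ?F (fst p) (snd p)) \<in> borel_measurable (borel \<Otimes>\<^sub>M borel)"
    by (rule measurable_path_integral) fact
  have [measurable]: "(\<lambda>v. ?F (T - b) v) \<in> borel_measurable borel"
    using measurable_compose[OF _ F, of "\<lambda>v. (T - b, v)" borel] by simp
  have [measurable]: "(\<lambda>v. \<kappa> x v (T - a)) \<in> borel_measurable borel"
    using measurable_compose[OF _ k[of x], of "\<lambda>v. (v, T - a)" borel] by simp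
  have "path_integral \<kappa> (rev (x # y # ys)) (T - b) (T - a) =
    (\<integral>\<^sup>+v. ?F (T - b) v * \<kappa> x v (T - a) * indicator {T - b..T - a} v \<partial>lborel)"
    using path_integral_snoc[where \<kappa>=\<kappa> and xs="rev (y # ys)" and z=x] k by simp
  also have "\<dots> = (\<integral>\<^sup>+u. ?F (T - b) (T - u) * \<kappa> x (T - u) (T - a) * indicator {T - b..T - a} (T - u) \<partial>lborel)"
    by (subst nn_integral_real_affine[where c="-1" and t=T]) (auto simp del: rev.simps)
  also have "\<dots> = (\<integral>\<^sup>+u. \<kappa>' x a u * path_integral \<kappa>' (y # ys) u b * indicator {a..b} u \<partial>lborel)"
    unfolding 3(2) k' by (auto intro!: nn_integral_cong simp: indicator_def mult_ac)
  finally show ?case by simp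
qed (simp_all add: k')

lemma path_integral_pos:
  assumes k: "\<And>x. (\<lambda>p. \<kappa> x (fst p) (snd p)) \<in> borel_measurable (borel \<Otimes>\<^sub>M borel)"
    and pos: "\<And>x u v. a \<le> u \<Longrightarrow> u < v \<Longrightarrow> v < b \<Longrightarrow> \<kappa> x u v > 0" "\<And>u. a \<le> u \<Longrightarrow> u < b \<Longrightarrow> \<kappa> (last xs) u b > 0"
    and "xs \<noteq> []" "a < b"
  shows "path_integral \<kappa> xs a b > 0"
  using assms(2-)
proof (induction xs arbitrary: a rule: induct_list012)
  case (3 x y ys)
  have F: "(\<lambda>p. path_integral \<kappa> (y # ys) (fst p) (snd p)) \<in> borel_measurable (borel \<Otimes>\<^sub>M borel)"
    by (rule measurable_path_integral) fact
  have [measurable]: "(\<lambda>v. path_integral \<kappa> (y # ys) v b) \<in> borel_measurable borel"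
    using measurable_compose[OF _ F, of "\<lambda>v. (v, b)" borel] by simp
  have [measurable]: "(\<lambda>v. \<kappa> x a v) \<in> borel_measurable borel"
    using measurable_compose[OF _ k[of x], of "\<lambda>v. (a, v)" borel] by simp
  let ?f = "\<lambda>u. \<kappa> x a u * path_integral \<kappa> (y # ys) u b * indicator {a..b} u"
  have "?f u > 0" if "a < u" "u < b" for u
  proof -
    have "path_integral \<kappa> (y # ys) u b > 0" using that 3(3,4) by (intro 3(2)) auto
    moreover have "\<kappa> x a u > 0" using 3(3) that by simp
    ultimately show ?thesis using that by (simp add: ennreal_zero_less_mult_iff)
  qed
  then have "{a<..<b} \<subseteq> {u. ?f u \<noteq> 0}" by force
  then have "emeasure lborel {a<..<b} \<le> emeasure lborel {u \<in> space lborel. ?f u \<noteq> 0}"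
    by (intro emeasure_mono) auto
  then have "emeasure lborel {u \<in> space lborel. ?f u \<noteq> 0} \<noteq> 0"
    using \<open>a < b\<close> by auto
  then have "(\<integral>\<^sup>+u. ?f u \<partial>lborel) \<noteq> 0"
    by (subst nn_integral_0_iff) auto
  then show ?case by (simp add: zero_less_iff_neq_zero)
qed simp_all

fun rate_prod :: "('a \<Rightarrow> 'a \<Rightarrow> real) \<Rightarrow> 'a list \<Rightarrow> real" where
  "rate_prod R (x # y # ys) = R x y * rate_prod R (y # ys)"
| "rate_prod R _ = 1"

lemma measurable_clock_exp1: "(\<lambda>e. e i) \<in> clock_space \<rightarrow>\<^sub>M exp1"
  by measurable

lemma measurable_clock_Cons: "(\<lambda>(s, e). case_nat s e) \<in> exp1 \<Otimes>\<^sub>M clock_space \<rightarrow>\<^sub>M clock_space"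
  unfolding clock_space_def by measurable

lemma rate_prod_snoc: "xs \<noteq> [] \<Longrightarrow> rate_prod R (xs @ [z]) = rate_prod R xs * R (last xs) z"
  by (induction xs rule: induct_list012) auto

context
  fixes q :: "'a::countable \<Rightarrow> real" and T :: real and M :: nat and t :: "nat \<Rightarrow> real" and z :: "nat \<Rightarrow> 'a"
begin

text \<open>\<open>segment_kernel\<close> closes the holding interval on the right, which makes it symmetric under
  time reversal; the actual process is right-continuous, so \<open>path_event\<close> has half-open intervals.\<close>

definition segment_kernel :: "'a \<Rightarrow> real \<Rightarrow> real \<Rightarrow> ennreal" where
  "segment_kernel x a b =
     ennreal (exp (- q x * (b - a))) * (if \<forall>i<M. a \<le> t i \<and> t i \<le> b \<longrightarrow> z i = x then 1 else 0)"

fun path_event :: "'a list \<Rightarrow> real \<Rightarrow> (nat \<Rightarrow> real) \<Rightarrow> bool" where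
  "path_event (x # y # ys) a e \<longleftrightarrow>
     a + e 0 / q x \<le> T \<and> (\<forall>i<M. a \<le> t i \<and> t i < a + e 0 / q x \<longrightarrow> z i = x) \<and>
     path_event (y # ys) (a + e 0 / q x) (\<lambda>i. e (Suc i))"
| "path_event [x] a e \<longleftrightarrow> a \<le> T \<and> T < a + e 0 / q x \<and> (\<forall>i<M. a \<le> t i \<and> t i \<le> T \<longrightarrow> z i = x)"
| "path_event [] a e \<longleftrightarrow> False"

lemma measurable_segment_kernel:
  "(\<lambda>p. segment_kernel x (fst p) (snd p)) \<in> borel_measurable (borel \<Otimes>\<^sub>M borel)"
  unfolding segment_kernel_def by measurable

lemma measurable_shift_clock [measurable]: "(\<lambda>e i. e (Suc i)) \<in> clock_space \<rightarrow>\<^sub>M clock_space"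
proof -
  have "(\<lambda>e i. e (Suc i)) \<in> clock_space \<rightarrow>\<^sub>M (\<Pi>\<^sub>M i\<in>UNIV. borel)"
    by (rule measurable_PiM_single') (auto intro: measurable_clock_component)
  then show ?thesis by (simp cong: measurable_cong_sets add: sets_clock)
qed

lemma measurable_path_event:
  "Measurable.pred (borel \<Otimes>\<^sub>M clock_space) (\<lambda>p. path_event xs (fst p) (snd p))"
proof (induction xs rule: induct_list012)
  case 1
  then show ?case by simp
next
  case (2 x)
  then show ?case by simp
next
  case (3 x y ys)
  have "Measurable.pred (borel \<Otimes>\<^sub>M clock_space)
    (\<lambda>p. path_event (y # ys) (fst p + snd p 0 / q x) (\<lambda>i. snd p (Suc i)))"
    using measurable_compose[OF _ 3(2), of "\<lambda>p. (fst p + snd p 0 / q x, \<lambda>i. snd p (Suc i))"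
        "borel \<Otimes>\<^sub>M clock_space"] by simp
  then show ?case by simp
qed

lemma sets_path_event: "{e. path_event xs a e} \<in> sets clock_space"
proof -
  have "Measurable.pred clock_space (\<lambda>e. path_event xs a e)"
    using measurable_compose[OF _ measurable_path_event, of "\<lambda>e. (a, e)" clock_space] by simp
  then show ?thesis by (simp add: pred_def)
qed

lemma measurable_emeasure_path_event:
  "(\<lambda>u. emeasure clock_space {e. path_event xs u e}) \<in> borel_measurable borel"
proof -
  have "{p \<in> space (borel \<Otimes>\<^sub>M clock_space). path_event xs (fst p) (snd p)} \<in> sets (borel \<Otimes>\<^sub>M clock_space)"
    using measurable_path_event by (simp add: pred_def)
  from clock.measurable_emeasure_Pair[OF this] show ?thesis
    by (simp add: vimage_def space_pair_measure)
qed

lemma emeasure_path_event_Cons: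
  assumes q: "q x > 0"
  shows "emeasure clock_space {e. path_event (x # y # ys) a e} = ennreal (q x) *
    (\<integral>\<^sup>+u. segment_kernel x a u * emeasure clock_space {e. path_event (y # ys) u e} * indicator {a..T} u \<partial>lborel)"
proof -
  let ?E = "\<lambda>u. emeasure clock_space {e. path_event (y # ys) u e}"
  let ?h = "\<lambda>u. if u \<le> T \<and> (\<forall>i<M. a \<le> t i \<and> t i < u \<longrightarrow> z i = x) then 1 else 0 :: ennreal"
  interpret P: pair_sigma_finite exp1 clock_space ..
  note [measurable] = measurable_emeasure_path_event[of "y # ys"]
  have "emeasure clock_space {e. path_event (x # y # ys) a e} =
    emeasure (exp1 \<Otimes>\<^sub>M clock_space) ((\<lambda>(s, e). case_nat s e) -` {e. path_event (x # y # ys) a e} \<inter> space (exp1 \<Otimes>\<^sub>M clock_space))"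
    by (subst distr_clock_shift[symmetric], subst emeasure_distr)
       (auto intro!: sets_path_event measurable_clock_Cons)
  also have "\<dots> = (\<integral>\<^sup>+s. emeasure clock_space {e. path_event (x # y # ys) a (case_nat s e)} \<partial>exp1)"
  proof -
    show ?thesis
      by (subst clock.emeasure_pair_measure_alt[OF measurable_sets[OF measurable_clock_Cons sets_path_event]])
         (auto intro!: nn_integral_cong arg_cong2[where f=emeasure] simp: space_pair_measure)
  qed
  also have "\<dots> = (\<integral>\<^sup>+s. ?h (a + s / q x) * ?E (a + s / q x) \<partial>exp1)"
  proof (rule nn_integral_cong)
    fix s
    define A where "A \<longleftrightarrow> a + s / q x \<le> T \<and> (\<forall>i<M. a \<le> t i \<and> t i < a + s / q x \<longrightarrow> z i = x)"
    have "path_event (x # y # ys) a (case_nat s e) \<longleftrightarrow> A \<and> path_event (y # ys) (a + s / q x) e" for e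
      by (simp add: A_def)
    then have "{e. path_event (x # y # ys) a (case_nat s e)} = (if A then {e. path_event (y # ys) (a + s / q x) e} else {})"
      by (simp only: if_splits) auto
    then show "emeasure clock_space {e. path_event (x # y # ys) a (case_nat s e)} = ?h (a + s / q x) * ?E (a + s / q x)"
      unfolding A_def[symmetric] by (cases A) (simp_all only: if_True if_False mult_1 mult_zero_left emeasure_empty)
  qed
  also have "\<dots> = (\<integral>\<^sup>+s. ennreal (exponential_density 1 s) * (?h (a + s / q x) * ?E (a + s / q x)) \<partial>lborel)"
    by (subst nn_integral_density) auto
  also have "\<dots> = ennreal (q x) * (\<integral>\<^sup>+u. ennreal (exponential_density 1 (- q x * a + q x * u)) *
    (?h (a + (- q x * a + q x * u) / q x) * ?E (a + (- q x * a + q x * u) / q x)) \<partial>lborel)"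
    using q by (subst nn_integral_real_affine[where c="q x" and t="- q x * a"]) auto
  also have "(\<integral>\<^sup>+u. ennreal (exponential_density 1 (- q x * a + q x * u)) *
      (?h (a + (- q x * a + q x * u) / q x) * ?E (a + (- q x * a + q x * u) / q x)) \<partial>lborel) =
    (\<integral>\<^sup>+u. segment_kernel x a u * ?E u * indicator {a..T} u \<partial>lborel)"
  proof (rule nn_integral_cong_AE)
    have "AE u in lborel. \<forall>i. u \<noteq> t i"
      unfolding AE_all_countable by (intro allI AE_lborel_singleton)
    then show "AE u in lborel. ennreal (exponential_density 1 (- q x * a + q x * u)) *
        (?h (a + (- q x * a + q x * u) / q x) * ?E (a + (- q x * a + q x * u) / q x)) =
        segment_kernel x a u * ?E u * indicator {a..T} u"
    proof eventually_elim
      case (elim u)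
      have 1: "a + (- q x * a + q x * u) / q x = u" using q by (simp add: field_simps)
      have 2: "- q x * a + q x * u < 0 \<longleftrightarrow> u < a" using q by (simp add: mult_less_cancel_left_pos)
      have 3: "(\<forall>i<M. a \<le> t i \<and> t i < u \<longrightarrow> z i = x) \<longleftrightarrow> (\<forall>i<M. a \<le> t i \<and> t i \<le> u \<longrightarrow> z i = x)"
        using elim by (metis less_le)
      have 4: "exponential_density 1 (- q x * a + q x * u) = (if u < a then 0 else exp (- q x * (u - a)))"
        unfolding exponential_density_def 2 by (simp add: algebra_simps)
      show ?case
        unfolding 1 3 4 by (auto simp: segment_kernel_def indicator_def)
    qed
  qed
  finally show ?thesis .
qed

lemma emeasure_path_event_single:
  assumes "q x > 0" "a \<le> T"
  shows "emeasure clock_space {e. path_event [x] a e} = segment_kernel x a T"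
proof -
  have "emeasure clock_space {e. (T - a) * q x < e 0} = emeasure (distr clock_space exp1 (\<lambda>e. e 0)) {(T - a) * q x<..}"
    by (subst emeasure_distr) (auto intro!: measurable_clock_exp1 arg_cong2[where f=emeasure])
  also have "\<dots> = ennreal (exp (- ((T - a) * q x)))"
    unfolding distr_clock_component using assms by (intro emeasure_exp1_greaterThan) simp
  finally have *: "emeasure clock_space {e. (T - a) * q x < e 0} = ennreal (exp (- ((T - a) * q x)))" .
  define D where "D \<longleftrightarrow> (\<forall>i<M. a \<le> t i \<and> t i \<le> T \<longrightarrow> z i = x)"
  have iff: "T < a + s / q x \<longleftrightarrow> (T - a) * q x < s" for s
    using assms by (simp add: field_simps)
  have "{e. path_event [x] a e} = (if D then {e. (T - a) * q x < e 0} else {})"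
    unfolding path_event.simps iff D_def[symmetric] using assms by auto
  moreover have "segment_kernel x a T = (if D then ennreal (exp (- ((T - a) * q x))) else 0)"
    unfolding segment_kernel_def D_def[symmetric] by (simp add: mult.commute)
  ultimately show ?thesis
    using * by (simp only: if_distrib[of "emeasure clock_space"] emeasure_empty)
qed

lemma emeasure_path_event:
  assumes q: "\<And>x. q x > 0" and P: "\<And>x y. pmf (P x) y = R x y / q x" and R: "\<And>x y. 0 \<le> R x y"
    and "xs \<noteq> []" "a \<le> T"
  shows "ennreal (weight P xs) * emeasure clock_space {e. path_event xs a e} =
         ennreal (rate_prod R xs) * path_integral segment_kernel xs a T"
  using assms(4-)
proof (induction xs arbitrary: a rule: induct_list012)
  case (2 x)
  then show ?case using emeasure_path_event_single[OF q] by simp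
next
  case (3 x y ys)
  let ?E = "\<lambda>u. emeasure clock_space {e. path_event (y # ys) u e}"
  let ?w = "ennreal (weight P (y # ys))" and ?r = "ennreal (rate_prod R (y # ys))"
  have [measurable]: "(\<lambda>u. segment_kernel x a u) \<in> borel_measurable borel"
    using measurable_compose[OF _ measurable_segment_kernel, of "\<lambda>u. (a, u)" borel] by simp
  note [measurable] = measurable_emeasure_path_event[of "y # ys"]
  have [measurable]: "(\<lambda>u. path_integral segment_kernel (y # ys) u T) \<in> borel_measurable borel"
    using measurable_compose[OF _ measurable_path_integral[OF measurable_segment_kernel], of "\<lambda>u. (u, T)" borel] by simp
  have "ennreal (weight P (x # y # ys)) * emeasure clock_space {e. path_event (x # y # ys) a e} =
    ennreal (pmf (P x) y) * ?w * (ennreal (q x) *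
    (\<integral>\<^sup>+u. segment_kernel x a u * ?E u * indicator {a..T} u \<partial>lborel))"
    unfolding emeasure_path_event_Cons[OF q] by (simp add: ennreal_mult weight_nonneg)
  also have "\<dots> = ennreal (pmf (P x) y) * ennreal (q x) *
    (?w * (\<integral>\<^sup>+u. segment_kernel x a u * ?E u * indicator {a..T} u \<partial>lborel))"
    by (simp only: mult_ac)
  also have "ennreal (pmf (P x) y) * ennreal (q x) = ennreal (R x y)"
    using q[of x] by (simp add: P R flip: ennreal_mult)
  also have "?w * (\<integral>\<^sup>+u. segment_kernel x a u * ?E u * indicator {a..T} u \<partial>lborel) =
    (\<integral>\<^sup>+u. ?w * (segment_kernel x a u * ?E u * indicator {a..T} u) \<partial>lborel)"
    by (subst nn_integral_cmult) auto
  also have "\<dots> = (\<integral>\<^sup>+u. ?r * (segment_kernel x a u * path_integral segment_kernel (y # ys) u T * indicator {a..T} u) \<partial>lborel)"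
  proof (rule nn_integral_cong)
    fix u
    show "?w * (segment_kernel x a u * ?E u * indicator {a..T} u) =
      ?r * (segment_kernel x a u * path_integral segment_kernel (y # ys) u T * indicator {a..T} u)"
    proof (cases "u \<in> {a..T}")
      case True
      then have "?w * ?E u = ?r * path_integral segment_kernel (y # ys) u T"
        by (intro 3(2)) auto
      then show ?thesis
        using True by (simp only: indicator_simps mult_1_right mult.left_commute[of _ "segment_kernel x a u"])
    qed simp
  qed
  also have "\<dots> = ?r * (\<integral>\<^sup>+u. segment_kernel x a u * path_integral segment_kernel (y # ys) u T * indicator {a..T} u \<partial>lborel)"
    by (subst nn_integral_cmult) auto
  finally show ?case
    by (simp add: ennreal_mult' R mult.assoc)
qed simp

lemma path_event_iff:
  fixes xs :: "'a list"
  defines "S \<equiv> \<lambda>xs a e j. a + (\<Sum>l<j. e l / q (xs ! l))"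
  assumes q: "\<And>x. q x > 0" and e: "\<forall>i. 0 < e i" and t: "\<And>i. i < M \<Longrightarrow> t i \<le> T" and xs: "xs \<noteq> []"
  shows "path_event xs a e \<longleftrightarrow>
    S xs a e (length xs - 1) \<le> T \<and> T < S xs a e (length xs) \<and>
    (\<forall>i<M. \<forall>j<length xs. S xs a e j \<le> t i \<and> t i < S xs a e (Suc j) \<longrightarrow> z i = xs ! j)"
  using xs e
proof (induction xs arbitrary: a e rule: induct_list012)
  case (2 x)
  then show ?case using t by (force simp: S_def)
next
  case (3 x y ys)
  let ?a = "a + e 0 / q x" and ?e = "\<lambda>i. e (Suc i)"
  have S: "S (x # y # ys) a e (Suc j) = S (y # ys) ?a ?e j" for j
    unfolding S_def sum.lessThan_Suc_shift by simp
  have S0: "S (x # y # ys) a e 0 = a" "S (y # ys) ?a ?e 0 = ?a" by (simp_all add: S_def)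
  have mono: "?a \<le> S (y # ys) ?a ?e j" for j
    using 3(4) q by (simp add: S_def sum_nonneg less_imp_le)
  have IH: "path_event (y # ys) ?a ?e \<longleftrightarrow>
    S (y # ys) ?a ?e (length ys) \<le> T \<and> T < S (y # ys) ?a ?e (Suc (length ys)) \<and>
    (\<forall>i<M. \<forall>j<Suc (length ys). S (y # ys) ?a ?e j \<le> t i \<and> t i < S (y # ys) ?a ?e (Suc j) \<longrightarrow> z i = (y # ys) ! j)"
    using 3(2)[of ?e ?a] 3(4) by simp
  have all: "(\<forall>j<Suc (Suc (length ys)). Q j) \<longleftrightarrow> Q 0 \<and> (\<forall>j<Suc (length ys). Q (Suc j))" for Q :: "nat \<Rightarrow> bool"
    by (rule All_less_Suc2)
  show ?case
    unfolding path_event.simps IH list.size add_0_right add_Suc_right diff_Suc_1 S all S0 nth_Cons_0 nth_Cons_Suc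
    using mono[of "length ys"] by (auto simp: S0)
qed simp

end

context regular_rates
begin

lemma path_event_history:
  assumes e: "\<forall>i. 0 < snd (snd \<omega>) i" and t: "\<And>i. i < M \<Longrightarrow> 0 \<le> t i \<and> t i \<le> T" and T: "0 \<le> T"
  shows "path_event q T M t z (history \<omega> k) 0 (snd (snd \<omega>)) \<longleftrightarrow>
    jump_time R \<omega> k \<le> ennreal T \<and> ennreal T < jump_time R \<omega> (Suc k) \<and>
    (\<forall>i<M. ctmc R (t i) \<omega> = Some (z i))"
proof -
  define s where "s j = (\<Sum>l<j. snd (snd \<omega>) l / q (jump_chain \<omega> l))" for j
  have J: "jump_time R \<omega> j = ennreal (s j)" for j
    unfolding s_def by (rule jump_time_eq[OF e])
  have s0: "0 \<le> s j" for j
    unfolding s_def using e q_pos by (intro sum_nonneg) (simp add: less_imp_le)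
  have s_mono: "s i \<le> s j" if "i \<le> j" for i j
    unfolding s_def using e q_pos that by (intro sum_mono2) (auto simp: less_imp_le)
  have le: "jump_time R \<omega> j \<le> ennreal u \<longleftrightarrow> s j \<le> u" and less: "ennreal u < jump_time R \<omega> j \<longleftrightarrow> u < s j"
    if "0 \<le> u" for j u
    using that s0 by (auto simp: J ennreal_less_iff)
  have ne: "history \<omega> k \<noteq> []" using length_history[of \<omega> k] by (metis list.size(3) nat.distinct(1))
  have "path_event q T M t z (history \<omega> k) 0 (snd (snd \<omega>)) \<longleftrightarrow>
    s k \<le> T \<and> T < s (Suc k) \<and>
    (\<forall>i<M. \<forall>j<Suc k. s j \<le> t i \<and> t i < s (Suc j) \<longrightarrow> z i = jump_chain \<omega> j)"
    using t e q_pos ne by (subst path_event_iff) (auto simp: nth_history s_def[symmetric] simp del: sum.lessThan_Suc)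
  moreover have "(\<forall>j<Suc k. s j \<le> t i \<and> t i < s (Suc j) \<longrightarrow> z i = jump_chain \<omega> j) \<longleftrightarrow>
    ctmc R (t i) \<omega> = Some (z i)" if i: "i < M" and k: "T < s (Suc k)" for i
  proof
    assume *: "\<forall>j<Suc k. s j \<le> t i \<and> t i < s (Suc j) \<longrightarrow> z i = jump_chain \<omega> j"
    have "ennreal (t i) < jump_time R \<omega> (Suc k)" using t[OF i] k by (simp add: less)
    then obtain x where x: "ctmc R (t i) \<omega> = Some x" unfolding ctmc_def by metis
    then obtain j where j: "s j \<le> t i" "t i < s (Suc j)" "x = jump_chain \<omega> j"
      using t[OF i] by (auto simp: ctmc_eq_Some_iff le less)
    have "j < Suc k" using s_mono[of "Suc k" j] j(1) t[OF i] k by force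
    then show "ctmc R (t i) \<omega> = Some (z i)" using * j x by simp
  next
    assume "ctmc R (t i) \<omega> = Some (z i)"
    then obtain j where j: "s j \<le> t i" "t i < s (Suc j)" "jump_chain \<omega> j = z i"
      using t[OF i] by (auto simp: ctmc_eq_Some_iff le less)
    have "j' = j" if "s j' \<le> t i" "t i < s (Suc j')" for j'
      using s_mono[of "Suc j" j'] s_mono[of "Suc j'" j] j that by (meson le_less_trans not_less not_less_eq_eq less_le_not_le linorder_cases Suc_leI)
    then show "\<forall>j<Suc k. s j \<le> t i \<and> t i < s (Suc j) \<longrightarrow> z i = jump_chain \<omega> j"
      using j(3) by auto
  qed
  ultimately show ?thesis
    using T by (auto simp: le less)
qed

definition path_set :: "real \<Rightarrow> nat \<Rightarrow> (nat \<Rightarrow> real) \<Rightarrow> (nat \<Rightarrow> 'a) \<Rightarrow> 'a list \<Rightarrow> 'a sample set" where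
  "path_set T M t z xs = {\<omega>. history \<omega> (length xs - 1) = xs \<and>
     snd (snd \<omega>) \<in> {e. path_event q T M t z xs 0 e \<and> (\<forall>i. 0 < e i)}}"

definition path_density :: "real \<Rightarrow> nat \<Rightarrow> (nat \<Rightarrow> real) \<Rightarrow> (nat \<Rightarrow> 'a) \<Rightarrow> 'a pmf \<Rightarrow> 'a list \<Rightarrow> ennreal" where
  "path_density T M t z \<nu> xs =
     ennreal (pmf \<nu> (hd xs) * rate_prod R xs) * path_integral (segment_kernel q M t z) xs 0 T"

lemma sets_clock_pos: "{e. \<forall>i. 0 < e i} \<in> sets clock_space"
proof -
  have "{e \<in> space clock_space. \<forall>i. 0 < e i} \<in> sets clock_space" by measurable
  then show ?thesis by simp
qed

lemma sets_path_event_pos: "{e. path_event q T M t z xs 0 e \<and> (\<forall>i. 0 < e i)} \<in> sets clock_space"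
  using sets.Int[OF sets_path_event[of q T M t z xs 0] sets_clock_pos] by (simp add: Collect_conj_eq)

lemma sets_path_set: "path_set T M t z xs \<in> sets (ctmc_space R \<nu>)"
proof -
  note [measurable] = sets_path_event_pos[of T M t z xs]
  have "{\<omega> \<in> space (ctmc_space R \<nu>). history \<omega> (length xs - 1) = xs \<and>
     snd (snd \<omega>) \<in> {e. path_event q T M t z xs 0 e \<and> (\<forall>i. 0 < e i)}} \<in> sets (ctmc_space R \<nu>)"
    by measurable
  then show ?thesis by (simp add: path_set_def)
qed

lemma emeasure_path_set:
  assumes "xs \<noteq> []" "0 \<le> T"
  shows "emeasure (ctmc_space R \<nu>) (path_set T M t z xs) = path_density T M t z \<nu> xs"
proof -
  let ?E = "{e. path_event q T M t z xs 0 e \<and> (\<forall>i. 0 < e i)}"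
  have "emeasure clock_space ?E = emeasure clock_space {e. path_event q T M t z xs 0 e}"
    using AE_clock_pos by (intro emeasure_eq_AE sets_path_event sets_path_event_pos) auto
  moreover have "ennreal (weight P xs) * emeasure clock_space {e. path_event q T M t z xs 0 e} =
      ennreal (rate_prod R xs) * path_integral (segment_kernel q M t z) xs 0 T"
    using assms by (intro emeasure_path_event q_pos pmf_jump nonneg) auto
  ultimately show ?thesis
    unfolding path_set_def path_density_def
    by (subst emeasure_history_clock[OF assms(1) sets_path_event_pos])
       (simp add: ennreal_mult' mult.assoc)
qed

lemma path_set_subset:
  assumes "\<And>i. i < M \<Longrightarrow> 0 \<le> t i \<and> t i \<le> T" "0 \<le> T" "\<omega> \<in> path_set T M t z xs" "xs \<noteq> []"
  shows "jump_time R \<omega> (length xs - 1) \<le> ennreal T" "ennreal T < jump_time R \<omega> (length xs)"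
    "i < M \<Longrightarrow> ctmc R (t i) \<omega> = Some (z i)"
  using assms path_event_history[of \<omega> M t T z "length xs - 1"] by (auto simp: path_set_def)

lemma sets_ctmc_event:
  fixes M :: nat
  shows "{\<omega>. \<forall>i<M. ctmc R (t i) \<omega> = Some (z i)} \<in> sets (ctmc_space R \<nu>)"
proof -
  have "{\<omega> \<in> space (ctmc_space R \<nu>). \<forall>i\<in>{..<M}. ctmc R (t i) \<omega> = Some (z i)} \<in> sets (ctmc_space R \<nu>)"
    using measurable_ctmc_eq by (intro sets.sets_Collect_finite_All) (auto simp: pred_def)
  then show ?thesis by (simp add: Ball_def)
qed

lemma path_density_le:
  assumes "xs \<noteq> []" "\<And>i. i < M \<Longrightarrow> 0 \<le> t i \<and> t i \<le> T" "0 \<le> T"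
  shows "path_density T M t z \<nu> xs \<le> emeasure (ctmc_space R \<nu>) {\<omega>. \<forall>i<M. ctmc R (t i) \<omega> = Some (z i)}"
  unfolding emeasure_path_set[OF assms(1,3), symmetric]
  using path_set_subset(3)[OF assms(2,3) _ assms(1)]
  by (intro emeasure_mono sets_ctmc_event) auto

lemma emeasure_ctmc_event:
  assumes ne: "AE \<omega> in ctmc_space R \<nu>. \<exists>k. ennreal T < jump_time R \<omega> k"
    and t: "\<And>i. i < M \<Longrightarrow> 0 \<le> t i \<and> t i \<le> T" and T: "0 \<le> T"
  shows "emeasure (ctmc_space R \<nu>) {\<omega>. \<forall>i<M. ctmc R (t i) \<omega> = Some (z i)} =
    (\<integral>\<^sup>+xs. path_density T M t z \<nu> xs \<partial>count_space {xs. xs \<noteq> []})"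
proof -
  let ?U = "\<Union>(path_set T M t z ` {xs. xs \<noteq> []})"
  have "disjoint_family_on (path_set T M t z) {xs. xs \<noteq> []}"
  proof (unfold disjoint_family_on_def, intro ballI impI equals0I)
    fix xs ys \<omega> assume ne: "xs \<in> {xs. xs \<noteq> []}" "ys \<in> {xs. xs \<noteq> []}" "xs \<noteq> ys"
      and \<omega>: "\<omega> \<in> path_set T M t z xs \<inter> path_set T M t z ys"
    have *: "length xs \<le> length ys" if "xs \<noteq> []" "ys \<noteq> []" "\<omega> \<in> path_set T M t z xs" "\<omega> \<in> path_set T M t z ys" for xs ys
    proof (rule ccontr)
      assume "\<not> length xs \<le> length ys"
      then have "jump_time R \<omega> (length ys) \<le> jump_time R \<omega> (length xs - 1)"
        by (intro monoD[OF mono_jump_time]) auto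
      then show False
        using path_set_subset(1)[OF t T that(3,1)] path_set_subset(2)[OF t T that(4,2)] by auto
    qed
    from *[of xs ys] *[of ys xs] ne \<omega> have "length xs = length ys" by auto
    then show False using ne \<omega> by (auto simp: path_set_def)
  qed
  then have "emeasure (ctmc_space R \<nu>) ?U = (\<integral>\<^sup>+xs. emeasure (ctmc_space R \<nu>) (path_set T M t z xs) \<partial>count_space {xs. xs \<noteq> []})"
    by (intro emeasure_UN_countable sets_path_set countableI_type)
  also have "\<dots> = (\<integral>\<^sup>+xs. path_density T M t z \<nu> xs \<partial>count_space {xs. xs \<noteq> []})"
    using T by (intro nn_integral_cong emeasure_path_set) auto
  finally have U: "emeasure (ctmc_space R \<nu>) ?U = \<dots>" .
  have "AE \<omega> in ctmc_space R \<nu>. (\<forall>i<M. ctmc R (t i) \<omega> = Some (z i)) \<longleftrightarrow> \<omega> \<in> ?U"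
    using ne AE_ctmc_clock[OF AE_clock_pos]
  proof eventually_elim
    case (elim \<omega>)
    obtain x where "ctmc R T \<omega> = Some x"
      using elim(1) mono_jump_time[of R \<omega>] unfolding ctmc_def
      by (metis lessI less_imp_le_nat less_le_trans monoD)
    then obtain k where "jump_time R \<omega> k \<le> ennreal T" "ennreal T < jump_time R \<omega> (Suc k)"
      by (auto simp: ctmc_eq_Some_iff)
    then have "\<omega> \<in> path_set T M t z (history \<omega> k)" if "\<forall>i<M. ctmc R (t i) \<omega> = Some (z i)"
      using that path_event_history[OF elim(2) t T] elim(2) by (simp add: path_set_def)
    moreover have "history \<omega> k \<noteq> []" using length_history[of \<omega> k] by (metis list.size(3) nat.distinct(1))
    ultimately show ?case
      using path_set_subset(3)[where M=M and t=t and T=T and \<omega>=\<omega> and z=z, OF t T] by auto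
  qed
  moreover have "?U \<in> sets (ctmc_space R \<nu>)"
    by (intro sets.countable_UN'' countableI_type sets_path_set)
  ultimately have "emeasure (ctmc_space R \<nu>) {\<omega>. \<forall>i<M. ctmc R (t i) \<omega> = Some (z i)} = emeasure (ctmc_space R \<nu>) ?U"
    by (intro emeasure_eq_AE sets_ctmc_event) auto
  then show ?thesis by (simp only: U)
qed

end

context reversible_rates
begin

lemma rate_prod_rev:
  "xs \<noteq> [] \<Longrightarrow> pmf \<pi> (last xs) * rate_prod R (rev xs) = pmf \<pi> (hd xs) * rate_prod R xs"
proof (induction xs rule: induct_list012)
  case (3 x y ys)
  have "pmf \<pi> (last (x # y # ys)) * rate_prod R (rev (x # y # ys)) =
    pmf \<pi> (last (y # ys)) * rate_prod R (rev (y # ys)) * R y x"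
    using rate_prod_snoc[of "rev (y # ys)" R x] by (simp add: last_rev)
  also have "\<dots> = pmf \<pi> y * R y x * rate_prod R (y # ys)"
    using 3(2) by simp
  finally show ?case by (simp add: balance[of y x])
qed auto

lemma path_density_reverse:
  assumes "xs \<noteq> []"
  shows "path_density T M (\<lambda>i. T - t i) z \<pi> xs = path_density T M t z \<pi> (rev xs)"
proof -
  have "path_integral (segment_kernel q M (\<lambda>i. T - t i) z) xs 0 T =
    path_integral (segment_kernel q M t z) (rev xs) (T - T) (T - 0)"
    by (rule path_integral_reflect[OF measurable_segment_kernel])
       (auto simp: segment_kernel_def algebra_simps)
  then show ?thesis
    using assms by (simp add: path_density_def rate_prod_rev hd_rev)
qed

lemma reversible_from_\<pi>:
  assumes ne: "AE \<omega> in ctmc_space R \<pi>. \<forall>T. \<exists>k. ennreal T < jump_time R \<omega> k"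
  shows "reversible_from R \<pi>"
  unfolding reversible_from_def
proof (intro allI impI)
  fix T :: real and M and t :: "nat \<Rightarrow> real" and z :: "nat \<Rightarrow> 'a"
  assume t: "\<forall>i<M. 0 \<le> t i \<and> t i \<le> T"
  let ?C = "ctmc_space R \<pi>"
  show "\<P>(\<omega> in ?C. \<forall>i<M. ctmc R (t i) \<omega> = Some (z i)) = \<P>(\<omega> in ?C. \<forall>i<M. ctmc R (T - t i) \<omega> = Some (z i))"
  proof (cases "M = 0")
    case False
    then have T: "0 \<le> T" using t by force
    have ne': "AE \<omega> in ?C. \<exists>k. ennreal T < jump_time R \<omega> k" using ne by eventually_elim blast
    have "emeasure ?C {\<omega>. \<forall>i<M. ctmc R (T - t i) \<omega> = Some (z i)} =
      (\<integral>\<^sup>+xs. path_density T M (\<lambda>i. T - t i) z \<pi> xs \<partial>count_space {xs. xs \<noteq> []})"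
      using t T by (intro emeasure_ctmc_event ne') auto
    also have "\<dots> = (\<integral>\<^sup>+xs. path_density T M t z \<pi> (rev xs) \<partial>count_space {xs. xs \<noteq> []})"
      by (intro nn_integral_cong path_density_reverse) simp
    also have "\<dots> = (\<integral>\<^sup>+xs. path_density T M t z \<pi> xs \<partial>count_space {xs. xs \<noteq> []})"
      by (rule nn_integral_bij_count_space) (rule bij_betw_byWitness[where f'=rev], auto)
    also have "\<dots> = emeasure ?C {\<omega>. \<forall>i<M. ctmc R (t i) \<omega> = Some (z i)}"
      using t T by (intro emeasure_ctmc_event[symmetric] ne') auto
    finally show ?thesis by (simp add: measure_def)
  qed simp
qed

lemma reversible_imp_stationary:
  assumes "reversible_from R \<pi>"
  shows "stationary_distribution R \<pi>"
  unfolding stationary_distribution_def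
proof (intro allI impI)
  fix t :: real and z assume t: "0 \<le> t"
  have "\<P>(\<omega> in ctmc_space R \<pi>. ctmc R t \<omega> = Some z) = \<P>(\<omega> in ctmc_space R \<pi>. ctmc R 0 \<omega> = Some z)"
    using assms[unfolded reversible_from_def, rule_format, of 1 "\<lambda>_. t" t "\<lambda>_. z"] t by simp
  also have "\<dots> = measure (ctmc_space R \<pi>) {\<omega>. history \<omega> 0 \<in> {[z]}}"
  proof (rule measure_eq_AE)
    show "AE \<omega> in ctmc_space R \<pi>. \<omega> \<in> {\<omega> \<in> space (ctmc_space R \<pi>). ctmc R 0 \<omega> = Some z} \<longleftrightarrow>
      \<omega> \<in> {\<omega>. history \<omega> 0 \<in> {[z]}}"
      using AE_ctmc_clock[OF AE_clock_pos]
    proof eventually_elim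
      case (elim \<omega>)
      then have "ctmc R 0 \<omega> = Some (jump_chain \<omega> 0)" using ctmc_at_jump_time[of \<omega> 0] by simp
      then show ?case by (simp add: history_def)
    qed
    have "{\<omega> \<in> space (ctmc_space R \<pi>). history \<omega> 0 \<in> {[z]}} \<in> sets (ctmc_space R \<pi>)" by measurable
    then show "{\<omega>. history \<omega> 0 \<in> {[z]}} \<in> sets (ctmc_space R \<pi>)" by simp
  qed measurable
  also have "\<dots> = measure (bind_pmf \<pi> (path_pmf P 0)) {[z]}"
    by (simp only: measure_def emeasure_history)
  also have "\<dots> = pmf \<pi> z"
    using pmf_map_inj'[of "\<lambda>x. [x]" \<pi> z] path_pmf.simps(1)[of P, abs_def]
    by (simp add: measure_pmf_single map_pmf_def inj_on_def)
  finally show "\<P>(\<omega> in ctmc_space R \<pi>. ctmc R t \<omega> = Some z) = pmf \<pi> z" .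
qed

end

section \<open>Stationary distributions\<close>

lemma emeasure_ctmc_mixture:
  assumes A: "A \<in> sets (ctmc_space R \<nu>)"
  shows "emeasure (ctmc_space R \<nu>) A = (\<integral>\<^sup>+x. emeasure (ctmc_space R (return_pmf x)) A \<partial>\<nu>)"
proof -
  interpret TC: prob_space "target_space R \<Otimes>\<^sub>M clock_space" by (rule prob_space_target_clock)
  have *: "emeasure (ctmc_space R \<mu>) A = (\<integral>\<^sup>+x. emeasure (target_space R \<Otimes>\<^sub>M clock_space) (Pair x -` A) \<partial>\<mu>)" for \<mu>
  proof -
    have "A \<in> sets (ctmc_space R \<mu>)" using A by (simp add: sets_ctmc)
    then show ?thesis unfolding ctmc_space_eq by (rule TC.emeasure_pair_measure_alt)
  qed
  show ?thesis unfolding * by (simp add: nn_integral_return_pmf)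
qed

lemma AE_ctmc_mixture:
  assumes A: "{\<omega>. \<not> Q \<omega>} \<in> sets (ctmc_space R \<nu>)"
    and "\<And>x. x \<in> set_pmf \<nu> \<Longrightarrow> AE \<omega> in ctmc_space R (return_pmf x). Q \<omega>"
  shows "AE \<omega> in ctmc_space R \<nu>. Q \<omega>"
proof -
  have "emeasure (ctmc_space R (return_pmf x)) {\<omega>. \<not> Q \<omega>} = 0" if "x \<in> set_pmf \<nu>" for x
  proof -
    have "{\<omega>. \<not> Q \<omega>} \<in> sets (ctmc_space R (return_pmf x))" using A by (simp add: sets_ctmc)
    from AE_iff_measurable[OF this] show ?thesis using assms(2)[OF that] by simp
  qed
  then have "emeasure (ctmc_space R \<nu>) {\<omega>. \<not> Q \<omega>} = 0"
    unfolding emeasure_ctmc_mixture[OF A] by (subst nn_integral_0_iff_AE) (auto simp: AE_measure_pmf_iff)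
  then show ?thesis
    by (subst AE_iff_measurable[OF A]) auto
qed

context regular_rates
begin

lemma accessible_path:
  assumes "accessible R x z"
  obtains xs where "xs \<noteq> []" "hd xs = x" "last xs = z" "rate_prod R xs > 0"
proof -
  have "\<exists>xs. xs \<noteq> [] \<and> hd xs = x \<and> last xs = z \<and> rate_prod R xs > 0"
    using assms unfolding accessible_def
  proof (induction rule: rtrancl_induct)
    case base
    show ?case by (rule exI[of _ "[x]"]) simp
  next
    case (step u v)
    then obtain xs where "xs \<noteq> []" "hd xs = x" "last xs = u" "rate_prod R xs > 0" by blast
    then show ?case using step.hyps(2)
      by (intro exI[of _ "xs @ [v]"]) (auto simp: rate_prod_snoc)
  qed
  then show ?thesis using that by blast
qed

lemma transition_pos:
  assumes "accessible R x z"
  shows "emeasure (ctmc_space R (return_pmf x)) {\<omega>. ctmc R 1 \<omega> = Some z} > 0"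
proof -
  from assms obtain xs where xs: "xs \<noteq> []" "hd xs = x" "last xs = z" "rate_prod R xs > 0"
    by (rule accessible_path)
  let ?t = "\<lambda>_::nat. 1::real" and ?z = "\<lambda>_::nat. z"
  have "path_integral (segment_kernel q 1 ?t ?z) xs 0 1 > 0"
  proof (rule path_integral_pos[OF measurable_segment_kernel])
    show "0 < segment_kernel q 1 ?t ?z x u v" if "v < 1" for x u v
      using that by (simp add: segment_kernel_def)
    show "0 < segment_kernel q 1 ?t ?z (last xs) u 1" for u
      using xs(3) by (simp add: segment_kernel_def)
  qed (use xs in auto)
  then have "0 < path_density 1 1 ?t ?z (return_pmf x) xs"
    using xs by (simp add: path_density_def ennreal_zero_less_mult_iff)
  also have "\<dots> \<le> emeasure (ctmc_space R (return_pmf x)) {\<omega>. \<forall>i<1::nat. ctmc R (?t i) \<omega> = Some (?z i)}"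
    using xs by (intro path_density_le) auto
  finally show ?thesis by simp
qed

lemma transition_sum_le:
  "(\<integral>\<^sup>+z. emeasure (ctmc_space R \<nu>) {\<omega>. ctmc R t \<omega> = Some z} \<partial>count_space UNIV) \<le> 1"
proof -
  interpret prob_space "ctmc_space R \<nu>" by (rule prob_space_ctmc)
  have m: "{\<omega>. ctmc R t \<omega> = Some z} \<in> events" for z
    using measurable_ctmc_eq[where R=R and \<nu>=\<nu> and t=t and z=z] by (simp add: pred_def)
  have "(\<integral>\<^sup>+z. emeasure (ctmc_space R \<nu>) {\<omega>. ctmc R t \<omega> = Some z} \<partial>count_space UNIV) =
    emeasure (ctmc_space R \<nu>) (\<Union>z\<in>UNIV. {\<omega>. ctmc R t \<omega> = Some z})"
    by (rule emeasure_UN_countable[symmetric]) (auto simp: disjoint_family_on_def m)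
  then show ?thesis by (simp add: emeasure_le_1)
qed

lemma stationary_distributionD:
  assumes "stationary_distribution R \<nu>"
  shows "ennreal (pmf \<nu> z) =
    (\<integral>\<^sup>+x. ennreal (pmf \<nu> x) * emeasure (ctmc_space R (return_pmf x)) {\<omega>. ctmc R 1 \<omega> = Some z} \<partial>count_space UNIV)"
proof -
  interpret prob_space "ctmc_space R \<nu>" by (rule prob_space_ctmc)
  have m: "{\<omega>. ctmc R 1 \<omega> = Some z} \<in> events"
    using measurable_ctmc_eq[where R=R and \<nu>=\<nu> and t=1 and z=z] by (simp add: pred_def)
  have "measure (ctmc_space R \<nu>) {\<omega>. ctmc R 1 \<omega> = Some z} = pmf \<nu> z"
    using assms[unfolded stationary_distribution_def, rule_format, of 1 z] by simp
  then have "ennreal (pmf \<nu> z) = emeasure (ctmc_space R \<nu>) {\<omega>. ctmc R 1 \<omega> = Some z}"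
    by (simp add: emeasure_eq_measure)
  then show ?thesis
    by (simp add: emeasure_ctmc_mixture[OF m] nn_integral_measure_pmf)
qed

end

lemma nn_integral_count_space_eq_if_le:
  fixes f g :: "'a \<Rightarrow> ennreal"
  assumes le: "\<And>x. f x \<le> g x" and "(\<integral>\<^sup>+x. g x \<partial>count_space UNIV) \<le> (\<integral>\<^sup>+x. f x \<partial>count_space UNIV)"
    and fin: "(\<integral>\<^sup>+x. f x \<partial>count_space UNIV) < \<infinity>"
  shows "f x = g x"
proof -
  have "(\<integral>\<^sup>+x. g x - f x \<partial>count_space UNIV) = (\<integral>\<^sup>+x. g x \<partial>count_space UNIV) - (\<integral>\<^sup>+x. f x \<partial>count_space UNIV)"
    using fin le by (intro nn_integral_diff) auto
  also have "\<dots> = 0" using assms(2,3) by (simp add: diff_eq_0_iff_ennreal less_top)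
  finally have "g x - f x = 0" by (simp add: nn_integral_0_iff_AE AE_count_space)
  then have "g x \<le> f x \<or> g x = \<infinity>" by (simp add: diff_eq_0_iff_ennreal)
  moreover have "f x < \<infinity>"
  proof -
    have "f x = (\<integral>\<^sup>+y. f y * indicator {x} y \<partial>count_space UNIV)"
      by (simp add: nn_integral_indicator_singleton')
    also have "\<dots> \<le> (\<integral>\<^sup>+y. f y \<partial>count_space UNIV)" by (intro nn_integral_mono) (simp add: indicator_def)
    finally show ?thesis using fin by simp
  qed
  ultimately show ?thesis using le[of x] \<open>g x - f x = 0\<close> by (auto simp: diff_eq_0_iff_ennreal antisym)
qed

lemma pmf_le_imp_eq:
  assumes "\<And>x. pmf \<mu> x \<le> pmf \<nu> x"
  shows "\<mu> = \<nu>"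
proof (rule pmf_eqI)
  fix x
  have "ennreal (pmf \<mu> x) = ennreal (pmf \<nu> x)"
    by (rule nn_integral_count_space_eq_if_le) (auto simp: assms nn_integral_pmf measure_pmf.emeasure_space_1[simplified])
  then show "pmf \<mu> x = pmf \<nu> x" by simp
qed

context regular_rates
begin

text \<open>The positive part of \<open>\<mu> - \<nu>\<close> is subinvariant under the contraction given by the transition
  probabilities at time 1, hence invariant; it vanishes at \<open>x\<^sub>0\<close>, which is reached from everywhere.\<close>

lemma stationary_le:
  assumes \<mu>: "stationary_distribution R \<mu>" and \<nu>: "stationary_distribution R \<nu>"
    and acc: "\<And>x. accessible R x x\<^sub>0" and le: "pmf \<mu> x\<^sub>0 \<le> pmf \<nu> x\<^sub>0"
  shows "\<mu> = \<nu>"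
proof (rule pmf_le_imp_eq)
  fix x0
  let ?p = "\<lambda>x z. emeasure (ctmc_space R (return_pmf x)) {\<omega>. ctmc R 1 \<omega> = Some z}"
  \<comment> \<open>\<open>ennreal\<close> truncates, so this is the positive part of the difference.\<close>
  define \<tau> where "\<tau> x = ennreal (pmf \<mu> x - pmf \<nu> x)" for x
  let ?\<tau>p = "\<lambda>z. \<integral>\<^sup>+x. \<tau> x * ?p x z \<partial>count_space UNIV"
  have \<mu>_le: "ennreal (pmf \<mu> x) \<le> ennreal (pmf \<nu> x) + \<tau> x" for x
  proof (cases "pmf \<mu> x \<le> pmf \<nu> x")
    case True
    then have "ennreal (pmf \<mu> x) \<le> ennreal (pmf \<nu> x)" by (rule ennreal_leI)
    then show ?thesis by (rule order_trans) simp
  next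
    case False
    then have "ennreal (pmf \<nu> x) + \<tau> x = ennreal (pmf \<nu> x + (pmf \<mu> x - pmf \<nu> x))"
      unfolding \<tau>_def by (intro ennreal_plus[symmetric]) auto
    then show ?thesis by simp
  qed
  have "\<tau> z \<le> ?\<tau>p z" for z
  proof -
    have "ennreal (pmf \<mu> z) = (\<integral>\<^sup>+x. ennreal (pmf \<mu> x) * ?p x z \<partial>count_space UNIV)"
      by (rule stationary_distributionD[OF \<mu>])
    also have "\<dots> \<le> (\<integral>\<^sup>+x. ennreal (pmf \<nu> x) * ?p x z + \<tau> x * ?p x z \<partial>count_space UNIV)"
      unfolding distrib_right[symmetric]
      by (intro nn_integral_mono mult_right_mono \<mu>_le) simp
    also have "\<dots> = (\<integral>\<^sup>+x. ennreal (pmf \<nu> x) * ?p x z \<partial>count_space UNIV) + ?\<tau>p z"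
      by (rule nn_integral_add) auto
    also have "(\<integral>\<^sup>+x. ennreal (pmf \<nu> x) * ?p x z \<partial>count_space UNIV) = ennreal (pmf \<nu> z)"
      by (rule stationary_distributionD[OF \<nu>, symmetric])
    finally have "ennreal (pmf \<mu> z) - ennreal (pmf \<nu> z) \<le> ?\<tau>p z"
      by (simp add: ennreal_minus_le_iff)
    then show ?thesis by (simp add: \<tau>_def ennreal_minus)
  qed
  moreover have "(\<integral>\<^sup>+z. ?\<tau>p z \<partial>count_space UNIV) \<le> (\<integral>\<^sup>+x. \<tau> x \<partial>count_space UNIV)"
  proof -
    have "(\<integral>\<^sup>+z. ?\<tau>p z \<partial>count_space UNIV) = (\<integral>\<^sup>+x. \<integral>\<^sup>+z. \<tau> x * ?p x z \<partial>count_space UNIV \<partial>count_space UNIV)"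
      by (rule nn_integral_count_space_nn_integral) auto
    also have "\<dots> = (\<integral>\<^sup>+x. \<tau> x * (\<integral>\<^sup>+z. ?p x z \<partial>count_space UNIV) \<partial>count_space UNIV)"
      by (simp add: nn_integral_cmult)
    also have "\<dots> \<le> (\<integral>\<^sup>+x. \<tau> x * 1 \<partial>count_space UNIV)"
      by (intro nn_integral_mono mult_left_mono transition_sum_le) auto
    finally show ?thesis by simp
  qed
  moreover have "(\<integral>\<^sup>+x. \<tau> x \<partial>count_space UNIV) < \<infinity>"
  proof -
    have "(\<integral>\<^sup>+x. \<tau> x \<partial>count_space UNIV) \<le> (\<integral>\<^sup>+x. ennreal (pmf \<mu> x) \<partial>count_space UNIV)"
      by (intro nn_integral_mono) (auto simp: \<tau>_def intro: ennreal_leI)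
    also have "\<dots> = 1" by (simp add: nn_integral_pmf measure_pmf.emeasure_space_1[simplified])
    finally show ?thesis by (rule le_less_trans) simp
  qed
  ultimately have "\<tau> x\<^sub>0 = ?\<tau>p x\<^sub>0" by (rule nn_integral_count_space_eq_if_le)
  then have "?\<tau>p x\<^sub>0 = 0" using le by (simp add: \<tau>_def ennreal_neg)
  then have "\<tau> x0 * ?p x0 x\<^sub>0 = 0" by (simp add: nn_integral_0_iff_AE AE_count_space)
  then have "\<tau> x0 = 0" using transition_pos[OF acc[of x0]] by auto
  then show "pmf \<mu> x0 \<le> pmf \<nu> x0" by (simp add: \<tau>_def ennreal_eq_0_iff)
qed

end

locale ergodic_rates = recurrent_rates +
  fixes x\<^sub>0 :: 'a
  assumes origin: "accessible R x x\<^sub>0" and origin_support: "x\<^sub>0 \<in> set_pmf \<pi>"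
    and absorbed: "never (set_pmf \<pi>) x = 0"
begin

lemma AE_nonexplosive_\<pi>: "AE \<omega> in ctmc_space R \<pi>. \<forall>t. \<exists>k. ennreal t < jump_time R \<omega> k"
proof (rule AE_nonexplosive[where x=x\<^sub>0], rule AE_ctmc_mixture)
  have "{\<omega> \<in> space (ctmc_space R \<pi>). \<not> (\<forall>n. \<exists>i\<ge>n. jump_chain \<omega> i = x\<^sub>0)} \<in> sets (ctmc_space R \<pi>)"
    by measurable
  then show "{\<omega>. \<not> (\<forall>n. \<exists>i\<ge>n. jump_chain \<omega> i = x\<^sub>0)} \<in> sets (ctmc_space R \<pi>)" by simp
  fix x assume x: "x \<in> set_pmf \<pi>"
  have "never {x\<^sub>0} z = 0" if "accessible R x z" for z
    using accessible_sym[OF origin accessible_support[OF that x]] by (rule no_escape[OF origin_support])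
  from AE_hit_infinitely_often[OF this]
  show "AE \<omega> in ctmc_space R (return_pmf x). \<forall>n. \<exists>i\<ge>n. jump_chain \<omega> i = x\<^sub>0" by simp
qed

lemma positive_recurrent: "positive_recurrent R"
  unfolding positive_recurrent_def
proof (intro exI[of _ "set_pmf \<pi>"] conjI ballI allI)
  show "set_pmf \<pi> \<noteq> {}" by (rule set_pmf_not_empty)
  fix x assume x: "x \<in> set_pmf \<pi>"
  then show "positive_recurrent_state R x" by (rule positive_recurrent_support)
  have "accessible R x\<^sub>0 z" if "z \<in> set_pmf \<pi>" for z
    using origin that by (rule accessible_sym)
  moreover have "accessible R x z" if "accessible R x x\<^sub>0" "accessible R x\<^sub>0 z" for z
    using that unfolding accessible_def by (rule rtrancl_trans)
  ultimately show "accessible R x z \<longleftrightarrow> z \<in> set_pmf \<pi>" for z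
    using x origin accessible_support by blast
next
  fix x
  show "AE \<omega> in ctmc_space R (return_pmf x). \<exists>t\<ge>0. \<exists>z\<in>set_pmf \<pi>. ctmc R t \<omega> = Some z"
    using AE_hit[OF absorbed[of x]] AE_ctmc_clock[OF AE_clock_pos]
  proof eventually_elim
    case (elim \<omega>)
    then obtain n where n: "jump_chain \<omega> n \<in> set_pmf \<pi>" by blast
    have "0 \<le> (\<Sum>i<n. snd (snd \<omega>) i / q (jump_chain \<omega> i))"
      using elim(2) q_pos by (intro sum_nonneg) (simp add: less_imp_le)
    then show ?case
      using n ctmc_at_jump_time[OF elim(2), of n] by blast
  qed
qed

lemma reversible: "reversible_from R \<pi>"
  using AE_nonexplosive_\<pi> by (rule reversible_from_\<pi>)

lemma stationary_iff: "stationary_distribution R \<nu> \<longleftrightarrow> \<nu> = \<pi>"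
proof
  assume \<nu>: "stationary_distribution R \<nu>"
  have \<pi>: "stationary_distribution R \<pi>" by (rule reversible_imp_stationary[OF reversible])
  show "\<nu> = \<pi>"
  proof (cases "pmf \<nu> x\<^sub>0 \<le> pmf \<pi> x\<^sub>0")
    case True
    then show ?thesis by (rule stationary_le[OF \<nu> \<pi> origin])
  next
    case False
    then have "\<pi> = \<nu>" by (intro stationary_le[OF \<pi> \<nu> origin]) simp
    then show ?thesis ..
  qed
qed (simp add: reversible_imp_stationary[OF reversible])

end

section \<open>The transitions of the network\<close>

datatype 's transition =
    Arrival 's | Departure 's
  | Free_move 's 's | Marked_move 's 's | Unmark_move 's 's | Mark_move 's 's
  | Customer_move 's 's | Customer_in 's | Customer_out 's

lemma UNIV_transition:
  "(UNIV :: 's transition set) =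
     range Arrival \<union> (range Departure \<union> (range (case_prod Free_move) \<union> (range (case_prod Marked_move) \<union>
     (range (case_prod Unmark_move) \<union> (range (case_prod Mark_move) \<union> (range (case_prod Customer_move) \<union>
     (range Customer_in \<union> range Customer_out)))))))"
proof (intro set_eqI iffI)
  fix x :: "'s transition"
  show "x \<in> range Arrival \<union> (range Departure \<union> (range (case_prod Free_move) \<union> (range (case_prod Marked_move) \<union>
     (range (case_prod Unmark_move) \<union> (range (case_prod Mark_move) \<union> (range (case_prod Customer_move) \<union>
     (range Customer_in \<union> range Customer_out)))))))"
    by (cases x) (auto simp: image_iff)
qed simp

instance transition :: (finite) finite
  by standard (subst UNIV_transition, simp)

lemma sum_transition:
  fixes g :: "'s::finite transition \<Rightarrow> 'b::comm_monoid_add"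
  shows "(\<Sum>\<tau>\<in>UNIV. g \<tau>) =
     (\<Sum>p\<in>UNIV. g (Arrival p)) + ((\<Sum>p\<in>UNIV. g (Departure p)) +
     ((\<Sum>k\<in>UNIV. \<Sum>l\<in>UNIV. g (Free_move k l)) + ((\<Sum>i\<in>UNIV. \<Sum>j\<in>UNIV. g (Marked_move i j)) +
     ((\<Sum>j\<in>UNIV. \<Sum>l\<in>UNIV. g (Unmark_move j l)) + ((\<Sum>k\<in>UNIV. \<Sum>j\<in>UNIV. g (Mark_move k j)) +
     ((\<Sum>j\<in>UNIV. \<Sum>j'\<in>UNIV. g (Customer_move j j')) +
     ((\<Sum>p\<in>UNIV. g (Customer_in p)) + (\<Sum>p\<in>UNIV. g (Customer_out p)))))))))"
proof -
  have 1: "(\<Sum>\<tau>\<in>range c. g \<tau>) = (\<Sum>p\<in>UNIV. g (c p))" if "inj c" for c :: "'s \<Rightarrow> 's transition"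
    using that by (simp add: sum.reindex)
  have 2: "(\<Sum>\<tau>\<in>range (case_prod c). g \<tau>) = (\<Sum>k\<in>UNIV. \<Sum>l\<in>UNIV. g (c k l))"
    if "inj (case_prod c)" for c :: "'s \<Rightarrow> 's \<Rightarrow> 's transition"
    using that by (simp add: sum.reindex sum.cartesian_product UNIV_Times_UNIV split_beta' comp_def)
  show ?thesis
    apply (subst UNIV_transition)
    apply (subst sum.union_disjoint, simp, simp, fastforce)+
    apply (subst 1 2, simp add: inj_def)+
    apply (rule refl)
    done
qed

fun enabled :: "'s transition \<Rightarrow> 's state \<Rightarrow> bool" where
  "enabled (Arrival p) (y, n) \<longleftrightarrow> True"
| "enabled (Departure p) (y, n) \<longleftrightarrow> n p \<ge> 1"
| "enabled (Free_move k l) (y, n) \<longleftrightarrow> k \<noteq> l \<and> y k = 0 \<and> y l = 0 \<and> n k \<ge> 1"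
| "enabled (Marked_move i j) (y, n) \<longleftrightarrow> i \<noteq> j \<and> y i \<ge> 1 \<and> y j \<ge> 1 \<and> n i \<ge> 1"
| "enabled (Unmark_move j l) (y, n) \<longleftrightarrow> y j \<ge> 1 \<and> y l = 0 \<and> n j \<ge> 1"
| "enabled (Mark_move k j) (y, n) \<longleftrightarrow> y k = 0 \<and> y j \<ge> 1 \<and> n k \<ge> 1"
| "enabled (Customer_move j j') (y, n) \<longleftrightarrow> y j \<ge> 1 \<and> j' \<noteq> j"
| "enabled (Customer_in p) (y, n) \<longleftrightarrow> True"
| "enabled (Customer_out p) (y, n) \<longleftrightarrow> y p \<ge> 1"

fun target :: "'s transition \<Rightarrow> 's state \<Rightarrow> 's state" where
  "target (Arrival p) (y, n) = (y, add_at p n)"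
| "target (Departure p) (y, n) = (y, remove_at p n)"
| "target (Free_move k l) (y, n) = (y, move k l n)"
| "target (Marked_move i j) (y, n) = (y, move i j n)"
| "target (Unmark_move j l) (y, n) = (y, move j l n)"
| "target (Mark_move k j) (y, n) = (y, move k j n)"
| "target (Customer_move j j') (y, n) = (move j j' y, n)"
| "target (Customer_in p) (y, n) = (add_at p y, n)"
| "target (Customer_out p) (y, n) = (remove_at p y, n)"

fun opposite :: "'s transition \<Rightarrow> 's transition" where
  "opposite (Arrival p) = Departure p"
| "opposite (Departure p) = Arrival p"
| "opposite (Free_move k l) = Free_move l k"
| "opposite (Marked_move i j) = Marked_move j i"
| "opposite (Unmark_move j l) = Mark_move l j"
| "opposite (Mark_move k j) = Unmark_move j k"
| "opposite (Customer_move j j') = Customer_move j' j"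
| "opposite (Customer_in p) = Customer_out p"
| "opposite (Customer_out p) = Customer_in p"

lemma opposite_opposite [simp]: "opposite (opposite \<tau>) = \<tau>"
  by (cases \<tau>) auto

lemma target_opposite:
  assumes "enabled \<tau> x"
  shows "enabled (opposite \<tau>) (target \<tau> x) \<and> target (opposite \<tau>) (target \<tau> x) = x"
proof -
  obtain y n where x: "x = (y, n)" by (cases x)
  show ?thesis
    using assms unfolding x
    by (cases \<tau>) (auto simp: add_at_def remove_at_def move_def fun_eq_iff)
qed

lemma add_at_same [simp]: "add_at p v p = Suc (v p)"
  by (simp add: add_at_def)

lemma remove_at_same: "1 \<le> v p \<Longrightarrow> Suc (remove_at p v p) = v p"
  by (simp add: remove_at_def)

lemma fun_upd_neq: "f p \<noteq> c \<Longrightarrow> f \<noteq> f(p := c)" "f r \<noteq> d \<Longrightarrow> f \<noteq> f(p := c, r := d)"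
  by (metis fun_upd_same)+

lemma target_neq:
  assumes "enabled \<tau> x"
  shows "x \<noteq> target \<tau> x"
proof -
  obtain y n where x: "x = (y, n)" by (cases x)
  show ?thesis
    using assms unfolding x
    by (cases \<tau>) (simp_all add: add_at_def remove_at_def move_def fun_upd_neq)
qed

definition total :: "('s::finite \<Rightarrow> nat) \<Rightarrow> nat" where
  "total v = (\<Sum>p\<in>UNIV. v p)"

lemma total_upd: "total (v(p := c)) + v p = total v + c"
proof -
  have *: "total w = w p + (\<Sum>r\<in>UNIV - {p}. w r)" for w :: "'a \<Rightarrow> nat"
    unfolding total_def by (rule sum.remove) auto
  show ?thesis using *[of v] *[of "v(p := c)"] by simp
qed

lemma total_add_at: "total (add_at p v) = Suc (total v)"
  using total_upd[of v p "v p + 1"] by (simp add: add_at_def)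

lemma total_remove_at: "1 \<le> v p \<Longrightarrow> Suc (total (remove_at p v)) = total v"
  using total_upd[of v p "v p - 1"] by (simp add: remove_at_def)

lemma total_move: "1 \<le> v i \<Longrightarrow> i \<noteq> k \<Longrightarrow> total (move i k v) = total v"
  using total_upd[of v i "v i - 1"] total_upd[of "v(i := v i - 1)" k "v k + 1"] by (simp add: move_def)

lemma finite_total_le: "finite {v :: 's::finite \<Rightarrow> nat. total v \<le> M}"
proof (rule finite_subset)
  show "{v :: 's \<Rightarrow> nat. total v \<le> M} \<subseteq> Pi\<^sub>E UNIV (\<lambda>_. {..M})"
  proof
    fix v :: "'s \<Rightarrow> nat" assume v: "v \<in> {v. total v \<le> M}"
    have "v p \<le> M" for p
      using v member_le_sum[of p UNIV v] by (simp add: total_def)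
    then show "v \<in> Pi\<^sub>E UNIV (\<lambda>_. {..M})" by (simp add: PiE_def)
  qed
  show "finite (Pi\<^sub>E UNIV (\<lambda>_::'s. {..M}))" by (rule finite_PiE) auto
qed

locale network =
  fixes lam mu :: "'s::finite \<Rightarrow> nat \<Rightarrow> 's config \<Rightarrow> real"
    and gam :: "'s \<Rightarrow> nat \<Rightarrow> real"
    and xi eta :: "'s \<Rightarrow> real"
    and beta theta eps :: "'s \<Rightarrow> 's \<Rightarrow> nat \<Rightarrow> nat \<Rightarrow> 's config \<Rightarrow> real"
    and tau :: "'s \<Rightarrow> 's \<Rightarrow> 's config \<Rightarrow> 's config \<Rightarrow> real"
  assumes lam_nonneg: "\<And>i n y. lam i n y \<ge> 0"
    and lam_bounded: "\<exists>L. \<forall>i n y. lam i n y \<le> L"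
    and lam_support: "\<And>i n y. lam i (n + 1) y > 0 \<Longrightarrow> lam i n y > 0"
    and mu_bounded_below: "\<exists>m>0. \<forall>i n y. n \<ge> 1 \<longrightarrow> m \<le> mu i n y"
    and gam_nonneg: "\<And>i n. gam i n \<ge> 0"
    and gam_0: "\<And>i. gam i 0 = 1"
    and gam_support: "\<And>i n. gam i (n + 1) > 0 \<Longrightarrow> gam i n > 0"
    and xi_pos: "\<And>k. xi k > 0"
    and eta_pos: "\<And>k. eta k > 0"
    and gam_bar_pos: "\<And>y n j j'. y j \<ge> (1::nat) \<Longrightarrow> j' \<noteq> j \<Longrightarrow>
          gam_bar gam j (n j) > 0 \<and> gam_bar gam j' (n j') > 0"
    and indep: "\<And>n y y'.
          (\<Prod>q\<in>UNIV. lam_bar lam q (n q) y / mu_bar mu q (n q) y) =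
          (\<Prod>q\<in>UNIV. lam_bar lam q (n q) y' / mu_bar mu q (n q) y')"
    and beta_pos: "\<And>n y k l. k \<noteq> l \<Longrightarrow> y k = 0 \<Longrightarrow> y l = 0 \<Longrightarrow> beta k l (n k) (n l) y > 0"
    and theta_pos: "\<And>n y j k. y j \<ge> 1 \<Longrightarrow> y k = 0 \<Longrightarrow>
          theta j k (n j) (n k) y > 0 \<and> theta k j (n k) (n j) y > 0"
    and eps_pos: "\<And>n y i j. i \<noteq> j \<Longrightarrow> y i \<ge> 1 \<Longrightarrow> y j \<ge> 1 \<Longrightarrow> eps i j (n i) (n j) y > 0"
    and tau_pos: "\<And>n y j j'. y j \<ge> 1 \<Longrightarrow> j' \<noteq> j \<Longrightarrow> tau j j' n y > 0"
    and beta_balance: "\<And>n y k l. k \<noteq> l \<Longrightarrow> y k = 0 \<Longrightarrow> y l = 0 \<Longrightarrow> n k \<ge> 1 \<Longrightarrow>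
          lam k (n k - 1) y / mu k (n k) y * beta k l (n k) (n l) y =
          lam l (n l) y / mu l (n l + 1) y * beta l k (n l + 1) (n k - 1) y"
    and theta_balance: "\<And>n y j k. y j \<ge> 1 \<Longrightarrow> y k = 0 \<Longrightarrow> n j \<ge> 1 \<Longrightarrow>
          lam j (n j - 1) y / mu j (n j) y * theta j k (n j) (n k) y =
          lam k (n k) y / mu k (n k + 1) y * theta k j (n k + 1) (n j - 1) y"
    and eps_balance: "\<And>n y i j. i \<noteq> j \<Longrightarrow> y i \<ge> 1 \<Longrightarrow> y j \<ge> 1 \<Longrightarrow> n i \<ge> 1 \<Longrightarrow>
          lam i (n i - 1) y * gam i (n i - 1) ^ y i / mu i (n i) y * eps i j (n i) (n j) y =
          lam j (n j) y * gam j (n j) ^ y j / mu j (n j + 1) y * eps j i (n j + 1) (n i - 1) y"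
    and tau_balance: "\<And>n y j j'. y j \<ge> 1 \<Longrightarrow> j' \<noteq> j \<Longrightarrow>
          tau j j' n y * (xi j / eta j) = tau j' j n (move j j' y) * (xi j' / eta j')"
    and Xi_finite: "Xi_sum lam mu gam xi eta < \<infinity>"
begin

abbreviation "net \<equiv> network_rate lam mu gam xi eta beta theta eps tau"

fun rate :: "'s transition \<Rightarrow> 's state \<Rightarrow> real" where
  "rate (Arrival p) (y, n) = lam p (n p) y * gam p (n p) ^ y p"
| "rate (Departure p) (y, n) = mu p (n p) y"
| "rate (Free_move k l) (y, n) = beta k l (n k) (n l) y"
| "rate (Marked_move i j) (y, n) = eps i j (n i) (n j) y"
| "rate (Unmark_move j l) (y, n) = theta j l (n j) (n l) y"
| "rate (Mark_move k j) (y, n) = theta k j (n k) (n j) y * gam j (n j) ^ y j"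
| "rate (Customer_move j j') (y, n) =
     inverse (gam_bar gam j (n j) ^ y j) * tau j j' n y * inverse (gam_bar gam j' (n j') ^ y j')"
| "rate (Customer_in p) (y, n) = xi p * gam_bar gam p (n p)"
| "rate (Customer_out p) (y, n) = eta p"

lemma net_eq_sum: "net x z = (\<Sum>\<tau>\<in>UNIV. if enabled \<tau> x \<and> z = target \<tau> x then rate \<tau> x else 0)"
proof -
  obtain y n y' n' where xz: "x = (y, n)" "z = (y', n')" by (cases x, cases z)
  show ?thesis
    unfolding xz sum_transition network_rate.simps enabled.simps target.simps rate.simps prod.inject
    by (simp only: conj_ac simp_thms add.assoc)
qed

lemma mu_pos: "1 \<le> k \<Longrightarrow> 0 < mu i k y"
  using mu_bounded_below by (meson less_le_trans)

lemma gam_bar_nonneg: "0 \<le> gam_bar gam i k"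
  unfolding gam_bar_def by (intro prod_nonneg) (simp add: gam_nonneg)

lemma rate_nonneg:
  assumes "enabled \<tau> x"
  shows "0 \<le> rate \<tau> x"
proof -
  obtain y n where x: "x = (y, n)" by (cases x)
  show ?thesis
  proof (cases \<tau>)
    case (Unmark_move j l)
    then show ?thesis
      using assms theta_pos[where y=y and j=j and k=l and n=n] by (simp add: x less_imp_le)
  next
    case (Mark_move k j)
    then show ?thesis
      using assms theta_pos[where y=y and j=j and k=k and n=n] by (simp add: x gam_nonneg less_imp_le)
  qed (use assms in \<open>auto simp: x lam_nonneg gam_nonneg gam_bar_nonneg less_imp_le[OF mu_pos]
        less_imp_le[OF xi_pos] less_imp_le[OF eta_pos] intro!: mult_nonneg_nonneg
        less_imp_le[OF beta_pos] less_imp_le[OF eps_pos] less_imp_le[OF tau_pos]\<close>)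
qed

lemma net_nonneg: "0 \<le> net x z"
  unfolding net_eq_sum by (intro sum_nonneg) (auto intro: rate_nonneg)

lemma net_diag: "net x x = 0"
  unfolding net_eq_sum by (intro sum.neutral ballI if_not_P) (use target_neq in blast)

lemma net_ge_rate: "enabled \<tau> x \<Longrightarrow> rate \<tau> x \<le> net x (target \<tau> x)"
  unfolding net_eq_sum
  using member_le_sum[of \<tau> UNIV "\<lambda>\<tau>'. if enabled \<tau>' x \<and> target \<tau> x = target \<tau>' x then rate \<tau>' x else 0"]
  by (auto simp: rate_nonneg)

lemma targets_net: "{z. net x z \<noteq> 0} \<subseteq> range (\<lambda>\<tau>. target \<tau> x)"
proof
  fix z assume "z \<in> {z. net x z \<noteq> 0}"
  then have "(\<Sum>\<tau>\<in>UNIV. if enabled \<tau> x \<and> z = target \<tau> x then rate \<tau> x else 0) \<noteq> 0"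
    by (simp add: net_eq_sum)
  then obtain \<tau> where "(if enabled \<tau> x \<and> z = target \<tau> x then rate \<tau> x else 0) \<noteq> 0"
    by (rule sum.not_neutral_contains_not_neutral)
  then show "z \<in> range (\<lambda>\<tau>. target \<tau> x)" by (auto split: if_splits)
qed

lemma finite_targets_net: "finite {z. net x z \<noteq> 0}"
  using targets_net by (rule finite_subset) simp

lemma sum_net:
  "(\<Sum>z | net x z \<noteq> 0. net x z * f z) = (\<Sum>\<tau>\<in>UNIV. if enabled \<tau> x then rate \<tau> x * f (target \<tau> x) else 0)"
proof -
  let ?Z = "range (\<lambda>\<tau>. target \<tau> x)"
  have "(\<Sum>z | net x z \<noteq> 0. net x z * f z) = (\<Sum>z\<in>?Z. net x z * f z)"
    using targets_net by (intro sum.mono_neutral_left) auto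
  also have "\<dots> = (\<Sum>\<tau>\<in>UNIV. \<Sum>z\<in>?Z. if z = target \<tau> x then (if enabled \<tau> x then rate \<tau> x * f z else 0) else 0)"
    unfolding net_eq_sum sum_distrib_right by (subst sum.swap) (auto intro!: sum.cong)
  also have "\<dots> = (\<Sum>\<tau>\<in>UNIV. if enabled \<tau> x then rate \<tau> x * f (target \<tau> x) else 0)"
    by (intro sum.cong) (auto simp: sum.delta')
  finally show ?thesis .
qed

subsection \<open>Detailed balance\<close>

definition site_weight :: "'s \<Rightarrow> nat \<Rightarrow> 's config \<Rightarrow> real" where
  "site_weight q k y = lam_bar lam q k y / mu_bar mu q k y * (xi q / eta q * gam_bar gam q k) ^ y q"

definition W :: "'s state \<Rightarrow> real" where
  "W x = (\<Prod>q\<in>UNIV. site_weight q (snd x q) (fst x))"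

lemma mu_bar_pos: "0 < mu_bar mu q k y"
  unfolding mu_bar_def by (intro prod_pos) (auto intro: mu_pos)

lemma lam_bar_nonneg: "0 \<le> lam_bar lam q k y"
  unfolding lam_bar_def by (intro prod_nonneg) (simp add: lam_nonneg)

lemma ratio_pos: "0 < xi q / eta q"
  by (simp add: xi_pos eta_pos)

lemma site_weight_nonneg: "0 \<le> site_weight q k y"
  unfolding site_weight_def
  by (intro mult_nonneg_nonneg divide_nonneg_pos zero_le_power lam_bar_nonneg mu_bar_pos gam_bar_nonneg
      less_imp_le[OF ratio_pos])

lemma W_nonneg: "0 \<le> W x"
  unfolding W_def by (intro prod_nonneg) (simp add: site_weight_nonneg)

lemma W_eq:
  "W (y, n) = (\<Prod>p\<in>UNIV. lam_bar lam p (n p) y / mu_bar mu p (n p) y) *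
     (\<Prod>q\<in>UNIV. (xi q / eta q * gam_bar gam q (n q)) ^ y q)"
  unfolding W_def site_weight_def fst_conv snd_conv by (rule prod.distrib)

lemma site_weight_Suc:
  "site_weight q (Suc k) y = site_weight q k y * (lam q k y / mu q (Suc k) y * gam q k ^ y q)"
  by (simp add: site_weight_def lam_bar_def mu_bar_def gam_bar_def power_mult_distrib power_divide mult_ac)

lemma prod_split1: "(\<Prod>q\<in>UNIV. g q) = g p * (\<Prod>q\<in>UNIV - {p::'s}. g q :: real)"
  by (rule prod.remove) auto

lemma prod_split2:
  "i \<noteq> k \<Longrightarrow> (\<Prod>q\<in>UNIV. g q) = g i * g k * (\<Prod>q\<in>UNIV - {i} - {k::'s}. g q :: real)"
  by (subst prod_split1[of g i], subst prod.remove[of _ k]) auto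

lemma W_add_at: "W (y, add_at p n) = W (y, n) * (lam p (n p) y / mu p (n p + 1) y * gam p (n p) ^ y p)"
  unfolding W_def by (subst (1 2) prod_split1[of _ p]) (simp add: add_at_def site_weight_Suc)

lemma W_move:
  assumes "i \<noteq> k" "1 \<le> n i"
    and "lam i (n i - 1) y * gam i (n i - 1) ^ y i / mu i (n i) y * c =
         lam k (n k) y * gam k (n k) ^ y k / mu k (n k + 1) y * d"
  shows "W (y, n) * c = W (y, move i k n) * d"
proof -
  define a where "a = n i - 1"
  have a: "n i = Suc a" using assms(2) by (simp add: a_def)
  let ?rest = "\<Prod>q\<in>UNIV - {i} - {k}. site_weight q (n q) y"
  have "W (y, n) = site_weight i (Suc a) y * site_weight k (n k) y * ?rest"
    unfolding W_def using assms(1) a by (subst prod_split2[of i k]) auto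
  moreover have "W (y, move i k n) = site_weight i a y * site_weight k (Suc (n k)) y * ?rest"
    unfolding W_def using assms(1) a by (subst prod_split2[of i k]) (auto simp: move_def intro!: prod.cong)
  moreover have "lam i a y / mu i (Suc a) y * gam i a ^ y i * c = lam k (n k) y / mu k (Suc (n k)) y * gam k (n k) ^ y k * d"
    using assms(3) by (simp add: a)
  moreover have "(A * (l * g) * B * C) * c = (A * B * C) * (l * g * c)"
    "(A * (B * (l * g)) * C) * d = (A * B * C) * (l * g * d)" for A B C l g :: real
    by (simp_all only: mult_ac)
  ultimately show ?thesis
    unfolding site_weight_Suc by (simp only:)
qed

lemma W_customer_in: "W (add_at p y, n) = W (y, n) * (xi p / eta p * gam_bar gam p (n p))"
proof -
  have "(\<Prod>q\<in>UNIV. (xi q / eta q * gam_bar gam q (n q)) ^ add_at p y q) =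
    (\<Prod>q\<in>UNIV. (xi q / eta q * gam_bar gam q (n q)) ^ y q) * (xi p / eta p * gam_bar gam p (n p))"
    by (subst (1 2) prod_split1[of _ p]) (simp add: add_at_def)
  then show ?thesis
    unfolding W_eq using indep[of n "add_at p y" y] by simp
qed

lemma W_customer_move:
  assumes "1 \<le> y j" "j' \<noteq> j"
  shows "W (y, n) * rate (Customer_move j j') (y, n) =
         W (move j j' y, n) * rate (Customer_move j' j) (move j j' y, n)"
proof -
  define c where "c = y j - 1"
  have c: "y j = Suc c" using assms(1) by (simp add: c_def)
  let ?r = "\<lambda>q. xi q / eta q" and ?g = "\<lambda>q. gam_bar gam q (n q)"
  let ?a = "\<Prod>p\<in>UNIV. lam_bar lam p (n p) y / mu_bar mu p (n p) y"
  let ?rest = "\<Prod>q\<in>UNIV - {j} - {j'}. (?r q * ?g q) ^ y q"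
  have g: "?g j > 0" "?g j' > 0" using gam_bar_pos[where y=y and n=n and j=j and j'=j', OF assms] by auto
  have W1: "W (y, n) = ?a * ((?r j * ?g j) ^ Suc c * (?r j' * ?g j') ^ y j' * ?rest)"
    unfolding W_eq using assms(2) c by (subst prod_split2[of j j']) auto
  have "(\<Prod>q\<in>UNIV. (?r q * ?g q) ^ move j j' y q) = (?r j * ?g j) ^ c * (?r j' * ?g j') ^ Suc (y j') * ?rest"
    using assms(2) c by (subst prod_split2[of j j']) (auto simp: move_def intro!: prod.cong)
  then have W2: "W (move j j' y, n) = ?a * ((?r j * ?g j) ^ c * (?r j' * ?g j') ^ Suc (y j') * ?rest)"
    unfolding W_eq using indep[of n "move j j' y" y] by simp
  have "W (y, n) * rate (Customer_move j j') (y, n) =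
    ?a * ?rest * (?r j) ^ c * (?r j') ^ y j' * (tau j j' n y * ?r j)"
    unfolding W1 using g c by (simp add: power_mult_distrib field_simps)
  also have "tau j j' n y * ?r j = tau j' j n (move j j' y) * ?r j'"
    using assms by (rule tau_balance)
  also have "?a * ?rest * (?r j) ^ c * (?r j') ^ y j' * (tau j' j n (move j j' y) * ?r j') =
    W (move j j' y, n) * rate (Customer_move j' j) (move j j' y, n)"
    unfolding W2 using g c assms(2) by (simp add: move_def power_mult_distrib field_simps)
  finally show ?thesis .
qed

lemma W_balance_rate:
  assumes "enabled \<tau> x"
  shows "W x * rate \<tau> x = W (target \<tau> x) * rate (opposite \<tau>) (target \<tau> x)"
proof -
  have arr: "W (y, n) * rate (Arrival p) (y, n) = W (y, add_at p n) * rate (Departure p) (y, add_at p n)" for p y n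
    using mu_pos[of "n p + 1" p y] by (simp add: W_add_at)
  have inn: "W (y, n) * rate (Customer_in p) (y, n) = W (add_at p y, n) * rate (Customer_out p) (add_at p y, n)" for p y n
    using eta_pos[of p] by (simp add: W_customer_in)
  have unmark: "W (y, n) * rate (Unmark_move j l) (y, n) = W (y, move j l n) * rate (Mark_move l j) (y, move j l n)"
    if "1 \<le> y j" "y l = 0" "1 \<le> n j" for j l y n
  proof -
    have "j \<noteq> l" using that by auto
    moreover have "rate (Mark_move l j) (y, move j l n) = theta l j (n l + 1) (n j - 1) y * gam j (n j - 1) ^ y j"
      using \<open>j \<noteq> l\<close> by (simp add: move_def)
    ultimately show ?thesis
      using arg_cong[OF theta_balance[of y j l n, OF that], of "\<lambda>c. c * gam j (n j - 1) ^ y j"] that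
      by (intro W_move) (simp_all add: mult_ac)
  qed
  obtain y n where x: "x = (y, n)" by (cases x)
  show ?thesis
  proof (cases \<tau>)
    case (Arrival p)
    then show ?thesis using arr x by simp
  next
    case (Departure p)
    then show ?thesis using arr[of y "remove_at p n" p] target_opposite[OF assms] x assms by (simp add: remove_at_same)
  next
    case (Free_move k l)
    then have *: "k \<noteq> l" "y k = 0" "y l = 0" "1 \<le> n k" using assms x by auto
    then have "rate (Free_move l k) (y, move k l n) = beta l k (n l + 1) (n k - 1) y" by (simp add: move_def)
    then show ?thesis
      using beta_balance[of k l y n, OF *] * Free_move x by (auto intro!: W_move)
  next
    case (Marked_move i j)
    then have *: "i \<noteq> j" "1 \<le> y i" "1 \<le> y j" "1 \<le> n i" using assms x by auto
    then have "rate (Marked_move j i) (y, move i j n) = eps j i (n j + 1) (n i - 1) y" by (simp add: move_def)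
    then show ?thesis
      using eps_balance[of i j y n, OF *] * Marked_move x by (auto intro!: W_move)
  next
    case (Unmark_move j l)
    then show ?thesis using assms x unmark by simp
  next
    case (Mark_move k j)
    have "1 \<le> move k j n j" "move j k (move k j n) = n"
      using assms x Mark_move target_opposite[OF assms] by (auto simp: move_def)
    then show ?thesis using assms x Mark_move unmark[of y j k "move k j n"] by simp
  next
    case (Customer_move j j')
    then show ?thesis using assms x W_customer_move[of y j j' n] by simp
  next
    case (Customer_in p)
    then show ?thesis using inn x by simp
  next
    case (Customer_out p)
    then show ?thesis using inn[of "remove_at p y" n p] target_opposite[OF assms] x by simp
  qed
qed

lemma W_balance: "W x * net x z = W z * net z x"
proof -
  have "W x * net x z = (\<Sum>\<tau>\<in>UNIV. if enabled \<tau> x \<and> z = target \<tau> x then W x * rate \<tau> x else 0)"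
    unfolding net_eq_sum sum_distrib_left by (auto intro!: sum.cong)
  also have "\<dots> = (\<Sum>\<tau>\<in>UNIV. if enabled \<tau> z \<and> x = target \<tau> z then W z * rate \<tau> z else 0)"
  proof (rule sum.reindex_bij_witness[where i=opposite and j=opposite])
    fix \<tau> :: "'s transition"
    have "enabled \<tau> x \<and> z = target \<tau> x \<longleftrightarrow> enabled (opposite \<tau>) z \<and> x = target (opposite \<tau>) z"
      using target_opposite[of \<tau> x] target_opposite[of "opposite \<tau>" z] by auto
    then show "(if enabled (opposite \<tau>) z \<and> x = target (opposite \<tau>) z then W z * rate (opposite \<tau>) z else 0) =
      (if enabled \<tau> x \<and> z = target \<tau> x then W x * rate \<tau> x else 0)"
      using W_balance_rate[of \<tau> x] by auto
  qed auto
  also have "\<dots> = W z * net z x"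
    unfolding net_eq_sum sum_distrib_left by (auto intro!: sum.cong)
  finally show ?thesis .
qed

end

subsection \<open>The equilibrium distribution\<close>

lemma infsum_eq_nn_integral:
  fixes f :: "'a::countable \<Rightarrow> ennreal"
  shows "(\<Sum>\<^sub>\<infinity>y\<in>UNIV. f y) = (\<integral>\<^sup>+y. f y \<partial>count_space UNIV)"
proof (rule antisym)
  have S: "(\<Sum>\<^sub>\<infinity>y\<in>UNIV. f y) = (SUP F\<in>{F. finite F \<and> F \<subseteq> UNIV}. sum f F)"
    by (rule nonneg_infsum_complete) simp
  show "(\<Sum>\<^sub>\<infinity>y\<in>UNIV. f y) \<le> (\<integral>\<^sup>+y. f y \<partial>count_space UNIV)"
    unfolding S
  proof (rule SUP_least)
    fix F :: "'a set" assume "F \<in> {F. finite F \<and> F \<subseteq> UNIV}"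
    then have "sum f F = (\<integral>\<^sup>+y. f y * indicator F y \<partial>count_space UNIV)"
      by (subst nn_integral_count_space'[where A=F]) auto
    also have "\<dots> \<le> (\<integral>\<^sup>+y. f y \<partial>count_space UNIV)"
      by (intro nn_integral_mono) (simp add: indicator_def)
    finally show "sum f F \<le> (\<integral>\<^sup>+y. f y \<partial>count_space UNIV)" .
  qed
  have "(\<integral>\<^sup>+y. f y \<partial>count_space UNIV) = (\<integral>\<^sup>+i. f (from_nat i) \<partial>count_space (range (to_nat :: 'a \<Rightarrow> nat)))"
    by (rule nn_integral_bij_count_space[symmetric]) (rule bij_betw_byWitness[where f'=to_nat], auto)
  also have "\<dots> = (\<integral>\<^sup>+i. f (from_nat i) * indicator (range (to_nat :: 'a \<Rightarrow> nat)) i \<partial>count_space UNIV)"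
    by (simp add: nn_integral_count_space_indicator)
  also have "\<dots> = (SUP n. \<Sum>i<n. f (from_nat i) * indicator (range (to_nat :: 'a \<Rightarrow> nat)) i)"
    by (simp add: nn_integral_count_space_nat suminf_eq_SUP)
  also have "\<dots> \<le> (\<Sum>\<^sub>\<infinity>y\<in>UNIV. f y)"
  proof (rule SUP_least)
    fix n
    let ?F = "{y :: 'a. to_nat y < n}"
    have fin: "finite ?F"
      using finite_imageD[of to_nat ?F] by (auto intro: finite_subset[of _ "{..<n}"] inj_on_subset[OF inj_to_nat])
    have "(\<Sum>i<n. f (from_nat i) * indicator (range (to_nat :: 'a \<Rightarrow> nat)) i) = (\<Sum>i\<in>to_nat ` ?F. f (from_nat i))"
      by (rule sum.mono_neutral_cong_right) (auto simp: indicator_def)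
    also have "\<dots> = sum f ?F"
      by (subst sum.reindex) (auto intro: inj_on_subset[OF inj_to_nat])
    also have "\<dots> \<le> (\<Sum>\<^sub>\<infinity>y\<in>UNIV. f y)"
      unfolding S using fin by (intro SUP_upper) auto
    finally show "(\<Sum>i<n. f (from_nat i) * indicator (range (to_nat :: 'a \<Rightarrow> nat)) i) \<le> (\<Sum>\<^sub>\<infinity>y\<in>UNIV. f y)" .
  qed
  finally show "(\<integral>\<^sup>+y. f y \<partial>count_space UNIV) \<le> (\<Sum>\<^sub>\<infinity>y\<in>UNIV. f y)" .
qed

lemma prod_suminf_eq_nn_integral:
  fixes f :: "'s::finite \<Rightarrow> nat \<Rightarrow> ennreal"
  shows "(\<Prod>q\<in>UNIV. \<Sum>k. f q k) = (\<integral>\<^sup>+n. (\<Prod>q\<in>UNIV. f q (n q)) \<partial>count_space UNIV)"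
proof -
  interpret product_sigma_finite "\<lambda>_::'s. count_space (UNIV :: nat set)"
    unfolding product_sigma_finite_def by (intro allI sigma_finite_measure_count_space)
  have "(\<Pi>\<^sub>M q\<in>(UNIV::'s set). count_space (UNIV :: nat set)) = count_space UNIV"
    by (subst count_space_PiM_finite) auto
  then have "(\<integral>\<^sup>+n. (\<Prod>q\<in>UNIV. f q (n q)) \<partial>count_space UNIV) =
    (\<Prod>q\<in>UNIV. \<integral>\<^sup>+k. f q k \<partial>count_space UNIV)"
    using product_nn_integral_prod[of "UNIV :: 's set" f] by simp
  then show ?thesis by (simp add: nn_integral_count_space_nat)
qed

context network
begin

lemma Xi_eq: "Xi_sum lam mu gam xi eta = (\<integral>\<^sup>+x. ennreal (W x) \<partial>count_space UNIV)"
proof -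
  have "(\<Prod>r | y r \<ge> 1. ennreal ((xi r / eta r) ^ y r) * C_sum lam mu gam r y) * (\<Prod>l | y l = 0. U_sum lam mu l y) =
    (\<integral>\<^sup>+n. ennreal (W (y, n)) \<partial>count_space UNIV)" for y
  proof -
    let ?c = "\<lambda>q. \<Sum>k. ennreal (site_weight q k y)"
    have c: "?c q = ennreal ((xi q / eta q) ^ y q) * C_sum lam mu gam q y" for q
    proof -
      have "ennreal (site_weight q k y) = ennreal ((xi q / eta q) ^ y q) *
        ennreal (lam_bar lam q k y / mu_bar mu q k y * gam_bar gam q k ^ y q)" for k
        using xi_pos[of q] eta_pos[of q]
        by (subst ennreal_mult'[symmetric]) (auto simp: site_weight_def power_mult_distrib power_divide mult_ac)
      then show ?thesis by (simp add: C_sum_def)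
    qed
    have c0: "?c q = U_sum lam mu q y" if "y q = 0" for q
      using that by (simp add: site_weight_def U_sum_def)
    have "(\<Prod>q\<in>UNIV. ?c q) = (\<Prod>q\<in>{r. y r \<ge> 1} \<union> {l. y l = 0}. ?c q)"
      by (intro prod.cong) auto
    also have "\<dots> = (\<Prod>r | y r \<ge> 1. ?c r) * (\<Prod>l | y l = 0. ?c l)"
      by (rule prod.union_disjoint) auto
    also have "(\<Prod>l | y l = 0. ?c l) = (\<Prod>l | y l = 0. U_sum lam mu l y)"
      by (intro prod.cong) (auto simp: c0)
    also have "(\<Prod>r | y r \<ge> 1. ?c r) = (\<Prod>r | y r \<ge> 1. ennreal ((xi r / eta r) ^ y r) * C_sum lam mu gam r y)"
      by (intro prod.cong refl c)
    finally have "(\<Prod>r | y r \<ge> 1. ennreal ((xi r / eta r) ^ y r) * C_sum lam mu gam r y) * (\<Prod>l | y l = 0. U_sum lam mu l y)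
      = (\<Prod>q\<in>UNIV. ?c q)" ..
    also have "\<dots> = (\<integral>\<^sup>+n. (\<Prod>q\<in>UNIV. ennreal (site_weight q (n q) y)) \<partial>count_space UNIV)"
      by (rule prod_suminf_eq_nn_integral)
    finally show ?thesis by (simp add: W_def prod_ennreal site_weight_nonneg)
  qed
  then have "Xi_sum lam mu gam xi eta = (\<integral>\<^sup>+y. \<integral>\<^sup>+n. ennreal (W (y, n)) \<partial>count_space UNIV \<partial>count_space UNIV)"
    by (simp add: Xi_sum_def infsum_eq_nn_integral)
  also have "\<dots> = (\<integral>\<^sup>+x. ennreal (W x) \<partial>count_space UNIV)"
    by (rule nn_integral_fst_count_space)
  finally show ?thesis .
qed

abbreviation "\<Xi> \<equiv> enn2real (Xi_sum lam mu gam xi eta)"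

lemma W_le_\<Xi>: "W x \<le> \<Xi>"
proof -
  have "ennreal (W x) = (\<integral>\<^sup>+y. ennreal (W y) * indicator {x} y \<partial>count_space UNIV)"
    by (simp add: nn_integral_indicator_singleton')
  also have "\<dots> \<le> (\<integral>\<^sup>+y. ennreal (W y) \<partial>count_space UNIV)"
    by (intro nn_integral_mono) (simp add: indicator_def)
  finally have "ennreal (W x) \<le> ennreal \<Xi>"
    using Xi_finite by (simp add: Xi_eq less_top)
  then show ?thesis by (simp add: ennreal_le_iff)
qed

lemma W_empty: "W (\<lambda>_. 0, \<lambda>_. 0) = 1"
  by (simp add: W_def site_weight_def lam_bar_def mu_bar_def)

lemma \<Xi>_pos: "0 < \<Xi>"
  using W_le_\<Xi>[of "(\<lambda>_. 0, \<lambda>_. 0)"] W_empty by simp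

definition equilibrium :: "'s state pmf" where
  "equilibrium = embed_pmf (\<lambda>x. W x / \<Xi>)"

lemma pmf_equilibrium: "pmf equilibrium x = W x / \<Xi>"
  unfolding equilibrium_def
proof (rule pmf_embed_pmf)
  show "0 \<le> W x / \<Xi>" for x using W_nonneg \<Xi>_pos by simp
  have "(\<integral>\<^sup>+x. ennreal (W x / \<Xi>) \<partial>count_space UNIV) = (\<integral>\<^sup>+x. ennreal (W x) * ennreal (1 / \<Xi>) \<partial>count_space UNIV)"
    using \<Xi>_pos by (intro nn_integral_cong) (simp add: W_nonneg flip: ennreal_mult)
  also have "\<dots> = Xi_sum lam mu gam xi eta * ennreal (1 / \<Xi>)"
    by (simp add: nn_integral_multc Xi_eq)
  also have "\<dots> = ennreal \<Xi> * ennreal (1 / \<Xi>)"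
    using Xi_finite by (simp add: less_top)
  also have "\<dots> = 1" using \<Xi>_pos by (simp flip: ennreal_mult)
  finally show "(\<integral>\<^sup>+x. ennreal (W x / \<Xi>) \<partial>count_space UNIV) = 1" .
qed

lemma set_equilibrium: "x \<in> set_pmf equilibrium \<longleftrightarrow> 0 < W x"
  using \<Xi>_pos W_nonneg[of x] by (auto simp: set_pmf_iff pmf_equilibrium less_le)

lemma W_no_customers: "W (\<lambda>_. 0, n) = (\<Prod>p\<in>UNIV. lam_bar lam p (n p) y / mu_bar mu p (n p) y)"
  unfolding W_eq using indep[of n "\<lambda>_. 0" y] by simp

lemma W_factor: "W (y, n) = W (\<lambda>_. 0, n) * (\<Prod>q\<in>UNIV. (xi q / eta q * gam_bar gam q (n q)) ^ y q)"
  unfolding W_eq[of y n] W_no_customers[of n y] ..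

text \<open>For fixed \<open>n\<close>, the customers at the single site \<open>q\<close> contribute a geometric series to \<open>\<Xi>\<close>.\<close>

lemma gam_bar_le:
  assumes "0 < W (\<lambda>_. 0, n)"
  shows "xi q / eta q * gam_bar gam q (n q) \<le> 1"
proof (rule ccontr)
  let ?r = "xi q / eta q * gam_bar gam q (n q)"
  assume "\<not> ?r \<le> 1"
  then obtain k where k: "\<Xi> / W (\<lambda>_. 0, n) < ?r ^ k"
    using real_arch_pow[of ?r] by auto
  have "(\<Prod>p\<in>UNIV. (xi p / eta p * gam_bar gam p (n p)) ^ (if p = q then k else 0)) = ?r ^ k"
    by (subst prod_split1[of _ q]) (auto intro!: prod.neutral)
  then have "W (\<lambda>_. 0, n) * ?r ^ k \<le> \<Xi>"
    using W_le_\<Xi>[of "(\<lambda>p. if p = q then k else 0, n)"] by (simp add: W_factor[of "\<lambda>p. if p = q then k else 0"])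
  then show False using k assms by (simp add: field_simps)
qed

lemma customer_factor_le:
  assumes "0 < W (\<lambda>_. 0, n)"
  shows "(\<Prod>q\<in>UNIV. (xi q / eta q * gam_bar gam q (n q)) ^ y q) \<le> 1"
proof (rule prod_le_1)
  fix q
  have "0 \<le> xi q / eta q * gam_bar gam q (n q)"
    by (rule mult_nonneg_nonneg[OF less_imp_le[OF ratio_pos] gam_bar_nonneg])
  then show "0 \<le> (xi q / eta q * gam_bar gam q (n q)) ^ y q \<and> (xi q / eta q * gam_bar gam q (n q)) ^ y q \<le> 1"
    using gam_bar_le[OF assms, of q] by (metis power_le_one zero_le_power)
qed

lemma W_customer_in_le: "W (y, n) * rate (Customer_in p) (y, n) \<le> eta p * W (y, n)"
proof (cases "W (y, n) = 0")
  case False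
  then have "W (\<lambda>_. 0, n) \<noteq> 0" by (auto simp: W_factor[of y])
  then have "xi p / eta p * gam_bar gam p (n p) \<le> 1"
    using W_nonneg[of "(\<lambda>_. 0, n)"] by (intro gam_bar_le) simp
  then have "rate (Customer_in p) (y, n) \<le> eta p"
    using eta_pos[of p] by (simp add: field_simps)
  then have "W (y, n) * rate (Customer_in p) (y, n) \<le> W (y, n) * eta p"
    by (rule mult_left_mono) (rule W_nonneg)
  then show ?thesis by (simp add: mult.commute)
qed simp

lemma W_arrival_le:
  assumes L: "\<And>i k y. lam i k y \<le> L"
  shows "W (y, n) * rate (Arrival p) (y, n) \<le> L * W (\<lambda>_. 0, n)"
proof (cases "W (y, n) * rate (Arrival p) (y, n) = 0")
  case True
  have "0 \<le> L" using L[of p 0 y] lam_nonneg[of p 0 y] by linarith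
  then show ?thesis unfolding True by (simp add: W_nonneg)
next
  case False
  let ?n = "add_at p n"
  have "W (y, ?n) \<noteq> 0"
    unfolding W_add_at using False mu_pos[of "n p + 1" p y] by simp
  then have "W (\<lambda>_. 0, ?n) \<noteq> 0" by (auto simp: W_factor[of y])
  then have pos: "0 < W (\<lambda>_. 0, ?n)" using W_nonneg[of "(\<lambda>_. 0, ?n)"] by simp
  have "(\<Prod>q\<in>UNIV. (xi q / eta q * gam_bar gam q (n q)) ^ y q) * gam p (n p) ^ y p =
    (\<Prod>q\<in>UNIV. (xi q / eta q * gam_bar gam q (?n q)) ^ y q)"
    by (subst (1 2) prod_split1[of _ p]) (simp add: add_at_def gam_bar_def power_mult_distrib power_divide mult.assoc)
  also have "\<dots> \<le> 1" by (rule customer_factor_le[OF pos])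
  finally have le: "(\<Prod>q\<in>UNIV. (xi q / eta q * gam_bar gam q (n q)) ^ y q) * gam p (n p) ^ y p \<le> 1" .
  have "W (y, n) * rate (Arrival p) (y, n) = (W (\<lambda>_. 0, n) * lam p (n p) y) *
    ((\<Prod>q\<in>UNIV. (xi q / eta q * gam_bar gam q (n q)) ^ y q) * gam p (n p) ^ y p)"
    unfolding W_factor[of y n] by simp
  also have "\<dots> \<le> (W (\<lambda>_. 0, n) * lam p (n p) y) * 1"
    using le by (rule mult_left_mono) (simp add: W_nonneg lam_nonneg)
  also have "\<dots> \<le> L * W (\<lambda>_. 0, n)"
    using mult_left_mono[OF L[of p "n p" y] W_nonneg[of "(\<lambda>_. 0, n)"]] by (simp add: mult.commute)
  finally show ?thesis .
qed

end

context network
begin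

lemma net_step:
  assumes "enabled \<tau> x" "0 < rate \<tau> x"
  shows "accessible net x (target \<tau> x)"
  using assms target_neq[OF assms(1)] net_ge_rate[OF assms(1)] unfolding accessible_def
  by (intro r_into_rtrancl) auto

lemma accessible_empty: "accessible net x (\<lambda>_. 0, \<lambda>_. 0)"
proof (induction "total (fst x) + total (snd x)" arbitrary: x rule: less_induct)
  case less
  obtain y n where x: "x = (y, n)" by (cases x)
  have step: ?case
    if \<tau>: "enabled \<tau> x" "0 < rate \<tau> x"
      and "total (fst (target \<tau> x)) + total (snd (target \<tau> x)) < total (fst x) + total (snd x)" for \<tau>
    using net_step[OF \<tau>] less.hyps[OF that(3)] unfolding accessible_def by (rule rtrancl_trans)
  show ?case
  proof (cases "\<exists>p. 1 \<le> n p")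
    case True
    then obtain p where p: "1 \<le> n p" by blast
    show ?thesis
      using p mu_pos[OF p] total_remove_at[of n p] by (intro step[of "Departure p"]) (auto simp: x)
  next
    case n: False
    show ?thesis
    proof (cases "\<exists>p. 1 \<le> y p")
      case True
      then obtain p where p: "1 \<le> y p" by blast
      show ?thesis
        using p eta_pos[of p] total_remove_at[of y p] by (intro step[of "Customer_out p"]) (auto simp: x)
    next
      case False
      then have "x = (\<lambda>_. 0, \<lambda>_. 0)" using n by (auto simp: x fun_eq_iff not_le)
      then show ?thesis by (simp add: accessible_def)
    qed
  qed
qed

lemma net_not_absorbing: "\<exists>z. net x z \<noteq> 0"
proof -
  obtain y n where x: "x = (y, n)" by (cases x)
  have "\<exists>\<tau>. enabled \<tau> x \<and> 0 < rate \<tau> x"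
  proof (cases "\<exists>p. 1 \<le> n p")
    case True
    then obtain p where p: "1 \<le> n p" by blast
    then show ?thesis using mu_pos[OF p] by (intro exI[of _ "Departure p"]) (simp add: x)
  next
    case False
    then have "n p = 0" for p by (auto simp: not_le)
    then show ?thesis
      using xi_pos by (intro exI[of _ "Customer_in p" for p]) (simp add: x gam_bar_def)
  qed
  then obtain \<tau> where "enabled \<tau> x" "0 < rate \<tau> x" by blast
  then have "0 < net x (target \<tau> x)" using net_ge_rate[of \<tau> x] by linarith
  then show ?thesis by (intro exI[of _ "target \<tau> x"]) simp
qed

sublocale rates: reversible_rates net equilibrium
proof
  show "pmf equilibrium x * net x z = pmf equilibrium z * net z x" for x z
    using W_balance[of x z] by (simp add: pmf_equilibrium)
qed (fact net_nonneg net_diag finite_targets_net net_not_absorbing)+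

subsection \<open>Inessential states\<close>

lemma gam_zero_from:
  assumes "gam_bar gam i k = 0"
  shows "gam i k = 0"
proof -
  obtain j where j: "j < k" "gam i j = 0" using assms by (auto simp: gam_bar_def)
  have "gam i (j + l) = 0" for l
  proof (induction l)
    case (Suc l)
    then show ?case using gam_support[of i "j + l"] gam_nonneg[of i "Suc (j + l)"] by (force simp: less_le)
  qed (use j in simp)
  from this[of "k - j"] show ?thesis using j by simp
qed

lemma lam_zero_from:
  assumes "lam i j y = 0" "j \<le> k"
  shows "lam i k y = 0"
proof -
  have "lam i (j + l) y = 0" for l
  proof (induction l)
    case (Suc l)
    then show ?case using lam_support[of i "j + l" y] lam_nonneg[of i "Suc (j + l)" y] by (force simp: less_le)
  qed (use assms in simp)
  from this[of "k - j"] show ?thesis using assms by simp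
qed

lemma lam_bar_eq_0_iff: "lam_bar lam i k y = 0 \<longleftrightarrow> (\<exists>j<k. lam i j y = 0)"
  by (auto simp: lam_bar_def)

lemma lam_bar_eq_0_indep: "lam_bar lam p k y = 0 \<longleftrightarrow> lam_bar lam p k y' = 0"
proof -
  let ?n = "\<lambda>q. if q = p then k else 0"
  have "(\<Prod>q\<in>UNIV. lam_bar lam q (?n q) y / mu_bar mu q (?n q) y) = lam_bar lam p k y / mu_bar mu p k y" for y
    by (subst prod_split1[of _ p]) (auto simp: lam_bar_def mu_bar_def intro!: prod.neutral)
  then show ?thesis
    using indep[of ?n y y'] mu_bar_pos[of p k y] mu_bar_pos[of p k y'] by auto
qed

text \<open>Outside the support of \<open>equilibrium\<close> no new task arrives. With at least two sites, \<open>beta_balance\<close>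
  without customers shows that one vanishing \<open>lam\<close> forces \<open>lam\<close> to vanish identically.\<close>

lemma no_arrivals:
  assumes "W (y, n) = 0"
  shows "rate (Arrival p) (y, n) = 0"
proof -
  obtain q where "site_weight q (n q) y = 0" using assms by (auto simp: W_def)
  then consider "lam_bar lam q (n q) y = 0" | "gam_bar gam q (n q) = 0" "1 \<le> y q"
    using mu_bar_pos[of q "n q" y] xi_pos[of q] eta_pos[of q]
    by (fastforce simp: site_weight_def)
  then show ?thesis
  proof cases
    case 1
    show ?thesis
    proof (cases "p = q")
      case True
      then have "lam p (n p) y = 0" using 1 lam_zero_from[of q _ y "n q"] by (auto simp: lam_bar_eq_0_iff)
      then show ?thesis by simp
    next
      case False
      let ?y0 = "\<lambda>_. 0"
      obtain j where j: "lam q j ?y0 = 0"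
        using 1 lam_bar_eq_0_indep[of q "n q" y ?y0] by (auto simp: lam_bar_eq_0_iff)
      let ?n = "(\<lambda>_. 0)(p := 1, q := j)"
      have "lam p 0 ?y0 / mu p 1 ?y0 * beta p q 1 j ?y0 = 0"
        using beta_balance[of p q ?y0 ?n] False j by simp
      moreover have "0 < beta p q 1 j ?y0"
        using beta_pos[of p q ?y0 ?n] False by simp
      ultimately have "lam p 0 ?y0 = 0" using mu_pos[of 1 p ?y0] by auto
      then have "lam p 0 y = 0"
        using lam_bar_eq_0_indep[of p 1 y ?y0] by (simp add: lam_bar_def)
      then show ?thesis using lam_zero_from[of p 0 y "n p"] by simp
    qed
  next
    case 2
    have "p = q"
    proof (rule ccontr)
      assume "p \<noteq> q"
      then show False using gam_bar_pos[where y=y and n=n and j=q and j'=p] 2 by simp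
    qed
    then show ?thesis using 2 gam_zero_from[of q "n q"] by simp
  qed
qed

lemma W_no_tasks: "0 < W (y, \<lambda>_. 0)"
  unfolding W_def using xi_pos eta_pos
  by (intro prod_pos) (simp add: site_weight_def lam_bar_def mu_bar_def gam_bar_def)

abbreviation "inessential \<equiv> rates.never (set_pmf equilibrium)"

text \<open>Maximum principle on the finite set of states with \<open>N\<close> tasks and at most \<open>M\<close> customers:
  it is left only by a departure, at a rate of at least \<open>m\<close>, or by a new customer, at a rate of at
  most \<open>K\<close>.\<close>

lemma inessential_contract:
  assumes m: "0 < m" "\<And>i k y. 1 \<le> k \<Longrightarrow> m \<le> mu i k y"
    and K: "\<And>n. total n = N \<Longrightarrow> (\<Sum>p\<in>UNIV. xi p * gam_bar gam p (n p)) \<le> K"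
    and less: "\<And>y n. total n < N \<Longrightarrow> inessential (y, n) = 0"
    and B: "0 \<le> B" "\<And>y n. total n = N \<Longrightarrow> inessential (y, n) \<le> B"
    and N: "total n = N"
  shows "inessential (y, n) \<le> K / (m + K) * B"
proof -
  let ?h = inessential
  have K0: "0 \<le> K"
    using K[OF N] sum_nonneg[of UNIV "\<lambda>p. xi p * gam_bar gam p (n p)"]
    by (simp add: gam_bar_nonneg less_imp_le[OF xi_pos])
  let ?F = "{y' :: 's config. total y' \<le> total y} \<times> {n' :: 's config. total n' = N}"
  have "finite {n' :: 's config. total n' = N}"
    by (rule finite_subset[OF _ finite_total_le[of N]]) auto
  then have F: "finite ?F"
    by (rule finite_cartesian_product[OF finite_total_le])
  have "(y, n) \<in> ?F" using N by simp
  then have "Max (?h ` ?F) \<in> ?h ` ?F"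
    using F by (intro Max_in finite_imageI) blast+
  then obtain x where x: "x \<in> ?F" "Max (?h ` ?F) = ?h x" by blast
  have max: "?h z \<le> ?h x" if "z \<in> ?F" for z
    unfolding x(2)[symmetric] using that F by (intro Max_ge finite_imageI imageI)
  obtain y' n' where x': "x = (y', n')" "total y' \<le> total y" "total n' = N" using x(1) by auto
  have "?h x \<le> K / (m + K) * B"
  proof (cases "x \<in> set_pmf equilibrium")
    case True
    then have "?h x = 0" by (rule rates.never_in)
    then show ?thesis using K0 m(1) B(1) by simp
  next
    case False
    then have W: "W (y', n') = 0" using W_nonneg[of x] by (auto simp: set_equilibrium x' less_le)
    have hx: "0 \<le> ?h x" "?h x \<le> B"
      using rates.never_nonneg[of "set_pmf equilibrium" x] B(2)[OF x'(3), of y'] x'(1) by simp_all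
    let ?lo = "\<lambda>\<tau>. case \<tau> of Departure p \<Rightarrow> (if 1 \<le> n' p then m * ?h x else 0)
      | Customer_in p \<Rightarrow> xi p * gam_bar gam p (n' p) * (?h x - B) | _ \<Rightarrow> 0"
    have lo: "?lo \<tau> \<le> (if enabled \<tau> x then rate \<tau> x * (?h x - ?h (target \<tau> x)) else 0)" for \<tau>
    proof (cases "enabled \<tau> x")
      case False
      then show ?thesis by (cases \<tau>) (auto simp: x')
    next
      case en: True
      have inside: "0 \<le> rate \<tau> x * (?h x - ?h (target \<tau> x))" if "target \<tau> x \<in> ?F"
        using rate_nonneg[OF en] max[OF that] by simp
      show ?thesis
      proof (cases \<tau>)
        case (Arrival p)
        then have "rate \<tau> x = 0" unfolding x'(1) Arrival by (intro no_arrivals W)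
        then show ?thesis using Arrival by simp
      next
        case (Departure p)
        then have p: "1 \<le> n' p" using en by (simp add: x')
        then have "?h (target \<tau> x) = 0"
          using total_remove_at[of n' p] x' Departure by (simp add: less[of "remove_at p n'" y'])
        moreover have "m * ?h x \<le> mu p (n' p) y' * ?h x"
          using m(2)[OF p] hx(1) by (rule mult_right_mono)
        ultimately show ?thesis using Departure p by (simp add: x')
      next
        case (Customer_in p)
        then have "?h (target \<tau> x) \<le> B" using x' B(2)[of n' "add_at p y'"] by simp
        then have "xi p * gam_bar gam p (n' p) * (?h x - B) \<le> xi p * gam_bar gam p (n' p) * (?h x - ?h (target \<tau> x))"
          by (intro mult_left_mono) (simp_all add: gam_bar_nonneg less_imp_le[OF xi_pos])
        then show ?thesis using Customer_in by (simp add: x')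
      next
        case (Unmark_move j l)
        then have "j \<noteq> l" using en by (auto simp: x')
        then show ?thesis using en inside Unmark_move x' by (simp add: total_move)
      next
        case (Mark_move k j)
        then have "k \<noteq> j" using en by (auto simp: x')
        then show ?thesis using en inside Mark_move x' by (simp add: total_move)
      next
        case (Customer_move j j')
        then have "1 \<le> y' j" "j \<noteq> j'" using en by (auto simp: x')
        then show ?thesis using inside Customer_move x' by (simp add: total_move)
      next
        case (Customer_out p)
        then show ?thesis using en inside x' total_remove_at[of y' p] by simp
      qed (use en inside x' in \<open>simp_all add: total_move\<close>)
    qed
    have "(\<Sum>\<tau>\<in>UNIV. ?lo \<tau>) \<le> (\<Sum>\<tau>\<in>UNIV. if enabled \<tau> x then rate \<tau> x * (?h x - ?h (target \<tau> x)) else 0)"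
      by (intro sum_mono lo)
    also have "\<dots> = 0"
      using rates.never_harmonic[OF False] unfolding sum_net .
    finally have "(\<Sum>p\<in>UNIV. if 1 \<le> n' p then m * ?h x else 0) +
        (\<Sum>p\<in>UNIV. xi p * gam_bar gam p (n' p)) * (?h x - B) \<le> 0"
      by (simp add: sum_transition sum_distrib_right)
    moreover have "m * ?h x \<le> (\<Sum>p\<in>UNIV. if 1 \<le> n' p then m * ?h x else 0)"
    proof -
      have "\<exists>p. 1 \<le> n' p"
      proof (rule ccontr)
        assume "\<nexists>p. 1 \<le> n' p"
        then have "n' = (\<lambda>_. 0)" by (auto simp: fun_eq_iff not_le)
        then show False using W W_no_tasks[of y'] by simp
      qed
      then obtain p where p: "1 \<le> n' p" by blast
      have "0 \<le> m * ?h x" using m(1) hx(1) by simp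
      then show ?thesis
        using member_le_sum[of p UNIV "\<lambda>p. if 1 \<le> n' p then m * ?h x else 0"] p by simp
    qed
    moreover have "K * (?h x - B) \<le> (\<Sum>p\<in>UNIV. xi p * gam_bar gam p (n' p)) * (?h x - B)"
      using K[OF x'(3)] hx(2) by (intro mult_right_mono_neg) auto
    ultimately have "m * ?h x + K * (?h x - B) \<le> 0" by linarith
    then have "?h x * (m + K) \<le> K * B" by (simp add: algebra_simps)
    then show ?thesis using m(1) K0 by (simp add: pos_le_divide_eq)
  qed
  then show ?thesis using max[of "(y, n)"] N by simp
qed

lemma inessential_eq_0: "inessential (y, n) = 0"
proof (induction "total n" arbitrary: y n rule: less_induct)
  case less
  let ?N = "total n"
  obtain m where m: "0 < m" "\<And>i k y. 1 \<le> k \<Longrightarrow> m \<le> mu i k y"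
    using mu_bounded_below by blast
  define K where "K = (\<Sum>p\<in>UNIV. \<Sum>k\<le>?N. xi p * gam_bar gam p k)"
  have K0: "0 \<le> K"
    unfolding K_def by (intro sum_nonneg mult_nonneg_nonneg gam_bar_nonneg less_imp_le[OF xi_pos])
  have K: "(\<Sum>p\<in>UNIV. xi p * gam_bar gam p (n' p)) \<le> K" if "total n' = ?N" for n' :: "'s config"
    unfolding K_def
  proof (rule sum_mono)
    fix p
    have "n' p \<le> ?N" using that member_le_sum[of p UNIV n'] by (simp add: total_def)
    then show "xi p * gam_bar gam p (n' p) \<le> (\<Sum>k\<le>?N. xi p * gam_bar gam p k)"
      by (intro member_le_sum) (auto intro!: mult_nonneg_nonneg gam_bar_nonneg less_imp_le[OF xi_pos])
  qed
  let ?c = "K / (m + K)"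
  have c: "0 \<le> ?c" "?c < 1" using m K0 by auto
  have "\<forall>y' (n' :: 's config). total n' = ?N \<longrightarrow> inessential (y', n') \<le> ?c ^ j" for j
  proof (induction j)
    case 0
    show ?case by (simp add: rates.never_le_1)
  next
    case (Suc j)
    show ?case
    proof (intro allI impI)
      fix y' n' :: "'s config" assume "total n' = ?N"
      then have "inessential (y', n') \<le> ?c * ?c ^ j"
        using Suc c less.hyps by (intro inessential_contract[OF m K]) auto
      then show "inessential (y', n') \<le> ?c ^ Suc j" by simp
    qed
  qed
  then have "inessential (y, n) \<le> ?c ^ j" for j by simp
  moreover have "(\<lambda>j. ?c ^ j) \<longlonglongrightarrow> 0" using c by (intro LIMSEQ_realpow_zero) auto
  ultimately have "inessential (y, n) \<le> 0" by (intro LIMSEQ_le_const) auto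
  then show ?case using rates.never_nonneg[of "set_pmf equilibrium" "(y, n)"] by linarith
qed

subsection \<open>Finite boxes with small boundary\<close>

lemma measure_level_tendsto_0:
  fixes s :: "'b \<Rightarrow> nat"
  shows "(\<lambda>N. measure (measure_pmf \<mu>) {x. s x = N}) \<longlonglongrightarrow> 0"
proof (rule tendsto_sandwich[OF _ _ tendsto_const])
  have "(\<lambda>N. measure (measure_pmf \<mu>) {x. N \<le> s x}) \<longlonglongrightarrow> measure (measure_pmf \<mu>) (\<Inter>N. {x. N \<le> s x})"
    by (intro measure_pmf.finite_Lim_measure_decseq) (auto simp: decseq_def)
  also have "(\<Inter>N. {x. N \<le> s x}) = {}"
  proof (intro equals0I)
    fix x assume "x \<in> (\<Inter>N. {x. N \<le> s x})"
    then have "Suc (s x) \<le> s x" by blast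
    then show False by simp
  qed
  finally show "(\<lambda>N. measure (measure_pmf \<mu>) {x. N \<le> s x}) \<longlonglongrightarrow> 0" by simp
  show "\<forall>\<^sub>F N in sequentially. measure (measure_pmf \<mu>) {x. s x = N} \<le> measure (measure_pmf \<mu>) {x. N \<le> s x}"
    by (intro always_eventually allI measure_pmf.finite_measure_mono) auto
qed simp

text \<open>The boundary of a box is crossed by arrivals of tasks from its face \<open>total n = N\<close> and of customers
  from its face \<open>total y = M\<close>.\<close>

lemma box_boundary:
  fixes M N :: nat
  assumes L: "\<And>i k y. lam i k y \<le> L"
  defines "A \<equiv> {y :: 's config. total y \<le> M} \<times> {n :: 's config. total n \<le> N}"
  shows "(\<Sum>u\<in>A. \<Sum>w\<in>rates.targets u - A. pmf equilibrium u * net u w) \<le>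
    real (card {y :: 's config. total y \<le> M} * card (UNIV :: 's set)) * L * measure equilibrium {x. total (snd x) = N} +
    (\<Sum>p\<in>UNIV. eta p) * measure equilibrium {x. total (fst x) = M}"
proof -
  let ?Y = "{y :: 's config. total y \<le> M}" and ?S = "real (card (UNIV :: 's set))" and ?e = "\<Sum>p\<in>UNIV. eta p"
  let ?p = "pmf equilibrium"
  have A: "finite A" unfolding A_def by (intro finite_cartesian_product finite_total_le)
  have L0: "0 \<le> L" using L[of undefined 0 undefined] lam_nonneg[of undefined 0 undefined] by linarith
  let ?a = "\<lambda>u. if total (snd u) = N then ?S * L * ?p (\<lambda>_. 0, snd u) else 0"
  let ?b = "\<lambda>u. if total (fst u) = M then ?e * ?p u else 0"
  have "(\<Sum>w\<in>rates.targets u - A. ?p u * net u w) \<le> ?a u + ?b u" if u: "u \<in> A" for u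
  proof -
    obtain y n where yn: "u = (y, n)" "total y \<le> M" "total n \<le> N" using u by (auto simp: A_def)
    have p: "?p u * r = (W u * r) / \<Xi>" for r by (simp add: pmf_equilibrium)
    have "(\<Sum>w\<in>rates.targets u - A. net u w) = (\<Sum>w\<in>rates.targets u. net u w * indicator (- A) w)"
      using finite_targets_net by (intro sum.mono_neutral_cong_left) (auto simp: indicator_def)
    also have "\<dots> = (\<Sum>\<tau>\<in>UNIV. if enabled \<tau> u then rate \<tau> u * indicator (- A) (target \<tau> u) else 0)"
      by (rule sum_net)
    also have "\<dots> = (\<Sum>\<tau>\<in>UNIV. case \<tau> of Arrival p \<Rightarrow> (if total n = N then rate \<tau> u else 0)
        | Customer_in p \<Rightarrow> (if total y = M then rate \<tau> u else 0) | _ \<Rightarrow> 0)"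
    proof (rule sum.cong[OF refl])
      fix \<tau> :: "'s transition"
      show "(if enabled \<tau> u then rate \<tau> u * indicator (- A) (target \<tau> u) else 0) =
        (case \<tau> of Arrival p \<Rightarrow> (if total n = N then rate \<tau> u else 0)
        | Customer_in p \<Rightarrow> (if total y = M then rate \<tau> u else 0) | _ \<Rightarrow> 0)"
      proof (cases \<tau>)
        case (Departure p)
        then show ?thesis using yn total_remove_at[of n p] by (auto simp: A_def)
      next
        case (Customer_out p)
        then show ?thesis using yn total_remove_at[of y p] by (auto simp: A_def)
      next
        case (Unmark_move j l)
        then have "enabled \<tau> u \<Longrightarrow> j \<noteq> l" by (auto simp: yn)
        then show ?thesis using yn Unmark_move by (auto simp: A_def total_move)
      next
        case (Mark_move j l)
        then have "enabled \<tau> u \<Longrightarrow> j \<noteq> l" by (auto simp: yn)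
        then show ?thesis using yn Mark_move by (auto simp: A_def total_move)
      qed (use yn in \<open>auto simp: A_def total_move total_add_at\<close>)
    qed
    also have "\<dots> = (if total n = N then \<Sum>p\<in>UNIV. rate (Arrival p) u else 0) +
        (if total y = M then \<Sum>p\<in>UNIV. rate (Customer_in p) u else 0)"
      by (simp add: sum_transition)
    finally have sum: "(\<Sum>w\<in>rates.targets u - A. net u w) = \<dots>" .
    have "?p u * (\<Sum>p\<in>UNIV. rate (Arrival p) u) = (\<Sum>p\<in>UNIV. W u * rate (Arrival p) u) / \<Xi>"
      by (simp only: p sum_distrib_left sum_divide_distrib)
    also have "\<dots> \<le> (\<Sum>p\<in>(UNIV :: 's set). L * W (\<lambda>_. 0, n)) / \<Xi>"
      unfolding yn(1) using \<Xi>_pos by (intro divide_right_mono sum_mono W_arrival_le L) simp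
    finally have a: "?p u * (\<Sum>p\<in>UNIV. rate (Arrival p) u) \<le> ?S * L * ?p (\<lambda>_. 0, n)"
      by (simp add: pmf_equilibrium)
    have "?p u * (\<Sum>p\<in>UNIV. rate (Customer_in p) u) = (\<Sum>p\<in>UNIV. W u * rate (Customer_in p) u) / \<Xi>"
      by (simp only: p sum_distrib_left sum_divide_distrib)
    also have "\<dots> \<le> (\<Sum>p\<in>UNIV. eta p * W u) / \<Xi>"
      unfolding yn(1) using \<Xi>_pos by (intro divide_right_mono sum_mono W_customer_in_le) simp
    finally have b: "?p u * (\<Sum>p\<in>UNIV. rate (Customer_in p) u) \<le> ?e * ?p u"
      by (simp add: pmf_equilibrium sum_distrib_right)
    have "(\<Sum>w\<in>rates.targets u - A. ?p u * net u w) = ?p u * (\<Sum>w\<in>rates.targets u - A. net u w)"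
      by (simp add: sum_distrib_left)
    also have "\<dots> \<le> ?a u + ?b u"
      unfolding sum using a b by (auto simp: yn(1) distrib_left)
    finally show ?thesis .
  qed
  then have "(\<Sum>u\<in>A. \<Sum>w\<in>rates.targets u - A. ?p u * net u w) \<le> (\<Sum>u\<in>A. ?a u) + (\<Sum>u\<in>A. ?b u)"
    unfolding sum.distrib[symmetric] by (rule sum_mono)
  moreover have "(\<Sum>u\<in>A. ?a u) \<le> real (card ?Y * card (UNIV :: 's set)) * L * measure equilibrium {x. total (snd x) = N}"
  proof -
    let ?Z = "{n :: 's config. total n \<le> N}"
    let ?f = "\<lambda>n. if total n = N then ?S * L * ?p (\<lambda>_. 0, n) else 0"
    have "(\<Sum>u\<in>A. ?a u) = (\<Sum>(y, n)\<in>?Y \<times> ?Z. ?f n)"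
      unfolding A_def by (intro sum.cong) auto
    also have "\<dots> = (\<Sum>y\<in>?Y. \<Sum>n\<in>?Z. ?f n)"
      by (rule sum.cartesian_product[symmetric])
    also have "\<dots> = real (card ?Y) * (\<Sum>n\<in>?Z. ?f n)"
      by (rule sum_constant)
    also have "(\<Sum>n\<in>?Z. if total n = N then ?S * L * ?p (\<lambda>_. 0, n) else 0) = ?S * L * (\<Sum>n | total n = N. ?p (\<lambda>_. 0, n))"
      unfolding sum_distrib_left using finite_total_le by (intro sum.mono_neutral_cong_right) auto
    also have "(\<Sum>n | total n = N. ?p (\<lambda>_. 0, n)) = (\<Sum>x\<in>Pair (\<lambda>_. 0) ` {n. total n = N}. ?p x)"
      by (subst sum.reindex) (auto simp: inj_on_def)
    also have "\<dots> = measure equilibrium (Pair (\<lambda>_. 0) ` {n. total n = N})"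
      by (subst measure_measure_pmf_finite) (auto intro: finite_subset[OF _ finite_total_le[of N]])
    also have "\<dots> \<le> measure equilibrium {x. total (snd x) = N}"
      by (intro measure_pmf.finite_measure_mono) auto
    finally show ?thesis using L0 by (simp add: mult_left_mono mult.assoc)
  qed
  moreover have "(\<Sum>u\<in>A. ?b u) \<le> ?e * measure equilibrium {x. total (fst x) = M}"
  proof -
    have "(\<Sum>u\<in>A. ?b u) = ?e * (\<Sum>u\<in>A \<inter> {x. total (fst x) = M}. ?p u)"
      unfolding sum_distrib_left using A by (intro sum.mono_neutral_cong_right) auto
    also have "(\<Sum>u\<in>A \<inter> {x. total (fst x) = M}. ?p u) = measure equilibrium (A \<inter> {x. total (fst x) = M})"
      using A by (subst measure_measure_pmf_finite) auto
    also have "\<dots> \<le> measure equilibrium {x. total (fst x) = M}"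
      by (intro measure_pmf.finite_measure_mono) auto
    finally show ?thesis by (simp add: mult_left_mono sum_nonneg less_imp_le[OF eta_pos])
  qed
  ultimately show ?thesis by linarith
qed

lemma small_boundary:
  assumes "0 < \<epsilon>"
  shows "\<exists>A. finite A \<and> x \<in> A \<and> (\<Sum>u\<in>A. \<Sum>w\<in>rates.targets u - A. pmf equilibrium u * net u w) \<le> \<epsilon>"
proof -
  obtain L where L: "\<And>i k y. lam i k y \<le> L" using lam_bounded by blast
  let ?e = "\<Sum>p\<in>UNIV. eta p"
  have "(\<lambda>M. ?e * measure equilibrium {x. total (fst x) = M}) \<longlonglongrightarrow> 0"
    by (intro tendsto_mult_right_zero measure_level_tendsto_0)
  then have "\<forall>\<^sub>F M in sequentially. ?e * measure equilibrium {x. total (fst x) = M} < \<epsilon> / 2"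
    using assms by (intro order_tendstoD(2)) auto
  with eventually_ge_at_top[of "total (fst x)"]
  obtain M where M: "total (fst x) \<le> M" "?e * measure equilibrium {x. total (fst x) = M} < \<epsilon> / 2"
    using eventually_happens'[OF sequentially_bot] eventually_conj by blast
  let ?c = "real (card {y :: 's config. total y \<le> M} * card (UNIV :: 's set)) * L"
  have "(\<lambda>N. ?c * measure equilibrium {x. total (snd x) = N}) \<longlonglongrightarrow> 0"
    by (intro tendsto_mult_right_zero measure_level_tendsto_0)
  then have "\<forall>\<^sub>F N in sequentially. ?c * measure equilibrium {x. total (snd x) = N} < \<epsilon> / 2"
    using assms by (intro order_tendstoD(2)) auto
  with eventually_ge_at_top[of "total (snd x)"]
  obtain N where N: "total (snd x) \<le> N" "?c * measure equilibrium {x. total (snd x) = N} < \<epsilon> / 2"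
    using eventually_happens'[OF sequentially_bot] eventually_conj by blast
  let ?A = "{y :: 's config. total y \<le> M} \<times> {n :: 's config. total n \<le> N}"
  have "finite ?A" by (intro finite_cartesian_product finite_total_le)
  moreover have "x \<in> ?A" using M(1) N(1) by (cases x) auto
  moreover have "(\<Sum>u\<in>?A. \<Sum>w\<in>rates.targets u - ?A. pmf equilibrium u * net u w) \<le> \<epsilon>"
    using box_boundary[OF L, of M N] M(2) N(2) by linarith
  ultimately show ?thesis by blast
qed

sublocale rates: ergodic_rates net equilibrium "(\<lambda>_. 0, \<lambda>_. 0)"
proof
  show "accessible net x (\<lambda>_. 0, \<lambda>_. 0)" for x by (rule accessible_empty)
  show "(\<lambda>_. 0, \<lambda>_. 0) \<in> set_pmf equilibrium" by (simp add: set_equilibrium W_empty)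
  show "inessential x = 0" for x using inessential_eq_0 by (cases x) simp
qed (rule small_boundary)

end

theorem theorem5p2:
  fixes lam mu :: "'s::finite \<Rightarrow> nat \<Rightarrow> 's config \<Rightarrow> real"
    and gam :: "'s \<Rightarrow> nat \<Rightarrow> real"
    and xi eta :: "'s \<Rightarrow> real"
    and beta theta eps :: "'s \<Rightarrow> 's \<Rightarrow> nat \<Rightarrow> nat \<Rightarrow> 's config \<Rightarrow> real"
    and tau :: "'s \<Rightarrow> 's \<Rightarrow> 's config \<Rightarrow> 's config \<Rightarrow> real"
  assumes lam_nonneg: "\<And>i n y. lam i n y \<ge> 0"
    and lam_bounded: "\<exists>L. \<forall>i n y. lam i n y \<le> L"
    and lam_support: "\<And>i n y. lam i (n + 1) y > 0 \<Longrightarrow> lam i n y > 0"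
    and mu_bounded_below: "\<exists>m>0. \<forall>i n y. n \<ge> 1 \<longrightarrow> m \<le> mu i n y"
    and gam_nonneg: "\<And>i n. gam i n \<ge> 0"
    and gam_0: "\<And>i. gam i 0 = 1"
    and gam_support: "\<And>i n. gam i (n + 1) > 0 \<Longrightarrow> gam i n > 0"
    and xi_pos: "\<And>k. xi k > 0"
    and eta_pos: "\<And>k. eta k > 0"
    and gam_bar_pos: "\<And>y n j j'. y j \<ge> (1::nat) \<Longrightarrow> j' \<noteq> j \<Longrightarrow>
          gam_bar gam j (n j) > 0 \<and> gam_bar gam j' (n j') > 0"
    and indep: "\<And>n y y'.
          (\<Prod>q\<in>UNIV. lam_bar lam q (n q) y / mu_bar mu q (n q) y) =
          (\<Prod>q\<in>UNIV. lam_bar lam q (n q) y' / mu_bar mu q (n q) y')"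
    and beta_pos: "\<And>n y k l. k \<noteq> l \<Longrightarrow> y k = 0 \<Longrightarrow> y l = 0 \<Longrightarrow> beta k l (n k) (n l) y > 0"
    and theta_pos: "\<And>n y j k. y j \<ge> 1 \<Longrightarrow> y k = 0 \<Longrightarrow>
          theta j k (n j) (n k) y > 0 \<and> theta k j (n k) (n j) y > 0"
    and eps_pos: "\<And>n y i j. i \<noteq> j \<Longrightarrow> y i \<ge> 1 \<Longrightarrow> y j \<ge> 1 \<Longrightarrow> eps i j (n i) (n j) y > 0"
    and tau_pos: "\<And>n y j j'. y j \<ge> 1 \<Longrightarrow> j' \<noteq> j \<Longrightarrow> tau j j' n y > 0"
    and beta_balance: "\<And>n y k l. k \<noteq> l \<Longrightarrow> y k = 0 \<Longrightarrow> y l = 0 \<Longrightarrow> n k \<ge> 1 \<Longrightarrow>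
          lam k (n k - 1) y / mu k (n k) y * beta k l (n k) (n l) y =
          lam l (n l) y / mu l (n l + 1) y * beta l k (n l + 1) (n k - 1) y"
    and theta_balance: "\<And>n y j k. y j \<ge> 1 \<Longrightarrow> y k = 0 \<Longrightarrow> n j \<ge> 1 \<Longrightarrow>
          lam j (n j - 1) y / mu j (n j) y * theta j k (n j) (n k) y =
          lam k (n k) y / mu k (n k + 1) y * theta k j (n k + 1) (n j - 1) y"
    and eps_balance: "\<And>n y i j. i \<noteq> j \<Longrightarrow> y i \<ge> 1 \<Longrightarrow> y j \<ge> 1 \<Longrightarrow> n i \<ge> 1 \<Longrightarrow>
          lam i (n i - 1) y * gam i (n i - 1) ^ y i / mu i (n i) y * eps i j (n i) (n j) y =
          lam j (n j) y * gam j (n j) ^ y j / mu j (n j + 1) y * eps j i (n j + 1) (n i - 1) y"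
    and tau_balance: "\<And>n y j j'. y j \<ge> 1 \<Longrightarrow> j' \<noteq> j \<Longrightarrow>
          tau j j' n y * (xi j / eta j) = tau j' j n (move j j' y) * (xi j' / eta j')"
    and Xi_finite: "Xi_sum lam mu gam xi eta < \<infinity>"
  shows "positive_recurrent (network_rate lam mu gam xi eta beta theta eps tau) \<and>
    (\<exists>\<pi> :: 's state pmf.
       (\<forall>y n. pmf \<pi> (y, n) =
          1 / enn2real (Xi_sum lam mu gam xi eta)
            * (\<Prod>p\<in>UNIV. lam_bar lam p (n p) y / mu_bar mu p (n p) y)
            * (\<Prod>q\<in>UNIV. (xi q / eta q * gam_bar gam q (n q)) ^ y q)) \<and>
       reversible_from (network_rate lam mu gam xi eta beta theta eps tau) \<pi> \<and>
       (\<forall>\<nu>. stationary_distribution (network_rate lam mu gam xi eta beta theta eps tau) \<nu>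
              \<longleftrightarrow> \<nu> = \<pi>))"
proof -
  interpret network lam mu gam xi eta beta theta eps tau
    by unfold_locales (fact assms)+
  show ?thesis
    using rates.positive_recurrent rates.reversible rates.stationary_iff
    by (intro conjI exI[of _ equilibrium]) (auto simp: pmf_equilibrium W_eq)
qed

end
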